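(* For $0\le s\le N-1$ let $V_s$ be the subspace of $\varOmega[X]$ on which $\mu_N$ acts through the character $\zeta\mapsto\zeta^s$, so that $\varOmega[X]=\bigoplus_{s=0}^{N-1}V_s$. Put $$d_s=\max\left\{0,\ \left\lfloor\frac{s\sum_{k=0}^r A_k-(N,N-\sum_{k=0}^r A_k)}{N}\right\rfloor-\sum_{j=0}^r\left\lceil\frac{sA_j+(N,A_j)}{N}-1\right\rceil\right\},$$ $$e_{s,j}=\left\lceil\frac{sA_j+(N,A_j)}{N}-1\right\rceil\qquad(0\le j\le r).$$ Then $\dim V_s=d_s$. Moreover, a basis of $V_s$ is given by $$x^m\,\frac{\prod_{j=0}^r(x-\lambda_j)^{e_{s,j}}}{y^s}\,dx,\qquad 0\le m\le d_s-1.$$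
   Context: Let $K$ be a field, $N\ge 1$ an integer that is not a multiple of the characteristic of $K$, and $f(x)=\prod_{i=0}^r(x-\lambda_i)^{A_i}\in K[x]$ with integers $A_i\ge1$, pairwise distinct $\lambda_0,\dots,\lambda_r\in\overline K$, and $\gcd(N,A_0,\dots,A_r)=1$. Assume that $K$ contains all $\lambda_i$ and the group $\mu_N\subset\overline K^\times$ of $N$-th roots of unity. The symbol $(a,b)$ with integers $a,b$ denotes the greatest common divisor, with $(N,0)=N$. $C\subset\mathbb P^2_K$ is the projective closure of the (irreducible) affine curve $y^N=f(x)$, and $\pi:X\to C$ is its desingularization: $X$ is the nonsingular projective curve with function field $K(x,y)$. $\varOmega[X]$ is the $K$-space of regular (everywhere holomorphic) differential forms on $X$, regarded inside the space of rational differential forms of $K(x,y)$. For $\zeta\in\mu_N$ let $\iota_\zeta$ be the automorphism of $X$ induced by $(x,y)\mapsto(x,\zeta y)$. The group $\mu_N$ acts on differential forms by $\zeta\cdot\omega=(\iota_\zeta^{-1})^*\omega$, so that $\zeta\cdot(g(x)\,dx/y^s)=\zeta^s g(x)\,dx/y^s$ for $g(x)\in K(x)$. *)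

theory Defs
  imports
    "HOL-Algebra.Algebraic_Closure_Type"
    "HOL-Library.Poly_Mapping"
    "HOL-Library.FuncSet"
begin

text \<open>
  A field extension \<open>F/K\<close> is a pair of field types \<open>'k\<close>, \<open>'f\<close> with an embedding
  \<open>\<iota> :: 'k \<Rightarrow> 'f\<close> (a unital ring homomorphism, hence injective).
\<close>

definition field_embedding :: "('a::field \<Rightarrow> 'b::field) \<Rightarrow> bool" where
  "field_embedding \<phi> \<longleftrightarrow> \<phi> 1 = 1 \<and> (\<forall>a b. \<phi> (a + b) = \<phi> a + \<phi> b) \<and> (\<forall>a b. \<phi> (a * b) = \<phi> a * \<phi> b)"

definition eval_at :: "('k::field \<Rightarrow> 'f::field) \<Rightarrow> 'k poly \<Rightarrow> 'f \<Rightarrow> 'f" where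
  "eval_at \<iota> p z = poly (map_poly \<iota> p) z"

definition subring_set :: "'a::field set \<Rightarrow> bool" where
  "subring_set S \<longleftrightarrow> 1 \<in> S \<and> (\<forall>a\<in>S. \<forall>b\<in>S. a - b \<in> S \<and> a * b \<in> S)"

definition subfield_set :: "'a::field set \<Rightarrow> bool" where
  "subfield_set S \<longleftrightarrow> subring_set S \<and> (\<forall>a\<in>S. inverse a \<in> S)"

text \<open>
  \<open>F = K(x,y)\<close> with \<open>x\<close> transcendental over \<open>K\<close> and \<open>y\<^sup>N = f(x)\<close>.  When \<open>T\<^sup>N - f(x)\<close> is
  irreducible over \<open>K(x)\<close>, this determines \<open>(F, x, y)\<close> up to a unique \<open>K\<close>-isomorphism:
  it is the function field of the affine curve \<open>y\<^sup>N = f(x)\<close>.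
\<close>

definition superelliptic_function_field ::
    "('k::field \<Rightarrow> 'f::field) \<Rightarrow> nat \<Rightarrow> 'k poly \<Rightarrow> 'f \<Rightarrow> 'f \<Rightarrow> bool" where
  "superelliptic_function_field \<iota> N f x y \<longleftrightarrow>
     field_embedding \<iota> \<and>
     (\<forall>p. p \<noteq> 0 \<longrightarrow> eval_at \<iota> p x \<noteq> 0) \<and>
     y ^ N = eval_at \<iota> f x \<and>
     (\<forall>S. subfield_set S \<and> range \<iota> \<subseteq> S \<and> x \<in> S \<and> y \<in> S \<longrightarrow> S = UNIV)"

text \<open>
  \<open>(\<Omega>, d)\<close> is the module of Kaehler differentials of \<open>F/K\<close>: the free \<open>F\<close>-module on the symbols
  \<open>[a]\<close>, \<open>a \<in> F\<close>, modulo \<open>[a + b] - [a] - [b]\<close>, \<open>[a b] - a [b] - b [a]\<close> and \<open>[c]\<close> for \<open>c \<in> K\<close>,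
  with \<open>d a\<close> the class of \<open>[a]\<close>.  It is given up to isomorphism by an \<open>F\<close>-vector space and a map
  \<open>d\<close> such that \<open>[a] \<mapsto> d a\<close> induces a surjection from the free module whose kernel is the
  submodule of relations.
\<close>

definition kaehler_relations :: "('k::field \<Rightarrow> 'f::field) \<Rightarrow> ('f \<Rightarrow>\<^sub>0 'f) set" where
  "kaehler_relations \<iota> =
     {Poly_Mapping.single (a + b) 1 - Poly_Mapping.single a 1 - Poly_Mapping.single b 1 | a b. True} \<union>
     {Poly_Mapping.single (a * b) 1 - Poly_Mapping.single b a - Poly_Mapping.single a b | a b. True} \<union>
     {Poly_Mapping.single (\<iota> c) 1 | c. True}"

definition free_to_forms ::
    "('f::field \<Rightarrow> 'w::ab_group_add \<Rightarrow> 'w) \<Rightarrow> ('f \<Rightarrow> 'w) \<Rightarrow> ('f \<Rightarrow>\<^sub>0 'f) \<Rightarrow> 'w" where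
  "free_to_forms scale d p =
     (\<Sum>a\<in>Poly_Mapping.keys p. scale (Poly_Mapping.lookup p a) (d a))"

definition kaehler_differentials ::
    "('k::field \<Rightarrow> 'f::field) \<Rightarrow> ('f \<Rightarrow> 'w::ab_group_add \<Rightarrow> 'w) \<Rightarrow> ('f \<Rightarrow> 'w) \<Rightarrow> bool" where
  "kaehler_differentials \<iota> scale d \<longleftrightarrow>
     vector_space scale \<and>
     surj (free_to_forms scale d) \<and>
     {p. free_to_forms scale d p = 0} =
       module.span (\<lambda>h. Poly_Mapping.map (\<lambda>c. h * c)) (kaehler_relations \<iota>)"

text \<open>
  The closed points of the nonsingular projective curve \<open>X\<close> with function field \<open>F\<close> correspond to
  their local rings, which are the valuation rings \<open>K \<subseteq> R \<subset> F\<close>.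
\<close>

definition places :: "('k::field \<Rightarrow> 'f::field) \<Rightarrow> 'f set set" where
  "places \<iota> = {R. subring_set R \<and> range \<iota> \<subseteq> R \<and> R \<noteq> UNIV \<and> (\<forall>h. h \<in> R \<or> inverse h \<in> R)}"

text \<open>
  The stalk of the sheaf of differentials at the point with local ring \<open>R\<close>, inside \<open>\<Omega>\<^bsub>F/K\<^esub>\<close>: the
  \<open>R\<close>-submodule generated by \<open>d a\<close>, \<open>a \<in> R\<close>.  Over an imperfect field \<open>K\<close> it need not be
  generated by \<open>d t\<close> for a uniformizer \<open>t\<close> of \<open>R\<close>.
\<close>

definition regular_forms_at ::
    "('f::field \<Rightarrow> 'w::ab_group_add \<Rightarrow> 'w) \<Rightarrow> ('f \<Rightarrow> 'w) \<Rightarrow> 'f set \<Rightarrow> 'w set" where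
  "regular_forms_at scale d R =
     {(\<Sum>a\<in>S. scale (u a) (d a)) | S u. finite S \<and> S \<subseteq> R \<and> u ` S \<subseteq> R}"

definition regular_forms ::
    "('k::field \<Rightarrow> 'f::field) \<Rightarrow> ('f \<Rightarrow> 'w::ab_group_add \<Rightarrow> 'w) \<Rightarrow> ('f \<Rightarrow> 'w) \<Rightarrow> 'w set" where
  "regular_forms \<iota> scale d = {\<omega>. \<forall>R\<in>places \<iota>. \<omega> \<in> regular_forms_at scale d R}"

definition K_scale ::
    "('k::field \<Rightarrow> 'f::field) \<Rightarrow> ('f \<Rightarrow> 'w::ab_group_add \<Rightarrow> 'w) \<Rightarrow> 'k \<Rightarrow> 'w \<Rightarrow> 'w" where
  "K_scale \<iota> scale c \<omega> = scale (\<iota> c) \<omega>"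

definition roots_of_unity :: "nat \<Rightarrow> 'a::field set" where
  "roots_of_unity N = {\<zeta>. \<zeta> ^ N = 1}"

text \<open>
  For the automorphism \<open>\<sigma>\<^sub>\<zeta> : (x,y) \<mapsto> (x, \<zeta> y)\<close> of \<open>X\<close>, the pullback \<open>\<sigma>\<^sub>\<zeta>\<^sup>*\<close> of rational functions is
  the \<open>K\<close>-automorphism of \<open>F\<close> with \<open>x \<mapsto> x\<close>, \<open>y \<mapsto> \<zeta> y\<close>.
\<close>

definition pullback_fun ::
    "('k::field \<Rightarrow> 'f::field) \<Rightarrow> 'f \<Rightarrow> 'f \<Rightarrow> 'k \<Rightarrow> 'f \<Rightarrow> 'f" where
  "pullback_fun \<iota> x y \<zeta> =
     (THE \<phi>. field_embedding \<phi> \<and> (\<forall>c. \<phi> (\<iota> c) = \<iota> c) \<and> \<phi> x = x \<and> \<phi> y = \<iota> \<zeta> * y)"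

text \<open>
  The pullback of forms along the automorphism of \<open>X\<close> whose pullback of functions is \<open>\<phi>\<close>:
  \<open>h da \<mapsto> \<phi>(h) d(\<phi>(a))\<close>.
\<close>

definition pullback_form ::
    "('f::field \<Rightarrow> 'w::ab_group_add \<Rightarrow> 'w) \<Rightarrow> ('f \<Rightarrow> 'w) \<Rightarrow> ('f \<Rightarrow> 'f) \<Rightarrow> 'w \<Rightarrow> 'w" where
  "pullback_form scale d \<phi> =
     (THE T. (\<forall>\<omega> \<eta>. T (\<omega> + \<eta>) = T \<omega> + T \<eta>) \<and>
             (\<forall>h a. T (scale h (d a)) = scale (\<phi> h) (d (\<phi> a))))"

text \<open>
  \<open>\<zeta> \<cdot> \<omega> = (\<sigma>\<^sub>\<zeta>\<^sup>-\<^sup>1)\<^sup>* \<omega>\<close>; the pullback of functions along \<open>\<sigma>\<^sub>\<zeta>\<^sup>-\<^sup>1\<close> is the inverse of the one along \<open>\<sigma>\<^sub>\<zeta>\<close>.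
\<close>

definition root_action ::
    "('k::field \<Rightarrow> 'f::field) \<Rightarrow> 'f \<Rightarrow> 'f \<Rightarrow> ('f \<Rightarrow> 'w::ab_group_add \<Rightarrow> 'w) \<Rightarrow> ('f \<Rightarrow> 'w) \<Rightarrow>
       'k \<Rightarrow> 'w \<Rightarrow> 'w" where
  "root_action \<iota> x y scale d \<zeta> = pullback_form scale d (Hilbert_Choice.inv (pullback_fun \<iota> x y \<zeta>))"

definition character_space ::
    "('k::field \<Rightarrow> 'f::field) \<Rightarrow> nat \<Rightarrow> 'f \<Rightarrow> 'f \<Rightarrow>
       ('f \<Rightarrow> 'w::ab_group_add \<Rightarrow> 'w) \<Rightarrow> ('f \<Rightarrow> 'w) \<Rightarrow> nat \<Rightarrow> 'w set" where
  "character_space \<iota> N x y scale d s =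
     {\<omega> \<in> regular_forms \<iota> scale d.
        \<forall>\<zeta>\<in>roots_of_unity N. root_action \<iota> x y scale d \<zeta> \<omega> = K_scale \<iota> scale (\<zeta> ^ s) \<omega>}"

definition e_num :: "nat \<Rightarrow> (nat \<Rightarrow> nat) \<Rightarrow> nat \<Rightarrow> nat \<Rightarrow> int" where
  "e_num N A s j = \<lceil>(of_nat (s * A j) + of_nat (gcd N (A j))) / of_nat N - (1 :: rat)\<rceil>"

definition d_num :: "nat \<Rightarrow> nat \<Rightarrow> (nat \<Rightarrow> nat) \<Rightarrow> nat \<Rightarrow> int" where
  "d_num N r A s =
     max 0 (\<lfloor>(of_nat (s * (\<Sum>k\<le>r. A k)) - of_int (gcd (int N) (int N - (\<Sum>k\<le>r. int (A k)))))
              / (of_nat N :: rat)\<rfloor>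
            - (\<Sum>j\<le>r. e_num N A s j))"

definition basis_form ::
    "('k::field \<Rightarrow> 'f::field) \<Rightarrow> nat \<Rightarrow> nat \<Rightarrow> (nat \<Rightarrow> nat) \<Rightarrow> (nat \<Rightarrow> 'k) \<Rightarrow> 'f \<Rightarrow> 'f \<Rightarrow>
       ('f \<Rightarrow> 'w::ab_group_add \<Rightarrow> 'w) \<Rightarrow> ('f \<Rightarrow> 'w) \<Rightarrow> nat \<Rightarrow> nat \<Rightarrow> 'w" where
  "basis_form \<iota> N r A lam x y scale d s m =
     scale (x ^ m * (\<Prod>j\<le>r. (x - \<iota> (lam j)) powi e_num N A s j) / y ^ s) (d x)"

end

theory Submission
  imports Defs
begin

text \<open>
  Write a form as \<open>h dx\<close>.  Averaging over \<open>\<mu>\<^sub>N\<close> splits \<open>h\<close> into components \<open>g(x) / y\<^sup>s\<close>, and regularity can be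
  tested on them because the automorphisms permute the places.  At a place \<open>R\<close> above \<open>\<lambda>\<^sub>j\<close> or infinity let
  \<open>\<xi>\<close> be the uniformizer \<open>x - \<lambda>\<^sub>j\<close> or \<open>1 / x\<close> of \<open>K(x)\<close>, and \<open>B\<close> the order of \<open>f\<close> in \<open>\<xi>\<close>.  Bezout's identity
  \<open>u B + v N = gcd(B, N)\<close> gives \<open>t = y\<^sup>u \<xi>\<^sup>v\<close> whose differential generates the regular forms at \<open>R\<close>, and since
  \<open>y\<^sup>N\<close> and \<open>t\<^sup>N\<close> are powers of \<open>\<xi>\<close> up to units, regularity of \<open>g(x) dx / y\<^sup>s\<close> is an inequality on the order
  of \<open>g\<close> in \<open>\<xi>\<close>.  At all other places \<open>dx\<close> generates.  Together the inequalities say that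
  \<open>g = p \<Prod> (x - \<lambda>\<^sub>j)\<^sup>e\<close>, \<open>e = e\<^sub>s\<^sub>,\<^sub>j\<close>, for a polynomial \<open>p\<close> of degree less than \<open>d\<^sub>s\<close>.  Working with \<open>N\<close>-th powers avoids
  normalized valuations and ramification indices.
\<close>

section \<open>Ring homomorphisms and derivations\<close>

text \<open>The hard half of "generates" is that \<open>D a\<close> must be controlled for every a
  in R. R is known only as a valuation ring, not as a discrete one, and the automorphisms may move
  it, so the eigencomponents of an element of R can leave R. \<open>integral_fraction\<close>
  repairs this: a = w / u, where all conjugates of u and w lie in R. Their components stay in R, and
  the quotient rule returns to a. K need not be perfect or algebraically closed; hence away from the
  branch points dx is used as generator, not the differential of a uniformizer. Irreducibility of
  T^N - f is derived from the gcd condition and yields both the automorphisms and the derivation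
  \<open>D\<close> = d/dx. That N is invertible in K enters in the averaging, in the extension of
  d/dx to y, and in showing that the logarithmic derivative of t is a unit. The gcd terms in the
  formulas are the order of t^N in \<xi>. At infinity f has order - deg f, and d(1/x) = - (1/x)^2 dx
  accounts for the different shape of d. Excluding poles of g requires enough places, which
  Chevalley's extension theorem supplies.\<close>

definition unital_hom :: "('a::comm_ring_1 \<Rightarrow> 'b::comm_ring_1) \<Rightarrow> bool" where
  "unital_hom \<phi> \<longleftrightarrow> \<phi> 1 = 1 \<and> (\<forall>a b. \<phi> (a + b) = \<phi> a + \<phi> b) \<and> (\<forall>a b. \<phi> (a * b) = \<phi> a * \<phi> b)"

definition derivation_along :: "('a::comm_ring_1 \<Rightarrow> 'b::comm_ring_1) \<Rightarrow> ('a \<Rightarrow> 'b) \<Rightarrow> bool" where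
  "derivation_along \<phi> \<delta> \<longleftrightarrow>
     (\<forall>a b. \<delta> (a + b) = \<delta> a + \<delta> b) \<and> (\<forall>a b. \<delta> (a * b) = \<phi> a * \<delta> b + \<delta> a * \<phi> b)"

text \<open>Coefficients may lie in any commutative ring, so that the construction can be iterated:
  first K[x] to F, then K[x][T] to F.\<close>

definition eval_hom :: "('a::comm_ring_1 \<Rightarrow> 'b::comm_ring_1) \<Rightarrow> 'b \<Rightarrow> 'a poly \<Rightarrow> 'b" where
  "eval_hom \<phi> z p = poly (map_poly \<phi> p) z"

lemma field_embedding_iff_unital_hom: "field_embedding \<phi> \<longleftrightarrow> unital_hom \<phi>"
  by (simp add: field_embedding_def unital_hom_def)

lemma eval_at_eq_eval_hom: "eval_at \<iota> p z = eval_hom \<iota> z p"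
  by (simp add: eval_at_def eval_hom_def)

context
  fixes \<phi> :: "'a::comm_ring_1 \<Rightarrow> 'b::comm_ring_1"
  assumes hom: "unital_hom \<phi>"
begin

lemma hom_1: "\<phi> 1 = 1"
  and hom_add: "\<phi> (a + b) = \<phi> a + \<phi> b"
  and hom_mult: "\<phi> (a * b) = \<phi> a * \<phi> b"
  using hom by (auto simp: unital_hom_def)

lemma hom_0: "\<phi> 0 = 0"
  using hom_add[of 0 0] by simp

lemma hom_uminus: "\<phi> (- a) = - \<phi> a"
  using hom_add[of a "- a"] by (simp add: hom_0 eq_neg_iff_add_eq_0 add.commute)

lemma hom_diff: "\<phi> (a - b) = \<phi> a - \<phi> b"
  using hom_add[of a "- b"] by (simp add: hom_uminus)

lemma hom_power: "\<phi> (a ^ n) = \<phi> a ^ n"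
  by (induction n) (auto simp: hom_1 hom_mult)

lemma hom_of_nat: "\<phi> (of_nat n) = of_nat n"
  by (induction n) (auto simp: hom_1 hom_add hom_0)

lemma hom_of_int: "\<phi> (of_int n) = of_int n"
  by (cases n) (auto simp: hom_of_nat hom_uminus hom_diff hom_1)

lemma hom_sum: "\<phi> (sum g S) = (\<Sum>i\<in>S. \<phi> (g i))"
  by (induction S rule: infinite_finite_induct) (auto simp: hom_0 hom_add)

lemma hom_prod: "\<phi> (prod g S) = (\<Prod>i\<in>S. \<phi> (g i))"
  by (induction S rule: infinite_finite_induct) (auto simp: hom_1 hom_mult)

lemma eval_hom_0: "eval_hom \<phi> z 0 = 0"
  by (simp add: eval_hom_def)

lemma eval_hom_pCons: "eval_hom \<phi> z (pCons a p) = \<phi> a + z * eval_hom \<phi> z p"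
  by (simp add: eval_hom_def map_poly_pCons hom_0)

lemma eval_hom_add: "eval_hom \<phi> z (p + q) = eval_hom \<phi> z p + eval_hom \<phi> z q"
proof (induction p arbitrary: q)
  case 0
  show ?case by (simp add: eval_hom_0)
next
  case (pCons a p)
  obtain b q' where q: "q = pCons b q'" by (cases q)
  show ?case
    using pCons(2)[of q'] by (simp add: q eval_hom_pCons hom_add algebra_simps)
qed

lemma eval_hom_smult: "eval_hom \<phi> z (smult a p) = \<phi> a * eval_hom \<phi> z p"
  by (induction p) (auto simp: eval_hom_0 eval_hom_pCons hom_mult algebra_simps)

lemma eval_hom_mult: "eval_hom \<phi> z (p * q) = eval_hom \<phi> z p * eval_hom \<phi> z q"
  by (induction p) (auto simp: eval_hom_0 eval_hom_pCons eval_hom_add eval_hom_smult hom_0 algebra_simps)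

lemma eval_hom_const: "eval_hom \<phi> z [:a:] = \<phi> a"
  by (simp add: eval_hom_pCons eval_hom_0)

lemma unital_hom_eval_hom: "unital_hom (eval_hom \<phi> z)"
  using eval_hom_const[of z 1] by (auto simp: unital_hom_def eval_hom_add eval_hom_mult hom_1 one_pCons)

lemma unital_hom_map_poly: "unital_hom (map_poly \<phi>)"
proof -
  have "map_poly \<phi> (p * q) = map_poly \<phi> p * map_poly \<phi> q" for p q
    by (rule poly_eqI) (simp add: coeff_map_poly hom_0 coeff_mult hom_sum hom_mult)
  moreover have "map_poly \<phi> (p + q) = map_poly \<phi> p + map_poly \<phi> q" for p q
    by (rule poly_eqI) (simp add: coeff_map_poly hom_0 hom_add)
  ultimately show ?thesis
    by (simp add: unital_hom_def hom_1)
qed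

end

lemma subring_range_hom: "unital_hom \<phi> \<Longrightarrow> subring_set (range \<phi>)" for \<phi> :: "'a::comm_ring_1 \<Rightarrow> 'b::field"
  unfolding subring_set_def
proof (intro conjI ballI)
  assume \<phi>: "unital_hom \<phi>"
  show "1 \<in> range \<phi>" using hom_1[OF \<phi>] by (metis rangeI)
  fix a b assume "a \<in> range \<phi>" "b \<in> range \<phi>"
  then show "a - b \<in> range \<phi>" "a * b \<in> range \<phi>"
    by (auto simp flip: hom_diff[OF \<phi>] hom_mult[OF \<phi>])
qed

lemma unital_hom_comp: "unital_hom \<phi> \<Longrightarrow> unital_hom \<psi> \<Longrightarrow> unital_hom (\<psi> \<circ> \<phi>)"
  by (auto simp: unital_hom_def)

context
  fixes \<phi> :: "'a::field \<Rightarrow> 'b::field"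
  assumes hom: "unital_hom \<phi>"
begin

lemma hom_eq_0_iff: "\<phi> a = 0 \<longleftrightarrow> a = 0"
  by (metis hom hom_0 hom_1 hom_mult mult_zero_left right_inverse zero_neq_one)

lemma hom_eq_iff: "\<phi> a = \<phi> b \<longleftrightarrow> a = b"
  using hom_eq_0_iff[of "a - b"] by (simp add: hom_diff[OF hom])

lemma hom_inverse: "\<phi> (inverse a) = inverse (\<phi> a)"
proof (cases "a = 0")
  case False
  then have "\<phi> a * \<phi> (inverse a) = 1"
    by (metis hom hom_1 hom_mult right_inverse)
  then show ?thesis by (metis inverse_unique)
qed (simp add: hom_0[OF hom])

lemma hom_divide: "\<phi> (a / b) = \<phi> a / \<phi> b"
  by (simp add: divide_inverse hom_mult[OF hom] hom_inverse)

end

lemma eval_hom_altdef: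
  fixes \<phi> :: "'a::comm_ring_1 \<Rightarrow> 'b::field"
  assumes "unital_hom \<phi>" and inj: "\<And>a. \<phi> a = 0 \<longleftrightarrow> a = 0"
  shows "eval_hom \<phi> z p = (\<Sum>i\<le>degree p. \<phi> (coeff p i) * z ^ i)"
proof -
  have "degree (map_poly \<phi> p) = degree p"
    by (rule degree_map_poly) (auto simp: inj)
  then show ?thesis
    by (simp add: eval_hom_def poly_altdef coeff_map_poly inj)
qed

lemma eval_hom_reflect_poly:
  fixes \<phi> :: "'a::field \<Rightarrow> 'b::field"
  assumes hom: "unital_hom \<phi>" and z: "z \<noteq> 0"
  shows "eval_hom \<phi> z (reflect_poly p) = z ^ degree p * eval_hom \<phi> (inverse z) p"
proof -
  have deg: "degree (map_poly \<phi> p) = degree p"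
    by (rule degree_map_poly) (auto simp: hom_eq_0_iff[OF hom])
  have "map_poly \<phi> (reflect_poly p) = reflect_poly (map_poly \<phi> p)"
    by (rule poly_eqI) (simp add: coeff_map_poly hom_0[OF hom] coeff_reflect_poly deg)
  then show ?thesis
    using poly_reflect_poly_nz[OF z, of "map_poly \<phi> p"] by (simp add: eval_hom_def deg)
qed

text \<open>The derivation of a polynomial ring with prescribed value z' on the variable:
  coefficients are differentiated by \<open>\<delta>\<close>, and the second term is the chain rule.
  Values are taken after evaluation at z, which makes it a derivation along
  \<open>eval_hom \<phi> z\<close>.\<close>

definition poly_derivation ::
    "('a::idom \<Rightarrow> 'b::comm_ring_1) \<Rightarrow> ('a \<Rightarrow> 'b) \<Rightarrow> 'b \<Rightarrow> 'b \<Rightarrow> 'a poly \<Rightarrow> 'b" where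
  "poly_derivation \<phi> \<delta> z z' p = poly (map_poly \<delta> p) z + z' * eval_hom \<phi> z (pderiv p)"

context
  fixes \<phi> \<delta> :: "'a::idom \<Rightarrow> 'b::comm_ring_1" and z z' :: 'b
  assumes hom: "unital_hom \<phi>" and der: "derivation_along \<phi> \<delta>"
begin

lemma derivation_add: "\<delta> (a + b) = \<delta> a + \<delta> b"
  and derivation_mult: "\<delta> (a * b) = \<phi> a * \<delta> b + \<delta> a * \<phi> b"
  using der by (auto simp: derivation_along_def)

lemma derivation_0: "\<delta> 0 = 0"
  using derivation_add[of 0 0] by simp

lemma poly_derivation_0: "poly_derivation \<phi> \<delta> z z' 0 = 0"
  by (simp add: poly_derivation_def eval_hom_0[OF hom])

lemma poly_derivation_pCons:
  "poly_derivation \<phi> \<delta> z z' (pCons a p) =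
     \<delta> a + z' * eval_hom \<phi> z p + z * poly_derivation \<phi> \<delta> z z' p"
  by (simp add: poly_derivation_def map_poly_pCons derivation_0 pderiv_pCons eval_hom_add[OF hom]
      eval_hom_pCons[OF hom] hom_0[OF hom] algebra_simps)

lemma poly_derivation_add:
  "poly_derivation \<phi> \<delta> z z' (p + q) = poly_derivation \<phi> \<delta> z z' p + poly_derivation \<phi> \<delta> z z' q"
proof (induction p arbitrary: q)
  case 0
  show ?case by (simp add: poly_derivation_0)
next
  case (pCons a p)
  obtain b q' where q: "q = pCons b q'" by (cases q)
  show ?case
    using pCons(2)[of q']
    by (simp add: q poly_derivation_pCons eval_hom_add[OF hom] derivation_add algebra_simps)
qed

lemma poly_derivation_smult:
  "poly_derivation \<phi> \<delta> z z' (smult a p) =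
     \<phi> a * poly_derivation \<phi> \<delta> z z' p + \<delta> a * eval_hom \<phi> z p"
  by (induction p)
    (auto simp: poly_derivation_0 eval_hom_0[OF hom] poly_derivation_pCons eval_hom_pCons[OF hom]
      eval_hom_smult[OF hom] derivation_mult algebra_simps)

lemma derivation_along_poly_derivation:
  "derivation_along (eval_hom \<phi> z) (poly_derivation \<phi> \<delta> z z')"
proof -
  have "poly_derivation \<phi> \<delta> z z' (p * q) =
      eval_hom \<phi> z p * poly_derivation \<phi> \<delta> z z' q + poly_derivation \<phi> \<delta> z z' p * eval_hom \<phi> z q"
    for p q
    by (induction p)
      (auto simp: poly_derivation_0 eval_hom_0[OF hom] poly_derivation_pCons eval_hom_pCons[OF hom]
        eval_hom_smult[OF hom] eval_hom_add[OF hom] eval_hom_mult[OF hom] poly_derivation_add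
        poly_derivation_smult derivation_0 hom_0[OF hom] algebra_simps)
  then show ?thesis
    by (simp add: derivation_along_def poly_derivation_add)
qed

end

definition field_derivation :: "('f::field \<Rightarrow> 'f) \<Rightarrow> bool" where
  "field_derivation D \<longleftrightarrow> derivation_along id D"

context
  fixes D :: "'f::field \<Rightarrow> 'f"
  assumes D: "field_derivation D"
begin

lemma fd_add: "D (a + b) = D a + D b"
  and fd_mult: "D (a * b) = a * D b + D a * b"
  using D by (auto simp: field_derivation_def derivation_along_def)

lemma fd_0: "D 0 = 0"
  using fd_add[of 0 0] by (metis add_0_right add_left_cancel)

lemma fd_1: "D 1 = 0"
  using fd_mult[of 1 1] by (metis add_0_right add_left_cancel mult_1_left mult_1_right)

lemma fd_uminus: "D (- a) = - D a"
  using fd_add[of a "- a"] by (simp add: fd_0 eq_neg_iff_add_eq_0 add.commute)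

lemma fd_diff: "D (a - b) = D a - D b"
  using fd_add[of a "- b"] by (simp add: fd_uminus)

lemma fd_sum: "D (sum g S) = (\<Sum>i\<in>S. D (g i))"
  by (induction S rule: infinite_finite_induct) (auto simp: fd_0 fd_add)

lemma fd_inverse: "D (inverse a) = - D a / a\<^sup>2"
proof (cases "a = 0")
  case False
  then have "a * D (inverse a) + D a * inverse a = 0"
    using fd_mult[of a "inverse a"] by (simp add: fd_1)
  then have eq: "a * D (inverse a) = - (D a / a)"
    by (simp add: divide_inverse eq_neg_iff_add_eq_0)
  have "D (inverse a) = a * D (inverse a) / a"
    using False by simp
  also have "\<dots> = - (D a / a) / a"
    by (simp only: eq)
  finally show ?thesis by (simp add: power2_eq_square)
qed (simp add: fd_0)

lemma fd_dlog_mult: "a \<noteq> 0 \<Longrightarrow> b \<noteq> 0 \<Longrightarrow> D (a * b) / (a * b) = D a / a + D b / b"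
  by (simp add: fd_mult field_simps)

lemma fd_dlog_inverse: "D (inverse a) / inverse a = - (D a / a)"
  by (cases "a = 0") (simp_all add: fd_inverse fd_0 power2_eq_square)

lemma fd_dlog_power: "a \<noteq> 0 \<Longrightarrow> D (a ^ n) / a ^ n = of_nat n * (D a / a)"
proof (induction n)
  case (Suc n)
  then have "D (a * a ^ n) / (a * a ^ n) = D a / a + of_nat n * (D a / a)"
    by (subst fd_dlog_mult) auto
  then show ?case by (simp only: power_Suc of_nat_Suc distrib_right mult_1_left)
qed (simp add: fd_1)

lemma fd_dlog_powi: "a \<noteq> 0 \<Longrightarrow> D (a powi k) / a powi k = of_int k * (D a / a)"
  by (cases k rule: int_cases3)
    (auto simp: power_int_minus fd_dlog_power fd_dlog_inverse fd_1)

end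

section \<open>Extending homomorphisms and derivations to fractions\<close>

context
  fixes ev :: "'a::idom \<Rightarrow> 'f::field"
  assumes hom: "unital_hom ev"
    and frac: "\<And>h. \<exists>P Q. ev Q \<noteq> 0 \<and> h = ev P / ev Q"
begin

lemma clear_denominators: "\<exists>P Q. ev Q \<noteq> 0 \<and> ev P = h * ev Q"
proof -
  obtain P Q where "ev Q \<noteq> 0" "h = ev P / ev Q" using frac by blast
  then have "ev Q \<noteq> 0 \<and> ev P = h * ev Q" by simp
  then show ?thesis by blast
qed

text \<open>Equal kernels let \<open>\<psi>\<close> factor through the image of \<open>ev\<close>
  and keep nonzero denominators nonzero, so \<open>\<psi> P / \<psi> Q\<close> depends only on the
  fraction.\<close>

lemma hom_extends_to_fractions:
  fixes \<psi> :: "'a \<Rightarrow> 'f"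
  assumes \<psi>: "unital_hom \<psi>" and ker: "\<And>P. ev P = 0 \<longleftrightarrow> \<psi> P = 0"
  shows "\<exists>\<sigma>. unital_hom \<sigma> \<and> (\<forall>P. \<sigma> (ev P) = \<psi> P)"
proof -
  define rep where "rep h = (SOME PQ. ev (snd PQ) \<noteq> 0 \<and> ev (fst PQ) = h * ev (snd PQ))" for h
  have rep: "ev (snd (rep h)) \<noteq> 0 \<and> ev (fst (rep h)) = h * ev (snd (rep h))" for h
  proof -
    obtain P Q where PQ: "ev Q \<noteq> 0 \<and> ev P = h * ev Q" using clear_denominators by blast
    show ?thesis
      unfolding rep_def by (rule someI_ex, rule exI[of _ "(P, Q)"]) (use PQ in simp)
  qed
  define \<sigma> where "\<sigma> h = \<psi> (fst (rep h)) / \<psi> (snd (rep h))" for h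
  \<comment> \<open>With this, any representation of h may be used and not only the chosen one; sums
    and products can then be computed over common denominators.\<close>
  have \<sigma>: "\<sigma> h * \<psi> Q = \<psi> P" if P: "h * ev Q = ev P" for h P Q
  proof -
    let ?P = "fst (rep h)" and ?Q = "snd (rep h)"
    have Q': "ev ?Q \<noteq> 0" and P': "ev ?P = h * ev ?Q"
      using rep[of h] by auto
    have "ev (P * ?Q - ?P * Q) = 0"
      by (simp add: hom_diff[OF hom] hom_mult[OF hom] P[symmetric] P')
    then have "\<psi> (P * ?Q - ?P * Q) = 0" using ker by blast
    then have "\<psi> ?P * \<psi> Q = \<psi> P * \<psi> ?Q"
      by (simp add: hom_diff[OF \<psi>] hom_mult[OF \<psi>])
    moreover have "\<psi> ?Q \<noteq> 0" using ker Q' by auto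
    ultimately show ?thesis
      by (simp add: \<sigma>_def nonzero_divide_eq_eq)
  qed
  have ev\<sigma>: "\<sigma> (ev P) = \<psi> P" for P
    using \<sigma>[of "ev P" 1 P] by (simp add: hom_1[OF hom] hom_1[OF \<psi>])
  have "\<sigma> (a + b) = \<sigma> a + \<sigma> b \<and> \<sigma> (a * b) = \<sigma> a * \<sigma> b" for a b
  proof -
    obtain P Q where a: "ev Q \<noteq> 0" "a * ev Q = ev P" using clear_denominators[of a] by metis
    obtain P' Q' where b: "ev Q' \<noteq> 0" "b * ev Q' = ev P'" using clear_denominators[of b] by metis
    have ne: "\<psi> Q * \<psi> Q' \<noteq> 0"
      using a b ker by auto
    have "\<sigma> (a + b) * \<psi> (Q * Q') = \<psi> (P * Q' + P' * Q)"
      by (rule \<sigma>) (simp add: hom_add[OF hom] hom_mult[OF hom] a(2)[symmetric] b(2)[symmetric] algebra_simps)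
    also have "\<dots> = (\<sigma> a + \<sigma> b) * (\<psi> Q * \<psi> Q')"
      by (simp add: hom_add[OF \<psi>] hom_mult[OF \<psi>] \<sigma>[OF a(2), symmetric] \<sigma>[OF b(2), symmetric] algebra_simps)
    finally have 1: "\<sigma> (a + b) = \<sigma> a + \<sigma> b"
      using ne by (simp add: hom_mult[OF \<psi>])
    have "\<sigma> (a * b) * \<psi> (Q * Q') = \<psi> (P * P')"
      by (rule \<sigma>) (simp add: hom_mult[OF hom] a(2)[symmetric] b(2)[symmetric] algebra_simps)
    also have "\<dots> = (\<sigma> a * \<sigma> b) * (\<psi> Q * \<psi> Q')"
      by (simp add: hom_mult[OF \<psi>] \<sigma>[OF a(2), symmetric] \<sigma>[OF b(2), symmetric] algebra_simps)
    finally have 2: "\<sigma> (a * b) = \<sigma> a * \<sigma> b"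
      using ne by (simp add: hom_mult[OF \<psi>])
    show ?thesis using 1 2 ..
  qed
  moreover have "\<sigma> 1 = 1" using ev\<sigma>[of 1] by (simp add: hom_1[OF hom] hom_1[OF \<psi>])
  ultimately show ?thesis using ev\<sigma> by (auto simp: unital_hom_def)
qed

text \<open>The quotient rule dictates the value (\<open>\<Delta> P\<close> - h
  \<open>\<Delta> Q\<close>) / \<open>ev Q\<close>. Vanishing of \<open>\<Delta>\<close> on the
  kernel of \<open>ev\<close> makes it independent of the chosen P and Q.\<close>

lemma derivation_extends_to_fractions:
  fixes \<Delta> :: "'a \<Rightarrow> 'f"
  assumes der: "derivation_along ev \<Delta>" and ker: "\<And>P. ev P = 0 \<Longrightarrow> \<Delta> P = 0"
  shows "\<exists>D. field_derivation D \<and> (\<forall>P. D (ev P) = \<Delta> P)"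
proof -
  note d_mult = derivation_mult[OF hom der] and d_add = derivation_add[OF hom der]
  define rep where "rep h = (SOME PQ. ev (snd PQ) \<noteq> 0 \<and> ev (fst PQ) = h * ev (snd PQ))" for h
  have rep: "ev (snd (rep h)) \<noteq> 0 \<and> ev (fst (rep h)) = h * ev (snd (rep h))" for h
  proof -
    obtain P Q where PQ: "ev Q \<noteq> 0 \<and> ev P = h * ev Q" using clear_denominators by blast
    show ?thesis
      unfolding rep_def by (rule someI_ex, rule exI[of _ "(P, Q)"]) (use PQ in simp)
  qed
  define D where "D h = (\<Delta> (fst (rep h)) - h * \<Delta> (snd (rep h))) / ev (snd (rep h))" for h
  have d_eq: "\<Delta> U = \<Delta> V" if "ev U = ev V" for U V
  proof -
    have "ev (U - V) = 0" using that by (simp add: hom_diff[OF hom])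
    then have "\<Delta> (U - V) = 0" by (rule ker)
    then show ?thesis using d_add[of "U - V" V] by simp
  qed
  have D: "D h * ev Q = \<Delta> P - h * \<Delta> Q" if P: "h * ev Q = ev P" for h P Q
  proof -
    let ?P = "fst (rep h)" and ?Q = "snd (rep h)"
    have Q': "ev ?Q \<noteq> 0" and P': "ev ?P = h * ev ?Q"
      using rep[of h] by auto
    have "\<Delta> (P * ?Q) = \<Delta> (?P * Q)"
      by (rule d_eq) (simp add: hom_mult[OF hom] P[symmetric] P')
    then have "h * ev Q * \<Delta> ?Q + \<Delta> P * ev ?Q = h * ev ?Q * \<Delta> Q + \<Delta> ?P * ev Q"
      by (simp add: d_mult P[symmetric] P')
    then have "(\<Delta> ?P - h * \<Delta> ?Q) * ev Q = (\<Delta> P - h * \<Delta> Q) * ev ?Q"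
      by (simp add: algebra_simps)
    then show ?thesis
      using Q' by (simp add: D_def nonzero_divide_eq_eq)
  qed
  have D': "\<Delta> P = D h * ev Q + h * \<Delta> Q" if P: "h * ev Q = ev P" for h P Q
    using D[OF P] by simp
  have d1: "\<Delta> 1 = 0" using d_mult[of 1 1] by (metis add_0_right add_left_cancel hom_1[OF hom] mult_1_left mult_1_right)
  have evD: "D (ev P) = \<Delta> P" for P
    using D[of "ev P" 1 P] by (simp add: hom_1[OF hom] d1)
  have "D (a + b) = D a + D b \<and> D (a * b) = a * D b + D a * b" for a b
  proof -
    obtain P Q where a: "ev Q \<noteq> 0" "a * ev Q = ev P" using clear_denominators[of a] by metis
    obtain P' Q' where b: "ev Q' \<noteq> 0" "b * ev Q' = ev P'" using clear_denominators[of b] by metis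
    have ne: "ev Q * ev Q' \<noteq> 0"
      using a b by auto
    have "D (a + b) * ev (Q * Q') = \<Delta> (P * Q' + P' * Q) - (a + b) * \<Delta> (Q * Q')"
      by (rule D) (simp add: hom_add[OF hom] hom_mult[OF hom] a(2)[symmetric] b(2)[symmetric] algebra_simps)
    also have "\<dots> = (D a + D b) * (ev Q * ev Q')"
      by (simp add: d_add d_mult D'[OF a(2)] D'[OF b(2)] a(2)[symmetric] b(2)[symmetric] algebra_simps)
    finally have 1: "D (a + b) = D a + D b"
      using ne by (simp add: hom_mult[OF hom])
    have "D (a * b) * ev (Q * Q') = \<Delta> (P * P') - (a * b) * \<Delta> (Q * Q')"
      by (rule D) (simp add: hom_add[OF hom] hom_mult[OF hom] a(2)[symmetric] b(2)[symmetric] algebra_simps)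
    also have "\<dots> = (a * D b + D a * b) * (ev Q * ev Q')"
      by (simp add: d_add d_mult D'[OF a(2)] D'[OF b(2)] a(2)[symmetric] b(2)[symmetric] algebra_simps)
    finally have 2: "D (a * b) = a * D b + D a * b"
      using ne by (simp add: hom_mult[OF hom])
    show ?thesis using 1 2 ..
  qed
  then show ?thesis using evD by (auto simp: field_derivation_def derivation_along_def)
qed

end

section \<open>Valuation rings\<close>

context
  fixes S :: "'a::field set"
  assumes S: "subring_set S"
begin

lemma subring_1: "1 \<in> S"
  and subring_diff: "a \<in> S \<Longrightarrow> b \<in> S \<Longrightarrow> a - b \<in> S"
  and subring_mult: "a \<in> S \<Longrightarrow> b \<in> S \<Longrightarrow> a * b \<in> S"
  using S by (auto simp: subring_set_def)

lemma subring_0: "0 \<in> S"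
  using subring_diff[OF subring_1 subring_1] by simp

lemma subring_uminus: "a \<in> S \<Longrightarrow> - a \<in> S"
  using subring_diff[OF subring_0, of a] by simp

lemma subring_add: "a \<in> S \<Longrightarrow> b \<in> S \<Longrightarrow> a + b \<in> S"
  using subring_diff[of a "- b"] subring_uminus[of b] by simp

lemma subring_power: "a \<in> S \<Longrightarrow> a ^ n \<in> S"
  by (induction n) (auto simp: subring_1 subring_mult)

lemma subring_sum: "(\<And>i. i \<in> I \<Longrightarrow> g i \<in> S) \<Longrightarrow> sum g I \<in> S"
  by (induction I rule: infinite_finite_induct) (auto simp: subring_0 subring_add)

lemma subring_prod: "(\<And>i. i \<in> I \<Longrightarrow> g i \<in> S) \<Longrightarrow> prod g I \<in> S"
  by (induction I rule: infinite_finite_induct) (auto simp: subring_1 subring_mult)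

definition adjoin :: "'a \<Rightarrow> 'a set" where
  "adjoin u = {poly p u | p. \<forall>i. coeff p i \<in> S}"

lemma subring_adjoin: "subring_set (adjoin u)"
  unfolding subring_set_def
proof (intro conjI ballI)
  have "\<forall>i. coeff 1 i \<in> S" by (auto simp: coeff_1 subring_0 subring_1)
  then show "1 \<in> adjoin u" unfolding adjoin_def by (force intro!: exI[of _ 1])
next
  fix a b
  assume "a \<in> adjoin u" "b \<in> adjoin u"
  then obtain p q where p: "a = poly p u" "\<forall>i. coeff p i \<in> S" and q: "b = poly q u" "\<forall>i. coeff q i \<in> S"
    by (auto simp: adjoin_def)
  show "a - b \<in> adjoin u"
    unfolding adjoin_def using p q by (auto intro!: exI[of _ "p - q"] subring_diff)
  show "a * b \<in> adjoin u"
    unfolding adjoin_def using p q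
    by (auto intro!: exI[of _ "p * q"] subring_sum subring_mult simp: coeff_mult)
qed

lemma subset_adjoin: "S \<subseteq> adjoin u"
proof
  fix a assume "a \<in> S"
  then show "a \<in> adjoin u"
    unfolding adjoin_def
    by (auto intro!: exI[of _ "[:a:]"] simp: coeff_pCons subring_0 split: nat.split)
qed

lemma self_in_adjoin: "u \<in> adjoin u"
  unfolding adjoin_def
  by (auto intro!: exI[of _ "[:0, 1:]"] simp: coeff_pCons subring_0 subring_1 split: nat.split)

text \<open>Elements congruent to 1 modulo t are closed under products;
  \<open>one_minus_unit\<close> needs this when it clears denominators.\<close>

lemma one_minus_power:
  assumes "t \<in> S" "b \<in> S"
  shows "\<exists>b'\<in>S. (1 - t * b) ^ k = 1 - t * b'"
proof (induction k)
  case 0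
  show ?case using subring_0 by (intro bexI[of _ 0]) auto
next
  case (Suc k)
  then obtain b' where b': "b' \<in> S" "(1 - t * b) ^ k = 1 - t * b'" by auto
  have "(1 - t * b) ^ Suc k = 1 - t * (b' + b - t * b * b')"
    by (simp only: power_Suc b'(2)) (simp add: algebra_simps)
  moreover have "b' + b - t * b * b' \<in> S"
    using assms b' by (intro subring_add subring_diff subring_mult)
  ultimately show ?case by blast
qed

text \<open>
  A subring that is maximal among those not containing \<open>inverse t\<close>: every \<open>1 - t b\<close> is a unit, and
  relations \<open>1 \<in> t S[u]\<close>, \<open>1 \<in> t S[1/u]\<close> can be played off against each other to lower their degrees.
\<close>

context
  fixes t :: 'a
  assumes t: "t \<in> S" "inverse t \<notin> S"
    and maximal: "\<And>u. u \<notin> S \<Longrightarrow> inverse t \<in> adjoin u"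
begin

lemma t_nz: "t \<noteq> 0"
  using t subring_0 by auto

lemma one_minus_unit:
  assumes b: "b \<in> S"
  shows "1 - t * b \<noteq> 0" "inverse (1 - t * b) \<in> S"
proof -
  have ne: "1 - t * b \<noteq> 0"
  proof
    assume "1 - t * b = 0"
    then have "inverse t = b" using t_nz by (simp add: inverse_unique)
    then show False using t b by simp
  qed
  show "1 - t * b \<noteq> 0" by (rule ne)
  show "inverse (1 - t * b) \<in> S"
  proof (rule ccontr)
    let ?w = "1 - t * b"
    assume "inverse ?w \<notin> S"
    then have "inverse t \<in> adjoin (inverse ?w)" by (rule maximal)
    then obtain p where p: "\<forall>i. coeff p i \<in> S" "inverse t = poly p (inverse ?w)"
      by (auto simp: adjoin_def)
    have w: "?w \<in> S" by (intro subring_diff subring_mult subring_1 t b)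
    \<comment> \<open>Clearing the powers of 1/w puts w^n / t into S. Since w^n = 1 - t b', this
      element is 1/t - b', which would force 1/t into S.\<close>
    have "inverse t * ?w ^ degree p = (\<Sum>i\<le>degree p. coeff p i * ?w ^ (degree p - i))"
    proof -
      have "inverse ?w ^ i * ?w ^ degree p = ?w ^ (degree p - i)" if "i \<le> degree p" for i
        using ne that by (simp add: power_diff power_inverse divide_inverse mult.commute)
      then show ?thesis
        by (simp add: p(2) poly_altdef sum_distrib_right mult.assoc)
    qed
    then have "inverse t * ?w ^ degree p \<in> S"
      using p w by (auto intro!: subring_sum subring_mult subring_power)
    moreover obtain b' where b': "b' \<in> S" "?w ^ degree p = 1 - t * b'"
      using one_minus_power[OF t(1) b] by blast
    ultimately have "inverse t * (1 - t * b') + b' \<in> S" by (auto intro: subring_add)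
    moreover have "inverse t * (1 - t * b') + b' = inverse t"
      using t_nz by (simp add: algebra_simps)
    ultimately show False using t by simp
  qed
qed

definition relation :: "'a \<Rightarrow> nat \<Rightarrow> bool" where
  "relation u n \<longleftrightarrow> (\<exists>c. (\<forall>i. c i \<in> S) \<and> (\<Sum>i\<le>n. t * c i * u ^ i) = 1)"

text \<open>In the relation for 1/u the constant part gathers into the unit 1 - t e_0. Multiplied by
  u^n, which clears all denominators because m \<le> n, it expresses u^n through lower powers of u
  with coefficients in t S. Substituting this for the top term of the relation for u lowers its
  degree.\<close>

lemma relation_reduce:
  assumes u: "u \<noteq> 0" and n: "relation u n" and m: "relation (inverse u) m" and mn: "1 \<le> m" "m \<le> n"
  shows "relation u (n - 1)"
proof -
  obtain c where c: "\<And>i. c i \<in> S" "(\<Sum>i\<le>n. t * c i * u ^ i) = 1"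
    using n by (auto simp: relation_def)
  obtain e where e: "\<And>i. e i \<in> S" "(\<Sum>i\<le>m. t * e i * inverse u ^ i) = 1"
    using m by (auto simp: relation_def)
  define w where "w = 1 - t * e 0"
  have w: "w \<noteq> 0" "inverse w \<in> S"
    using one_minus_unit[OF e(1)[of 0]] by (auto simp: w_def)
  have "(\<Sum>i\<le>m. t * e i * inverse u ^ i) = t * e 0 + (\<Sum>i=1..m. t * e i * inverse u ^ i)"
    by (simp add: sum.atLeast1_atMost_eq atLeast0AtMost[symmetric] sum.atLeast_Suc_atMost)
  then have "w = (\<Sum>i=1..m. t * e i * inverse u ^ i)"
    using e(2) by (simp add: w_def algebra_simps)
  then have "w * u ^ n = (\<Sum>i=1..m. t * e i * (inverse u ^ i * u ^ n))"
    by (simp add: sum_distrib_right mult.assoc)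
  also have "\<dots> = (\<Sum>i=1..m. t * e i * u ^ (n - i))"
    using mn u by (intro sum.cong) (auto simp: power_diff power_inverse divide_inverse mult.commute)
  also have "\<dots> = (\<Sum>i\<in>{n-m..<n}. t * e (n - i) * u ^ i)"
    using mn by (intro sum.reindex_bij_witness[of _ "\<lambda>i. n - i" "\<lambda>i. n - i"]) auto
  also have "\<dots> = (\<Sum>i<n. if n - m \<le> i then t * e (n - i) * u ^ i else 0)"
    by (intro sum.mono_neutral_cong_left) auto
  finally have wu: "w * u ^ n = \<dots>" .
  have "1 = (\<Sum>i<n. t * c i * u ^ i) + t * c n * u ^ n"
    using c(2) by (simp add: lessThan_Suc_atMost[symmetric])
  also have "t * c n * u ^ n = t * c n * inverse w * (w * u ^ n)"
    using w by simp
  also have "(\<Sum>i<n. t * c i * u ^ i) + t * c n * inverse w * (w * u ^ n) =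
      (\<Sum>i<n. t * (c i + (if n - m \<le> i then t * c n * inverse w * e (n - i) else 0)) * u ^ i)"
    unfolding wu sum_distrib_left sum.distrib[symmetric]
    by (intro sum.cong refl) (simp add: algebra_simps)
  also have "{..<n} = {..n-1}" using mn by auto
  finally show ?thesis
    unfolding relation_def using c(1) e(1) w t
    by (intro exI[of _ "\<lambda>i. c i + (if n - m \<le> i then t * c n * inverse w * e (n - i) else 0)"])
      (auto intro!: subring_add subring_mult subring_0)
qed

lemma no_relation_pair:
  assumes "u \<noteq> 0"
  shows "\<not> (relation u n \<and> relation (inverse u) m)"
  using assms
proof (induction "n + m" arbitrary: u n m rule: less_induct)
  case less
  have no0: "\<not> relation v 0" for v
  proof
    assume "relation v 0"
    then obtain c where "c \<in> S" "t * c = 1" by (auto simp: relation_def)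
    then show False using t by (auto dest: inverse_unique)
  qed
  show ?case
  proof
    assume *: "relation u n \<and> relation (inverse u) m"
    then have "n \<noteq> 0" "m \<noteq> 0" using no0 by (metis *)+
    consider "m \<le> n" | "n \<le> m" by linarith
    then show False
    proof cases
      case 1
      then have "relation u (n - 1)"
        using relation_reduce[of u n m] * less.prems \<open>m \<noteq> 0\<close> by auto
      then show False using less.hyps[of "n - 1" m u] * less.prems \<open>n \<noteq> 0\<close> by auto
    next
      case 2
      then have "relation (inverse u) (m - 1)"
        using relation_reduce[of "inverse u" m n] * less.prems \<open>n \<noteq> 0\<close> by auto
      then show False using less.hyps[of n "m - 1" u] * less.prems \<open>m \<noteq> 0\<close> by auto
    qed
  qed
qed

lemma maximal_subring_total: "u \<in> S \<or> inverse u \<in> S"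
proof (rule ccontr)
  have rel: "\<exists>n. relation u n" if u: "inverse t \<in> adjoin u" for u
  proof -
    obtain p where p: "\<forall>i. coeff p i \<in> S" "inverse t = poly p u"
      using u unfolding adjoin_def by blast
    have "1 = t * poly p u" using t_nz by (simp add: p(2)[symmetric])
    then have "relation u (degree p)"
      unfolding relation_def using p
      by (intro exI[of _ "coeff p"]) (simp add: poly_altdef sum_distrib_left mult.assoc)
    then show ?thesis ..
  qed
  assume "\<not> ?thesis"
  then have "u \<notin> S" "inverse u \<notin> S" by auto
  then obtain n m where "relation u n" "relation (inverse u) m"
    using rel maximal by meson
  moreover have "u \<noteq> 0" using \<open>u \<notin> S\<close> subring_0 by auto
  ultimately show False using no_relation_pair by blast
qed

end

end

text \<open>Chevalley's theorem, phrased as avoiding one prescribed inverse. Zorn's lemma gives a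
  subring maximal among those omitting 1/t; maximality means that adjoining any further element
  brings 1/t in, which is the situation treated in \<open>maximal_subring_total\<close>.\<close>

theorem exists_valuation_ring:
  fixes S0 :: "'a::field set"
  assumes S0: "subring_set S0" and t: "t \<in> S0" "inverse t \<notin> S0"
  shows "\<exists>R. subring_set R \<and> S0 \<subseteq> R \<and> inverse t \<notin> R \<and> (\<forall>h. h \<in> R \<or> inverse h \<in> R)"
proof -
  define \<A> where "\<A> = {S. subring_set S \<and> S0 \<subseteq> S \<and> inverse t \<notin> S}"
  have "\<Union>\<C> \<in> \<A>" if \<C>: "\<C> \<noteq> {}" "subset.chain \<A> \<C>" for \<C>
  proof -
    have ab: "a - b \<in> \<Union>\<C> \<and> a * b \<in> \<Union>\<C>" if a: "a \<in> \<Union>\<C>" and b: "b \<in> \<Union>\<C>" for a b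
    proof -
      obtain A B where AB: "A \<in> \<C>" "B \<in> \<C>" "a \<in> A" "b \<in> B" using a b by auto
      then obtain M where "M \<in> \<C>" "a \<in> M" "b \<in> M"
        using \<C>(2) unfolding subset_chain_def by blast
      moreover then have "subring_set M" using \<C>(2) by (auto simp: subset_chain_def \<A>_def)
      ultimately show ?thesis by (auto intro: subring_diff subring_mult)
    qed
    obtain M where M: "M \<in> \<C>" using \<C> by auto
    then have "M \<in> \<A>" using \<C>(2) by (auto simp: subset_chain_def)
    then have "S0 \<subseteq> \<Union>\<C>" "1 \<in> \<Union>\<C>" using M by (auto simp: \<A>_def intro: subring_1)
    moreover have "inverse t \<notin> \<Union>\<C>" using \<C>(2) by (auto simp: subset_chain_def \<A>_def)
    ultimately show ?thesis using ab by (auto simp: \<A>_def subring_set_def)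
  qed
  moreover have "\<A> \<noteq> {}" using assms by (auto simp: \<A>_def)
  ultimately obtain R where R: "R \<in> \<A>" "\<And>M. M \<in> \<A> \<Longrightarrow> R \<subseteq> M \<Longrightarrow> M = R"
    using subset_Zorn_nonempty[of \<A>] by blast
  have sub: "subring_set R" "S0 \<subseteq> R" "inverse t \<notin> R" using R(1) by (auto simp: \<A>_def)
  have max: "inverse t \<in> adjoin R u" if "u \<notin> R" for u
  proof (rule ccontr)
    assume "inverse t \<notin> adjoin R u"
    then have "adjoin R u \<in> \<A>"
      using subring_adjoin[OF sub(1)] subset_adjoin[OF sub(1)] sub by (force simp: \<A>_def)
    then show False
      using R(2) subset_adjoin[OF sub(1)] self_in_adjoin[OF sub(1), of u] that by blast
  qed
  have "t \<in> R" using sub t by blast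
  then have "\<forall>h. h \<in> R \<or> inverse h \<in> R"
    using maximal_subring_total[OF sub(1) _ sub(3) max] by blast
  then show ?thesis using sub by blast
qed

section \<open>Units, nonunits and orders in a valuation ring\<close>

locale valuation_ring =
  fixes R :: "'f::field set"
  assumes subring: "subring_set R" and total: "h \<in> R \<or> inverse h \<in> R"
begin

lemmas R_1 = subring_1[OF subring] and R_0 = subring_0[OF subring]
  and R_diff = subring_diff[OF subring] and R_mult = subring_mult[OF subring]
  and R_uminus = subring_uminus[OF subring] and R_add = subring_add[OF subring]
  and R_power = subring_power[OF subring] and R_sum = subring_sum[OF subring]

text \<open>The maximal ideal. Zero is listed separately because \<open>inverse 0 = 0\<close> lies
  in R.\<close>

definition nonunits :: "'f set" where
  "nonunits = {z. z = 0 \<or> inverse z \<notin> R}"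

definition units :: "'f set" where
  "units = {z. z \<noteq> 0 \<and> z \<in> R \<and> inverse z \<in> R}"

lemma nonunits_R: "z \<in> nonunits \<Longrightarrow> z \<in> R"
  using total[of z] R_0 by (auto simp: nonunits_def)

lemma units_R: "z \<in> units \<Longrightarrow> z \<in> R"
  and units_nz: "z \<in> units \<Longrightarrow> z \<noteq> 0"
  and units_inverse_R: "z \<in> units \<Longrightarrow> inverse z \<in> R"
  by (auto simp: units_def)

lemma R_cases: "z \<in> R \<Longrightarrow> z \<in> nonunits \<or> z \<in> units"
  by (auto simp: nonunits_def units_def)

lemma units_not_nonunits: "z \<in> units \<Longrightarrow> z \<notin> nonunits"
  by (auto simp: nonunits_def units_def)

lemma one_unit: "1 \<in> units"
  using R_1 by (auto simp: units_def)

lemma unit_mult: "a \<in> units \<Longrightarrow> b \<in> units \<Longrightarrow> a * b \<in> units"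
  by (auto simp: units_def R_mult)

lemma unit_inverse: "a \<in> units \<Longrightarrow> inverse a \<in> units"
  by (auto simp: units_def)

lemma unit_divide: "a \<in> units \<Longrightarrow> b \<in> units \<Longrightarrow> a / b \<in> units"
  by (simp add: divide_inverse unit_mult unit_inverse)

lemma unit_uminus: "a \<in> units \<Longrightarrow> - a \<in> units"
  by (auto simp: units_def R_uminus)

lemma unit_power: "a \<in> units \<Longrightarrow> a ^ n \<in> units"
  by (induction n) (auto simp: one_unit unit_mult)

lemma unit_powi: "a \<in> units \<Longrightarrow> a powi k \<in> units"
  by (auto simp: power_int_def unit_power unit_inverse)

lemma unit_prod: "(\<And>i. i \<in> I \<Longrightarrow> g i \<in> units) \<Longrightarrow> prod g I \<in> units"
  by (induction I rule: infinite_finite_induct) (auto simp: one_unit unit_mult)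

lemma R_mult_unit_iff: "c \<in> units \<Longrightarrow> z * c \<in> R \<longleftrightarrow> z \<in> R"
  using R_mult[of "z * c" "inverse c"] by (auto simp: units_def R_mult mult.assoc)

lemma nonunit_mult:
  assumes z: "z \<in> nonunits" and a: "a \<in> R"
  shows "a * z \<in> nonunits"
proof (cases "a * z = 0")
  case False
  have "inverse (a * z) \<notin> R"
  proof
    assume "inverse (a * z) \<in> R"
    then have "a * inverse (a * z) \<in> R" using a R_mult by blast
    then have "inverse z \<in> R" using False by (simp add: mult.assoc[symmetric])
    then show False using z False by (auto simp: nonunits_def)
  qed
  then show ?thesis by (simp add: nonunits_def)
qed (simp add: nonunits_def)

text \<open>Of two nonzero elements one divides the other in R, so the sum is an R-multiple of one
  of them.\<close>

lemma nonunit_add: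
  assumes z: "z \<in> nonunits" and w: "w \<in> nonunits"
  shows "z + w \<in> nonunits"
proof (cases "z = 0 \<or> w = 0")
  case True
  then show ?thesis using assms by auto
next
  case False
  from total[of "z / w"] consider "z / w \<in> R" | "w / z \<in> R" by auto
  then show ?thesis
  proof cases
    case 1
    then have "(z / w + 1) * w \<in> nonunits" using w by (intro nonunit_mult R_add R_1)
    then show ?thesis using False by (simp add: distrib_right)
  next
    case 2
    then have "(1 + w / z) * z \<in> nonunits" using z by (intro nonunit_mult R_add R_1)
    then show ?thesis using False by (simp add: distrib_right)
  qed
qed

lemma nonunit_sum: "(\<And>i. i \<in> I \<Longrightarrow> g i \<in> nonunits) \<Longrightarrow> sum g I \<in> nonunits"
  by (induction I rule: infinite_finite_induct) (auto simp: nonunit_add, auto simp: nonunits_def)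

lemma nonunit_uminus: "z \<in> nonunits \<Longrightarrow> - z \<in> nonunits"
  using R_uminus[of "- inverse z"] by (auto simp: nonunits_def)

lemma unit_add_nonunit:
  assumes u: "u \<in> units" and z: "z \<in> nonunits"
  shows "u + z \<in> units"
proof (rule ccontr)
  assume "u + z \<notin> units"
  moreover have "u + z \<in> R" using assms by (auto intro: R_add units_R nonunits_R)
  ultimately have "u + z \<in> nonunits" using R_cases by blast
  then have "(u + z) + - z \<in> nonunits" by (rule nonunit_add[OF _ nonunit_uminus[OF z]])
  then have "u \<in> nonunits" by simp
  then show False using u units_not_nonunits by blast
qed

text \<open>A valuation ring is integrally closed; here z = z^n (1/z)^(n-1) shows it directly. This
  is what allows membership in R to be tested on N-th powers.\<close>

lemma root_in_R:
  assumes "z ^ n \<in> R" "n > 0"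
  shows "z \<in> R"
proof (rule ccontr)
  assume z: "z \<notin> R"
  then have "inverse z \<in> R" "z \<noteq> 0" using total R_0 by auto
  then have "z ^ n * inverse z ^ (n - 1) \<in> R" using assms R_mult R_power by blast
  moreover have "z ^ n * inverse z ^ (n - 1) = z"
    using \<open>n > 0\<close> \<open>z \<noteq> 0\<close> by (cases n) (auto simp: power_inverse)
  ultimately show False using z by simp
qed

lemma root_unit:
  assumes "z ^ n \<in> units" "n > 0"
  shows "z \<in> units"
proof -
  have "z \<in> R" using assms root_in_R units_R by blast
  moreover have "inverse z \<in> R"
    using root_in_R[of "inverse z" n] assms by (auto simp: units_def power_inverse)
  moreover have "z \<noteq> 0" using assms by (auto simp: units_def power_0_left)
  ultimately show ?thesis by (auto simp: units_def)
qed

text \<open>Replaces the value group: every order inequality below is read off from the sign of an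
  exponent of one nonunit \<open>\<xi>\<close>, up to a unit factor.\<close>

lemma power_nonunit_iff:
  assumes \<xi>: "\<xi> \<in> nonunits" "\<xi> \<noteq> 0" and c: "c \<in> units"
  shows "\<xi> powi k * c \<in> R \<longleftrightarrow> k \<ge> 0"
proof -
  have "\<xi> powi k \<in> R \<longleftrightarrow> k \<ge> 0"
  proof
    assume k: "k \<ge> 0"
    then have "\<xi> powi k = \<xi> ^ nat k" by (simp add: power_int_def)
    then show "\<xi> powi k \<in> R" using \<xi> by (simp add: R_power nonunits_R)
  next
    assume *: "\<xi> powi k \<in> R"
    show "k \<ge> 0"
    proof (rule ccontr)
      assume "\<not> k \<ge> 0"
      then have "\<xi> powi k * \<xi> ^ nat (- k - 1) = inverse \<xi>"
        using \<xi>(2) power_int_add[of \<xi> k "- k - 1"]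
        by (simp add: power_int_def power_int_minus split: if_splits)
      moreover have "\<xi> powi k * \<xi> ^ nat (- k - 1) \<in> R"
        using * \<xi> by (simp add: R_mult R_power nonunits_R)
      ultimately show False using \<xi> by (auto simp: nonunits_def)
    qed
  qed
  then show ?thesis using R_mult_unit_iff[OF c] by simp
qed

text \<open>The index \<open>j\<close> is the largest one at which the valuation of \<open>c\<close> is minimal.\<close>

lemma dominant_index:
  fixes c :: "nat \<Rightarrow> 'f"
  assumes "\<exists>i\<le>n. c i \<noteq> 0"
  shows "\<exists>j\<le>n. c j \<noteq> 0 \<and> (\<forall>i\<le>n. c i / c j \<in> R \<and> (i > j \<longrightarrow> c i / c j \<in> nonunits))"
  using assms
proof (induction n)
  case 0
  then show ?case using R_1 by auto
next
  case (Suc n)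
  show ?case
  proof (cases "\<exists>i\<le>n. c i \<noteq> 0")
    case False
    then have "c (Suc n) \<noteq> 0" using Suc.prems by (metis le_Suc_eq)
    then show ?thesis using False R_0 R_1 by (intro exI[of _ "Suc n"]) (auto simp: le_Suc_eq)
  next
    case True
    then obtain j where j: "j \<le> n" "c j \<noteq> 0"
      "\<And>i. i \<le> n \<Longrightarrow> c i / c j \<in> R" "\<And>i. i \<le> n \<Longrightarrow> i > j \<Longrightarrow> c i / c j \<in> nonunits"
      using Suc.IH by blast
    show ?thesis
    \<comment> \<open>If the quotient is not in the maximal ideal, the new coefficient has valuation
      at most that of \<open>c j\<close>. The new index then takes over, also in case of a tie,
      which keeps the dominant index the largest one.\<close>
    proof (cases "c (Suc n) / c j \<in> nonunits")
      case True
      then show ?thesis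
        using j by (intro exI[of _ j]) (auto simp: le_Suc_eq nonunits_R)
    next
      case False
      then have ne: "c (Suc n) \<noteq> 0" and *: "c j / c (Suc n) \<in> R" by (auto simp: nonunits_def)
      have "c i / c (Suc n) \<in> R" if "i \<le> n" for i
        using R_mult[OF j(3)[OF that] *] j(2) by simp
      then show ?thesis
        using ne R_1 by (intro exI[of _ "Suc n"]) (auto simp: le_Suc_eq)
    qed
  qed
qed

end

section \<open>Polynomials and roots of unity\<close>

text \<open>Euclid's algorithm, passing from (p, q) to (q, p mod q). It provides reduced fractions
  in K(x) together with Bezout coefficients for numerator and denominator.\<close>

lemma poly_bezout:
  fixes p q :: "'a::field poly"
  assumes "q \<noteq> 0"
  shows "\<exists>g p' q' a b. p = g * p' \<and> q = g * q' \<and> a * p' + b * q' = 1"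
  using assms
proof (induction "if p = 0 then 0 else Suc (degree q)" arbitrary: p q rule: less_induct)
  case less
  obtain s u where p: "p = q * s + u" and u: "u = 0 \<or> degree u < degree q" "p = 0 \<Longrightarrow> u = 0"
    using less.prems degree_mod_less[of q p] by (metis mod_0 mult_div_mod_eq)
  show ?case
  proof (cases "u = 0")
    case True
    then show ?thesis using p
      by (intro exI[of _ q] exI[of _ s] exI[of _ 1] exI[of _ 0]) auto
  next
    case False
    then have "degree u < degree q" "p \<noteq> 0" using u by auto
    then obtain g q' r' a b where g: "q = g * q'" "u = g * r'" "a * q' + b * r' = 1"
      using less.hyps[of q u] less.prems False by auto
    have "p = g * (q' * s + r')"
      unfolding p g(1,2) by (simp add: algebra_simps)
    moreover have "b * (q' * s + r') + (a - b * s) * q' = 1"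
      using g(3) by (simp add: algebra_simps)
    ultimately show ?thesis using g(1) by blast
  qed
qed

text \<open>Each root a of the product is a root of p or of the cofactor; cancelling T - a there
  distributes the distinct linear factors between the two.\<close>

lemma dvd_prod_linear:
  fixes p :: "'a::field poly"
  assumes "finite S" "p dvd smult k (\<Prod>a\<in>S. [:- a, 1:])" "k \<noteq> 0"
  shows "\<exists>T c. T \<subseteq> S \<and> c \<noteq> 0 \<and> p = smult c (\<Prod>a\<in>T. [:- a, 1:])"
  using assms
proof (induction S arbitrary: p rule: finite_induct)
  case empty
  then have "p dvd [:k:]" "p \<noteq> 0" by auto
  moreover then have "degree p = 0"
    using dvd_imp_degree_le[of p "[:k:]"] \<open>k \<noteq> 0\<close> by simp
  ultimately obtain c where "p = [:c:]" "c \<noteq> 0" by (metis degree_eq_zeroE pCons_0_0)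
  then show ?case by (intro exI[of _ "{}"] exI[of _ c]) auto
next
  case (insert a S)
  let ?Q = "smult k (\<Prod>a\<in>S. [:- a, 1:])"
  obtain q where q: "[:- a, 1:] * ?Q = p * q"
    using insert by (auto simp: dvd_def mult.commute)
  then have "poly (p * q) a = 0"
    by (metis poly_eq_0_iff_dvd dvd_triv_left)
  then consider "poly p a = 0" | "poly q a = 0" by auto
  then show ?case
  proof cases
    case 1
    then obtain p' where p': "p = [:- a, 1:] * p'" by (auto simp: poly_eq_0_iff_dvd dvd_def)
    then have "[:- a, 1:] * ?Q = [:- a, 1:] * (p' * q)" using q by (simp only: mult.assoc)
    then have "?Q = p' * q" by (subst (asm) mult_left_cancel) auto
    then obtain T c where T: "T \<subseteq> S" "c \<noteq> 0" "p' = smult c (\<Prod>a\<in>T. [:- a, 1:])"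
      using insert.IH[of p'] insert.prems by auto
    then have "finite T" "a \<notin> T" using insert.hyps finite_subset by auto
    then have "p = smult c (\<Prod>a\<in>insert a T. [:- a, 1:])" using T p' by (simp add: mult.commute)
    then show ?thesis using T by (intro exI[of _ "insert a T"] exI[of _ c]) auto
  next
    case 2
    then obtain q' where q': "q = [:- a, 1:] * q'" by (auto simp: poly_eq_0_iff_dvd dvd_def)
    have "[:- a, 1:] * ?Q = [:- a, 1:] * (p * q')"
      unfolding q q' by (simp only: mult.left_commute)
    then have "?Q = p * q'" by (subst (asm) mult_left_cancel) auto
    then obtain T c where T: "T \<subseteq> S" "c \<noteq> 0" "p = smult c (\<Prod>a\<in>T. [:- a, 1:])"
      using insert.IH[of p] insert.prems by auto
    then show ?thesis by blast
  qed
qed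

lemma degree_prod_linear: "degree (\<Prod>a\<in>T. [:- a, 1:]) = card T"
  for T :: "'a::idom set"
  by (simp add: degree_prod_eq_sum_degree)

lemma lead_coeff_prod_linear: "lead_coeff (\<Prod>a\<in>T. [:- a, 1:]) = 1"
  for T :: "'a::idom set"
  by (simp add: lead_coeff_prod)

text \<open>Both sides are monic of degree N and vanish at the N points of S.\<close>

lemma power_diff_eq_prod_linear:
  fixes S :: "'a::idom set"
  assumes "card S = N" "N \<ge> 1" "\<And>a. a \<in> S \<Longrightarrow> a ^ N = b"
  shows "monom 1 N - [:b:] = (\<Prod>a\<in>S. [:- a, 1:])"
proof (rule poly_eqI_degree_lead_coeff[of _ N _ S])
  have fin: "finite S" using assms by (metis card.infinite not_one_le_zero)
  have "coeff (\<Prod>a\<in>S. [:- a, 1:]) N = 1"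
    using lead_coeff_prod_linear[of S] by (simp add: degree_prod_linear assms)
  then show "coeff (monom 1 N - [:b:]) N = coeff (\<Prod>a\<in>S. [:- a, 1:]) N"
    using assms by (simp add: coeff_pCons split: nat.split)
  show "degree (monom 1 N - [:b:]) \<le> N"
    by (intro degree_diff_le) (auto simp: degree_monom_le)
  fix a assume "a \<in> S"
  then show "poly (monom 1 N - [:b:]) a = poly (\<Prod>a\<in>S. [:- a, 1:]) a"
    using assms fin by (auto simp: poly_monom poly_prod)
qed (use assms in \<open>auto simp: degree_prod_linear\<close>)

text \<open>A double root z of T^N - 1 would also be a root of N T^(N-1), hence zero, which is not a
  root of T^N - 1. So the N linear factors are distinct.\<close>

lemma card_roots_of_unity_alg_closed:
  assumes N: "N \<ge> 1" "of_nat N \<noteq> (0 :: 'a::alg_closed_field)"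
  shows "card (roots_of_unity N :: 'a set) = N"
proof -
  define p :: "'a poly" where "p = monom 1 N - 1"
  have deg: "degree p = N"
  proof -
    have "coeff p N = 1" using N by (simp add: p_def coeff_1)
    moreover have "degree p \<le> N"
      unfolding p_def by (intro degree_diff_le) (auto simp: degree_monom_le)
    ultimately show ?thesis by (intro antisym le_degree) auto
  qed
  then have lc: "lead_coeff p = 1" using N by (simp add: p_def coeff_1)
  then have "p \<noteq> 0" by auto
  then obtain M where M: "size M = N" "p = (\<Prod>z\<in>#M. [:- z, 1:])"
    using alg_closed_imp_factorization[of p] deg lc by auto
  have p: "poly p z = z ^ N - 1" for z by (simp add: p_def poly_monom)
  have "count M z = (if z \<in># M then 1 else 0)" for z
  proof (rule ccontr)
    assume *: "count M z \<noteq> (if z \<in># M then 1 else 0)"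
    then have "z \<in># M" by (auto simp: not_in_iff split: if_splits)
    then obtain B where B: "M = add_mset z B" by (metis mset_add)
    then have "z \<in># B" using * by (auto simp: not_in_iff split: if_splits)
    then obtain C where C: "B = add_mset z C" by (metis mset_add)
    then have pC: "p = [:- z, 1:] * ([:- z, 1:] * (\<Prod>z\<in>#C. [:- z, 1:]))"
      unfolding M(2) B by simp
    have "poly (pderiv p) z = 0" "poly p z = 0"
      unfolding pC by (simp_all add: pderiv_mult pderiv_pCons del: mult_pCons_left)
    moreover have "poly (pderiv p) z = of_nat N * z ^ (N - 1)"
      by (simp add: p_def pderiv_diff pderiv_monom poly_monom)
    ultimately have "z = 0" "z ^ N = 1" using N p by auto
    then show False using N by (simp add: power_0_left)
  qed
  then have "M = mset_set (set_mset M)"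
    by (intro multiset_eqI) (auto simp: count_mset_set')
  then have "card (set_mset M) = N" using M(1) by (metis size_mset_set)
  moreover have "roots_of_unity N = set_mset M"
  proof -
    have "z ^ N = 1 \<longleftrightarrow> z \<in># M" for z
    proof -
      have "poly p z = 0 \<longleftrightarrow> z \<in># M" unfolding M(2) by (auto simp: poly_prod_mset)
      then show ?thesis using p[of z] by simp
    qed
    then show ?thesis by (auto simp: roots_of_unity_def)
  qed
  ultimately show ?thesis by simp
qed

lemma card_roots_of_unity:
  assumes N: "N \<ge> 1" "\<not> CHAR('k::field) dvd N"
    and sub: "(roots_of_unity N :: 'k alg_closure set) \<subseteq> range to_ac"
  shows "card (roots_of_unity N :: 'k set) = N"
proof -
  have "(roots_of_unity N :: 'k alg_closure set) = to_ac ` roots_of_unity N"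
    using sub by (auto simp: roots_of_unity_def simp flip: to_ac_power)
  moreover have "card (roots_of_unity N :: 'k alg_closure set) = N"
    using N by (intro card_roots_of_unity_alg_closed) (auto simp: of_nat_eq_0_iff_char_dvd)
  moreover have "inj (to_ac :: 'k \<Rightarrow> _)" by (auto simp: inj_def)
  ultimately show ?thesis by (metis card_image inj_on_subset subset_UNIV)
qed

lemma card_roots_of_unity_le:
  assumes "k \<ge> 1"
  shows "finite (roots_of_unity k :: 'a::field set)" "card (roots_of_unity k :: 'a set) \<le> k"
proof -
  have "coeff (monom 1 k - 1 :: 'a poly) k \<noteq> 0" using assms by (simp add: coeff_1)
  then have nz: "(monom 1 k - 1 :: 'a poly) \<noteq> 0" by (metis coeff_0)
  have eq: "roots_of_unity k = {z :: 'a. poly (monom 1 k - 1) z = 0}"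
    by (simp add: poly_monom roots_of_unity_def)
  show "finite (roots_of_unity k :: 'a set)" unfolding eq by (rule poly_roots_finite[OF nz])
  have "card (roots_of_unity k :: 'a set) \<le> degree (monom 1 k - 1 :: 'a poly)"
    unfolding eq by (rule card_poly_roots_bound[OF nz])
  also have "\<dots> \<le> k" by (intro degree_diff_le) (auto simp: degree_monom_le)
  finally show "card (roots_of_unity k :: 'a set) \<le> k" .
qed

section \<open>The function field and its automorphisms\<close>

locale superelliptic =
  fixes N r :: nat
    and A :: "nat \<Rightarrow> nat"
    and lam :: "nat \<Rightarrow> 'k::field"
    and f :: "'k poly"
    and \<iota> :: "'k \<Rightarrow> 'f::field"
    and x y :: 'f
  assumes N1: "N \<ge> 1"
    and char_not_dvd: "\<not> CHAR('k) dvd N"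
    and inj_lam: "inj_on lam {..r}"
    and Gcd1: "Gcd (insert N (A ` {..r})) = 1"
    and f_def: "f = (\<Prod>j\<le>r. [:- lam j, 1:] ^ A j)"
    and roots: "(roots_of_unity N :: 'k alg_closure set) \<subseteq> range to_ac"
    and function_field: "superelliptic_function_field \<iota> N f x y"
begin

abbreviation \<mu> :: "'k set" where "\<mu> \<equiv> roots_of_unity N"

text \<open>\<open>px\<close> embeds K[x] in F, \<open>pxy\<close> maps K[x][T] to F by T = y, and
  \<open>L\<close> is the copy of K(x) inside F.\<close>

definition px :: "'k poly \<Rightarrow> 'f" where "px = eval_hom \<iota> x"

definition pxy :: "'k poly poly \<Rightarrow> 'f" where "pxy = eval_hom px y"

definition L :: "'f set" where "L = {px p / px q | p q. q \<noteq> 0}"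

lemma \<iota>_hom: "unital_hom \<iota>"
  using function_field by (simp add: superelliptic_function_field_def field_embedding_iff_unital_hom)

lemma px_hom: "unital_hom px"
  unfolding px_def by (rule unital_hom_eval_hom[OF \<iota>_hom])

lemma pxy_hom: "unital_hom pxy"
  unfolding pxy_def by (rule unital_hom_eval_hom[OF px_hom])

lemma px_eq_0_iff: "px p = 0 \<longleftrightarrow> p = 0"
  using function_field hom_0[OF px_hom]
  by (auto simp: superelliptic_function_field_def eval_at_eq_eval_hom px_def)

lemma px_eq_iff: "px p = px q \<longleftrightarrow> p = q"
  using px_eq_0_iff[of "p - q"] by (simp add: hom_diff[OF px_hom])

lemma px_const: "px [:c:] = \<iota> c"
  by (simp add: px_def eval_hom_const[OF \<iota>_hom])

lemma px_pCons: "px (pCons c p) = \<iota> c + x * px p"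
  by (simp add: px_def eval_hom_pCons[OF \<iota>_hom])

lemma px_linear: "px [:- c, 1:] = x - \<iota> c"
  by (simp add: px_pCons hom_uminus[OF \<iota>_hom] hom_1[OF \<iota>_hom] hom_0[OF px_hom])

lemma px_altdef: "px p = (\<Sum>i\<le>degree p. \<iota> (coeff p i) * x ^ i)"
  unfolding px_def by (rule eval_hom_altdef[OF \<iota>_hom hom_eq_0_iff[OF \<iota>_hom]])

lemma px_var: "px [:0, 1:] = x"
  using px_linear[of 0] by (simp add: hom_0[OF \<iota>_hom])

lemma pxy_const: "pxy [:p:] = px p"
  by (simp add: pxy_def eval_hom_const[OF px_hom])

lemma pxy_var: "pxy [:0, 1:] = y"
  by (simp add: pxy_def eval_hom_pCons[OF px_hom] eval_hom_0[OF px_hom] hom_0[OF px_hom] hom_1[OF px_hom])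

lemma x_nz: "x \<noteq> 0"
  using px_eq_0_iff[of "[:0, 1:]"] by (simp add: px_var)

lemma x_minus_nz: "x - \<iota> c \<noteq> 0"
  using px_eq_0_iff[of "[:- c, 1:]"] by (simp add: px_linear)

lemma y_pow: "y ^ N = px f"
  using function_field by (simp add: superelliptic_function_field_def eval_at_eq_eval_hom px_def)

lemma f_nz: "f \<noteq> 0"
  by (auto simp: f_def)

lemma y_nz: "y \<noteq> 0"
  using y_pow px_eq_0_iff[of f] f_nz N1 by (auto simp: power_0_left)

lemma px_f: "px f = (\<Prod>j\<le>r. (x - \<iota> (lam j)) ^ A j)"
  by (simp add: f_def hom_prod[OF px_hom] hom_power[OF px_hom] px_linear)

lemma of_nat_K_nz: "n dvd N \<Longrightarrow> of_nat n \<noteq> (0 :: 'k)"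
  using char_not_dvd dvd_trans by (auto simp: of_nat_eq_0_iff_char_dvd)

lemma of_nat_F_nz: "n dvd N \<Longrightarrow> of_nat n \<noteq> (0 :: 'f)"
  using of_nat_K_nz hom_eq_0_iff[OF \<iota>_hom, of "of_nat n"] by (simp add: hom_of_nat[OF \<iota>_hom])

lemma card_\<mu>: "card \<mu> = N"
  using card_roots_of_unity N1 char_not_dvd roots by blast

lemma finite_\<mu>: "finite \<mu>"
  using card_\<mu> N1 by (metis card.infinite not_one_le_zero)

lemma one_\<mu>: "1 \<in> \<mu>"
  by (simp add: roots_of_unity_def)

lemma \<mu>_nz: "\<zeta> \<in> \<mu> \<Longrightarrow> \<zeta> \<noteq> 0"
  using N1 by (auto simp: roots_of_unity_def power_0_left)

lemma \<mu>_mult: "\<zeta> \<in> \<mu> \<Longrightarrow> \<xi> \<in> \<mu> \<Longrightarrow> \<zeta> * \<xi> \<in> \<mu>"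
  by (simp add: roots_of_unity_def power_mult_distrib)

lemma \<mu>_inverse: "\<zeta> \<in> \<mu> \<Longrightarrow> inverse \<zeta> \<in> \<mu>"
  by (simp add: roots_of_unity_def power_inverse)

lemma \<iota>_\<mu>_pow: "\<zeta> \<in> \<mu> \<Longrightarrow> \<iota> \<zeta> ^ N = 1"
  by (simp add: roots_of_unity_def hom_1[OF \<iota>_hom] flip: hom_power[OF \<iota>_hom])

lemma y_prod_linear: "monom 1 N - [:px f:] = (\<Prod>a\<in>(\<lambda>\<zeta>. \<iota> \<zeta> * y) ` \<mu>. [:- a, 1:])"
proof (rule power_diff_eq_prod_linear)
  have "inj_on (\<lambda>\<zeta>. \<iota> \<zeta> * y) \<mu>"
    using y_nz by (auto simp: inj_on_def hom_eq_iff[OF \<iota>_hom])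
  then show "card ((\<lambda>\<zeta>. \<iota> \<zeta> * y) ` \<mu>) = N" by (simp add: card_image card_\<mu>)
qed (use N1 in \<open>auto simp: power_mult_distrib \<iota>_\<mu>_pow y_pow\<close>)

lemma order_f: "j \<le> r \<Longrightarrow> order (lam j) f = A j"
proof -
  assume j: "j \<le> r"
  let ?g = "\<Prod>i\<in>{..r} - {j}. [:- lam i, 1:] ^ A i"
  have f: "f = [:- lam j, 1:] ^ A j * ?g"
    unfolding f_def using j by (subst prod.remove[of _ j]) auto
  have "poly ?g (lam j) \<noteq> 0"
    using inj_lam j by (auto simp: poly_prod inj_on_def)
  moreover have "[:- lam j, 1:] ^ A j * ?g \<noteq> 0" using f f_nz by metis
  ultimately have "order (lam j) ([:- lam j, 1:] ^ A j * ?g) = A j"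
    by (simp add: order_mult order_power_n_n order_0I)
  then show ?thesis by (simp only: f[symmetric])
qed

section \<open>The minimal equation of y over K(x)\<close>

definition T_N_minus_f :: "'k poly poly" where
  "T_N_minus_f = monom 1 N - [:f:]"

lemma map_T_N_minus_f: "map_poly px T_N_minus_f = monom 1 N - [:px f:]"
proof -
  have "map_poly px [:f:] = [:px f:]" by (simp add: map_poly_pCons hom_0[OF px_hom])
  then show ?thesis
    using hom_diff[OF unital_hom_map_poly[OF px_hom], of "monom 1 N" "[:f:]"]
    by (simp add: T_N_minus_f_def map_poly_monom hom_0[OF px_hom] hom_1[OF px_hom])
qed

lemma pxy_T_N_minus_f: "pxy T_N_minus_f = 0"
  by (simp add: pxy_def eval_hom_def map_T_N_minus_f poly_monom y_pow)

lemma T_N_minus_f: "degree T_N_minus_f = N" "lead_coeff T_N_minus_f = 1"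
proof -
  have c: "coeff T_N_minus_f N = 1"
    using N1 by (simp add: T_N_minus_f_def coeff_pCons split: nat.split)
  moreover have "degree T_N_minus_f \<le> N"
    unfolding T_N_minus_f_def by (intro degree_diff_le) (auto simp: degree_monom_le)
  ultimately show "degree T_N_minus_f = N" by (intro antisym le_degree) auto
  then show "lead_coeff T_N_minus_f = 1" using c by simp
qed

text \<open>
  A relation of minimal degree \<open>m\<close> is a partial product of \<open>T\<^sup>N - y\<^sup>N = \<Prod> (T - \<zeta> y)\<close>, so its
  constant term puts a multiple of \<open>y\<^sup>m\<close> into \<open>K(x)\<close>; comparing orders at the \<open>\<lambda>\<^sub>j\<close> gives \<open>N dvd m\<close>.
\<close>

lemma relation_degree_ge:
  assumes Q: "Q \<noteq> 0" "pxy Q = 0"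
  shows "degree Q \<ge> N"
proof -
  obtain P where P: "P \<noteq> 0" "pxy P = 0"
    and min: "\<And>Q. Q \<noteq> 0 \<Longrightarrow> pxy Q = 0 \<Longrightarrow> degree P \<le> degree Q"
    using ex_has_least_nat[of "\<lambda>Q. Q \<noteq> 0 \<and> pxy Q = 0" Q degree] Q by blast
  define m where "m = degree P"
  note poly_hom = unital_hom_map_poly[OF px_hom]
  let ?S = "(\<lambda>\<zeta>. \<iota> \<zeta> * y) ` \<mu>" and ?P = "map_poly px P"
  \<comment> \<open>Coefficients lie in K[x], so division by P is pseudo-division and multiplies T^N
    - f by a power c of the leading coefficient of P.\<close>
  obtain q u where qu: "pseudo_divmod T_N_minus_f P = (q, u)" by (cases "pseudo_divmod T_N_minus_f P")
  define c where "c = lead_coeff P ^ (Suc (degree T_N_minus_f) - degree P)"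
  have div: "smult c T_N_minus_f = P * q + u" and u: "u = 0 \<or> degree u < m"
    using pseudo_divmod[OF P(1) qu] by (auto simp: c_def m_def)
  have c: "c \<noteq> 0" using P by (simp add: c_def)
  have "pxy u = pxy (smult c T_N_minus_f) - pxy (P * q)"
    by (simp add: div hom_add[OF pxy_hom])
  also have "\<dots> = 0"
    using P(2) pxy_T_N_minus_f eval_hom_smult[OF px_hom, of y c T_N_minus_f]
    by (simp add: pxy_def[symmetric] hom_mult[OF pxy_hom])
  finally have "pxy u = 0" .
  then have "u = 0" using u min[of u] by (metis leD m_def)
  then have "map_poly px (smult c T_N_minus_f) = ?P * map_poly px q"
    by (simp add: div hom_mult[OF poly_hom])
  then have "?P dvd map_poly px (smult c T_N_minus_f)" by simp
  also have "map_poly px (smult c T_N_minus_f) = smult (px c) (\<Prod>a\<in>?S. [:- a, 1:])"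
    by (simp add: map_poly_smult hom_0[OF px_hom] hom_mult[OF px_hom] map_T_N_minus_f y_prod_linear)
  finally obtain T k where T: "T \<subseteq> ?S" "k \<noteq> 0" "?P = smult k (\<Prod>a\<in>T. [:- a, 1:])"
    using dvd_prod_linear[of ?S ?P "px c"] finite_\<mu> c px_eq_0_iff by blast
  have cP: "coeff ?P i = px (coeff P i)" for i
    by (simp add: coeff_map_poly hom_0[OF px_hom])
  have "degree ?P = m"
    unfolding m_def by (rule degree_map_poly) (use px_eq_0_iff in auto)
  then have m: "m = card T" using T by (simp add: degree_prod_linear)
  have "coeff ?P m = k"
    using lead_coeff_prod_linear[of T] by (simp add: T(3) degree_prod_linear m)
  then have k: "k = px (lead_coeff P)" by (simp add: cP m_def)
  have "px (coeff P 0) = poly ?P 0" using cP[of 0] by (simp add: poly_0_coeff_0)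
  also have "\<dots> = k * (\<Prod>a\<in>T. - a)" by (simp add: T(3) poly_prod)
  \<comment> \<open>The individual roots need not lie in K(x), but the N-th power of each is f.
    Raising to the N-th power therefore turns the formula for the constant term into an identity in
    K[x].\<close>
  finally have "px (coeff P 0) ^ N = k ^ N * (\<Prod>a\<in>T. (- a) ^ N)"
    by (simp add: power_mult_distrib prod_power_distrib)
  also have "(\<Prod>a\<in>T. (- a) ^ N) = (\<Prod>a\<in>T. (-1) ^ N * px f)"
  proof (rule prod.cong)
    fix a assume "a \<in> T"
    then have "a ^ N = px f" using T(1) by (auto simp: power_mult_distrib \<iota>_\<mu>_pow y_pow)
    then show "(- a) ^ N = (-1) ^ N * px f" by (metis power_minus)
  qed simp
  also have "\<dots> = ((-1) ^ N * px f) ^ m" by (simp add: m)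
  finally have "px (coeff P 0 ^ N) = px (lead_coeff P ^ N * ((-1) ^ N * f) ^ m)"
    by (simp add: k hom_mult[OF px_hom] hom_power[OF px_hom] hom_uminus[OF px_hom] hom_1[OF px_hom])
  then have eq: "coeff P 0 ^ N = lead_coeff P ^ N * ((-1) ^ N * f) ^ m"
    by (simp add: px_eq_iff)
  have order_pow: "order a (p ^ n) = n * order a p" if "p \<noteq> 0" for a n and p :: "'k poly"
    using that by (induction n) (auto simp: order_mult)
  have lc: "lead_coeff P \<noteq> 0" using P by simp
  moreover have mf: "(-1) ^ N * f \<noteq> 0" using f_nz by simp
  ultimately have "coeff P 0 \<noteq> 0" using eq N1 by (auto simp: power_0_left)
  have "N dvd m * A j" if j: "j \<le> r" for j
  proof -
    have "order (lam j) ((-1) ^ N * f) = A j"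
      using order_f[OF j] by (cases "even N") simp_all
    then have "N * order (lam j) (coeff P 0) = N * order (lam j) (lead_coeff P) + m * A j"
      using arg_cong[OF eq, of "order (lam j)"] lc mf \<open>coeff P 0 \<noteq> 0\<close>
      by (simp add: order_mult order_pow)
    then show ?thesis by (metis dvd_add_right_iff dvd_triv_left)
  qed
  \<comment> \<open>N divides m N and every m A_j, hence m times the gcd of N and all A_j, which is
    m.\<close>
  then have "N dvd Gcd ((*) m ` insert N (A ` {..r}))"
    by (intro Gcd_greatest) auto
  then have "N dvd m" using Gcd1 by (simp only: Gcd_mult) simp
  \<comment> \<open>A relation of degree 0 in T would be a polynomial relation for x alone,
    contradicting that x is transcendental.\<close>
  moreover have "m \<noteq> 0"
  proof
    assume "m = 0"
    then obtain p where "P = [:p:]" unfolding m_def by (metis degree_eq_zeroE)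
    then show False using P pxy_const px_eq_0_iff by auto
  qed
  ultimately have "N \<le> m" by (simp add: dvd_imp_le)
  then show ?thesis using min Q by (force simp: m_def)
qed

lemma division_by_T_N_minus_f:
  "\<exists>q u. P = T_N_minus_f * q + u \<and> (u = 0 \<or> degree u < N)"
proof -
  obtain q u where qu: "pseudo_divmod P T_N_minus_f = (q, u)" by (cases "pseudo_divmod P T_N_minus_f")
  have "T_N_minus_f \<noteq> 0" using T_N_minus_f(2) by auto
  then show ?thesis
    using pseudo_divmod[OF _ qu] T_N_minus_f by auto
qed

lemma pxy_eq_0_iff: "pxy P = 0 \<longleftrightarrow> T_N_minus_f dvd P"
proof
  assume P: "pxy P = 0"
  obtain q u where eq: "P = T_N_minus_f * q + u" "u = 0 \<or> degree u < N"
    using division_by_T_N_minus_f by blast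
  then have "pxy u = 0"
    using P hom_add[OF pxy_hom, of "T_N_minus_f * q" u] by (simp add: hom_mult[OF pxy_hom] pxy_T_N_minus_f)
  then have "u = 0" using eq(2) relation_degree_ge by force
  then show "T_N_minus_f dvd P" using eq(1) by simp
qed (auto simp: dvd_def hom_mult[OF pxy_hom] pxy_T_N_minus_f)

text \<open>The elements satisfying P form a subfield containing K, x and y. This is the induction
  principle behind \<open>hom_eqI\<close>, \<open>\<sigma>_D\<close> and
  \<open>d_eq\<close>.\<close>

lemma generated:
  assumes "P 1" "\<And>a b. P a \<Longrightarrow> P b \<Longrightarrow> P (a - b)" "\<And>a b. P a \<Longrightarrow> P b \<Longrightarrow> P (a * b)"
    "\<And>a. P a \<Longrightarrow> P (inverse a)" "\<And>c. P (\<iota> c)" "P x" "P y"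
  shows "P h"
proof -
  have "subfield_set {h. P h}"
    using assms by (auto simp: subfield_set_def subring_set_def)
  then have "{h. P h} = UNIV"
    using function_field assms(5-7) unfolding superelliptic_function_field_def by blast
  then show ?thesis by blast
qed

lemma pxy_fraction: "\<exists>P Q. pxy Q \<noteq> 0 \<and> h = pxy P / pxy Q"
proof (rule generated[where P = "\<lambda>h. \<exists>P Q. pxy Q \<noteq> 0 \<and> h = pxy P / pxy Q"])
  have S: "\<exists>P Q. pxy Q \<noteq> 0 \<and> pxy P' = pxy P / pxy Q" for P'
    by (intro exI[of _ P'] exI[of _ 1]) (simp add: hom_1[OF pxy_hom])
  show "\<exists>P Q. pxy Q \<noteq> 0 \<and> 1 = pxy P / pxy Q" using S[of 1] by (simp add: hom_1[OF pxy_hom])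
  show "\<exists>P Q. pxy Q \<noteq> 0 \<and> \<iota> c = pxy P / pxy Q" for c using S[of "[:[:c:]:]"] by (simp add: pxy_const px_const)
  show "\<exists>P Q. pxy Q \<noteq> 0 \<and> x = pxy P / pxy Q" using S[of "[:[:0,1:]:]"] by (simp add: pxy_const px_var)
  show "\<exists>P Q. pxy Q \<noteq> 0 \<and> y = pxy P / pxy Q" using S[of "[:0,1:]"] by (simp add: pxy_var)
next
  fix a b
  assume "\<exists>P Q. pxy Q \<noteq> 0 \<and> a = pxy P / pxy Q" "\<exists>P Q. pxy Q \<noteq> 0 \<and> b = pxy P / pxy Q"
  then obtain P Q P' Q' where *: "pxy Q \<noteq> 0" "a = pxy P / pxy Q" "pxy Q' \<noteq> 0" "b = pxy P' / pxy Q'" by blast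
  show "\<exists>P Q. pxy Q \<noteq> 0 \<and> a - b = pxy P / pxy Q"
    using * by (intro exI[of _ "P * Q' - P' * Q"] exI[of _ "Q * Q'"])
      (simp add: hom_mult[OF pxy_hom] hom_diff[OF pxy_hom] diff_frac_eq)
  show "\<exists>P Q. pxy Q \<noteq> 0 \<and> a * b = pxy P / pxy Q"
    using * by (intro exI[of _ "P * P'"] exI[of _ "Q * Q'"]) (simp add: hom_mult[OF pxy_hom])
next
  fix a
  assume "\<exists>P Q. pxy Q \<noteq> 0 \<and> a = pxy P / pxy Q"
  then obtain P Q where *: "pxy Q \<noteq> 0" "a = pxy P / pxy Q" by blast
  show "\<exists>P Q. pxy Q \<noteq> 0 \<and> inverse a = pxy P / pxy Q"
  proof (cases "pxy P = 0")
    case True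
    then show ?thesis using * by (intro exI[of _ 0] exI[of _ 1]) (simp add: hom_0[OF pxy_hom] hom_1[OF pxy_hom])
  next
    case False
    then show ?thesis using * by (intro exI[of _ Q] exI[of _ P]) simp
  qed
qed

text \<open>Evaluation at T = \<zeta> y has the same kernel as evaluation at T = y: T^N - f vanishes
  at both, and neither satisfies a relation of smaller degree. So it extends to the fractions that
  make up F.\<close>

lemma automorphism_exists:
  assumes \<zeta>: "\<zeta> \<in> \<mu>"
  shows "\<exists>\<sigma>. unital_hom \<sigma> \<and> (\<forall>c. \<sigma> (\<iota> c) = \<iota> c) \<and> \<sigma> x = x \<and> \<sigma> y = \<iota> \<zeta> * y"
proof -
  define \<psi> where "\<psi> = eval_hom px (\<iota> \<zeta> * y)"
  have \<psi>: "unital_hom \<psi>" unfolding \<psi>_def by (rule unital_hom_eval_hom[OF px_hom])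
  have root: "\<psi> T_N_minus_f = 0"
    by (simp add: \<psi>_def eval_hom_def map_T_N_minus_f poly_monom y_pow power_mult_distrib \<iota>_\<mu>_pow[OF \<zeta>])
  have degree: "degree P \<ge> N" if "P \<noteq> 0" "\<psi> P = 0" for P
  proof -
    \<comment> \<open>Substituting \<zeta> T for T turns a relation for \<zeta> y into one for y of
      the same degree, as \<zeta> is nonzero.\<close>
    let ?l = "[:0, [:\<zeta>:]:]"
    have "pxy (pcompose P ?l) = \<psi> P"
      by (induction P)
        (auto simp: \<psi>_def pxy_def eval_hom_0[OF px_hom] pcompose_pCons eval_hom_add[OF px_hom]
          eval_hom_mult[OF px_hom] eval_hom_pCons[OF px_hom] hom_0[OF px_hom] px_const algebra_simps
          simp del: mult_pCons_left)
    moreover have deg: "degree ?l = 1" using \<mu>_nz[OF \<zeta>] by simp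
    then have "pcompose P ?l \<noteq> 0" using that(1) pcompose_eq_0 by fastforce
    ultimately have "degree (pcompose P ?l) \<ge> N" using that(2) by (intro relation_degree_ge) auto
    then show ?thesis using deg by (simp add: degree_pcompose)
  qed
  have "\<psi> P = 0 \<longleftrightarrow> pxy P = 0" for P
  proof
    assume P: "\<psi> P = 0"
    obtain q u where eq: "P = T_N_minus_f * q + u" "u = 0 \<or> degree u < N"
      using division_by_T_N_minus_f by blast
    then have "\<psi> u = 0"
      using P hom_add[OF \<psi>, of "T_N_minus_f * q" u] by (simp add: hom_mult[OF \<psi>] root)
    then have "u = 0" using eq(2) degree by force
    then show "pxy P = 0" using eq(1) pxy_eq_0_iff by simp
  next
    assume "pxy P = 0"
    then show "\<psi> P = 0" using pxy_eq_0_iff by (auto simp: dvd_def hom_mult[OF \<psi>] root)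
  qed
  then obtain \<sigma> where \<sigma>: "unital_hom \<sigma>" "\<And>P. \<sigma> (pxy P) = \<psi> P"
    using hom_extends_to_fractions[OF pxy_hom pxy_fraction \<psi>] by metis
  have "\<sigma> (px p) = px p" for p
    using \<sigma>(2)[of "[:p:]"] by (simp add: pxy_const \<psi>_def eval_hom_const[OF px_hom])
  moreover have "\<sigma> y = \<iota> \<zeta> * y"
    using \<sigma>(2)[of "[:0, 1:]"]
    by (simp add: pxy_var \<psi>_def eval_hom_pCons[OF px_hom] eval_hom_0[OF px_hom] hom_0[OF px_hom] hom_1[OF px_hom])
  ultimately show ?thesis using \<sigma>(1) by (metis px_const px_var)
qed

text \<open>Extends d/dx from K[x] to K[x][T] and then to fractions; the value at T is chosen so
  that T^N - f, which generates the kernel of evaluation, is sent to 0.\<close>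

lemma derivation_exists:
  "\<exists>D. field_derivation D \<and> (\<forall>c. D (\<iota> c) = 0) \<and> D x = 1"
proof -
  have d0: "derivation_along \<iota> (\<lambda>_. 0)" by (simp add: derivation_along_def)
  define \<Delta>0 where "\<Delta>0 = poly_derivation \<iota> (\<lambda>_. 0) x 1"
  have \<Delta>0: "derivation_along px \<Delta>0"
    unfolding px_def \<Delta>0_def by (rule derivation_along_poly_derivation[OF \<iota>_hom d0])
  \<comment> \<open>Forced by differentiating y^N = f; the denominator is nonzero because the
    characteristic does not divide N.\<close>
  define y' where "y' = \<Delta>0 f / (of_nat N * y ^ (N - 1))"
  define \<Delta> where "\<Delta> = poly_derivation px \<Delta>0 y y'"
  have \<Delta>: "derivation_along pxy \<Delta>"
    unfolding pxy_def \<Delta>_def by (rule derivation_along_poly_derivation[OF px_hom \<Delta>0])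
  have \<Delta>1: "\<Delta>0 1 = 0"
    by (simp add: \<Delta>0_def poly_derivation_def map_poly_1 eval_hom_0[OF \<iota>_hom])
  have \<Delta>00: "\<Delta>0 0 = 0" by (rule derivation_0[OF px_hom \<Delta>0])
  have y'_eq: "y' * (of_nat N * y ^ (N - 1)) = \<Delta>0 f"
    using of_nat_F_nz[of N] y_nz by (simp add: y'_def)
  have \<Delta>diff: "\<Delta> P - \<Delta> Q = \<Delta> (P - Q)" for P Q
    using derivation_add[OF pxy_hom \<Delta>, of "P - Q" Q] by simp
  have "\<Delta> (monom 1 N) = \<Delta>0 f"
    by (simp add: \<Delta>_def poly_derivation_def map_poly_monom \<Delta>00 \<Delta>1 pderiv_monom eval_hom_def
        hom_0[OF px_hom] hom_of_nat[OF px_hom] poly_monom y'_eq[unfolded One_nat_def])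
  moreover have "\<Delta> [:f:] = \<Delta>0 f"
    by (simp add: \<Delta>_def poly_derivation_def map_poly_pCons \<Delta>00 pderiv_pCons eval_hom_0[OF px_hom])
  ultimately have "\<Delta> T_N_minus_f = 0"
    unfolding T_N_minus_f_def by (simp flip: \<Delta>diff)
  then have "\<Delta> P = 0" if "pxy P = 0" for P
    using that unfolding pxy_eq_0_iff
    by (auto simp: dvd_def derivation_mult[OF pxy_hom \<Delta>] pxy_T_N_minus_f)
  then obtain D where D: "field_derivation D" "\<And>P. D (pxy P) = \<Delta> P"
    using derivation_extends_to_fractions[OF pxy_hom pxy_fraction \<Delta>] by metis
  have "D (px p) = \<Delta>0 p" for p
    using D(2)[of "[:p:]"] by (simp add: pxy_const \<Delta>_def poly_derivation_def map_poly_pCons \<Delta>00 pderiv_pCons eval_hom_0[OF px_hom])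
  moreover have "\<Delta>0 [:c:] = 0" for c
    by (simp add: \<Delta>0_def poly_derivation_def map_poly_pCons pderiv_pCons eval_hom_0[OF \<iota>_hom])
  moreover have "\<Delta>0 [:0, 1:] = 1"
    by (simp add: \<Delta>0_def poly_derivation_def map_poly_pCons pderiv_pCons eval_hom_0[OF \<iota>_hom]
        eval_hom_pCons[OF \<iota>_hom] hom_1[OF \<iota>_hom])
  ultimately show ?thesis using D(1) by (metis px_const px_var)
qed

section \<open>The action of the N-th roots of unity and the derivation d/dx\<close>

definition \<sigma> :: "'k \<Rightarrow> 'f \<Rightarrow> 'f" where
  "\<sigma> \<zeta> = (SOME \<sigma>. unital_hom \<sigma> \<and> (\<forall>c. \<sigma> (\<iota> c) = \<iota> c) \<and> \<sigma> x = x \<and> \<sigma> y = \<iota> \<zeta> * y)"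

definition D :: "'f \<Rightarrow> 'f" where
  "D = (SOME D. field_derivation D \<and> (\<forall>c. D (\<iota> c) = 0) \<and> D x = 1)"

lemma D_fd: "field_derivation D" and D_const: "D (\<iota> c) = 0" and D_x: "D x = 1"
  using someI_ex[OF derivation_exists] by (auto simp: D_def)

lemmas D_add = fd_add[OF D_fd] and D_mult = fd_mult[OF D_fd] and D_0 = fd_0[OF D_fd]
  and D_1 = fd_1[OF D_fd] and D_diff = fd_diff[OF D_fd]
  and D_sum = fd_sum[OF D_fd] and D_inverse = fd_inverse[OF D_fd]
  and dlog_mult = fd_dlog_mult[OF D_fd] and dlog_power = fd_dlog_power[OF D_fd]
  and dlog_powi = fd_dlog_powi[OF D_fd]

lemma
  assumes "\<zeta> \<in> \<mu>"
  shows \<sigma>_hom: "unital_hom (\<sigma> \<zeta>)" and \<sigma>_const: "\<sigma> \<zeta> (\<iota> c) = \<iota> c"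
    and \<sigma>_x: "\<sigma> \<zeta> x = x" and \<sigma>_y: "\<sigma> \<zeta> y = \<iota> \<zeta> * y"
  using someI_ex[OF automorphism_exists[OF assms]] by (auto simp: \<sigma>_def)

lemma hom_eqI:
  fixes \<phi> \<psi> :: "'f \<Rightarrow> 'f"
  assumes "unital_hom \<phi>" "unital_hom \<psi>" "\<And>c. \<phi> (\<iota> c) = \<psi> (\<iota> c)" "\<phi> x = \<psi> x" "\<phi> y = \<psi> y"
  shows "\<phi> = \<psi>"
proof
  show "\<phi> h = \<psi> h" for h
    by (rule generated[where P = "\<lambda>h. \<phi> h = \<psi> h"])
      (simp_all add: assms hom_1[OF assms(1)] hom_1[OF assms(2)] hom_diff[OF assms(1)] hom_diff[OF assms(2)]
        hom_mult[OF assms(1)] hom_mult[OF assms(2)] hom_inverse[OF assms(1)] hom_inverse[OF assms(2)])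
qed

lemma \<sigma>_comp:
  assumes "\<zeta> \<in> \<mu>" "\<xi> \<in> \<mu>"
  shows "\<sigma> \<zeta> (\<sigma> \<xi> h) = \<sigma> (\<zeta> * \<xi>) h"
proof -
  note \<zeta>\<xi> = \<mu>_mult[OF assms]
  have "\<sigma> \<zeta> \<circ> \<sigma> \<xi> = \<sigma> (\<zeta> * \<xi>)"
    by (rule hom_eqI[OF unital_hom_comp[OF \<sigma>_hom[OF assms(2)] \<sigma>_hom[OF assms(1)]] \<sigma>_hom[OF \<zeta>\<xi>]])
      (simp_all add: assms \<zeta>\<xi> \<sigma>_const \<sigma>_x \<sigma>_y hom_mult[OF \<sigma>_hom] hom_mult[OF \<iota>_hom])
  then show ?thesis by (metis comp_apply)
qed

lemma \<sigma>_1: "\<sigma> 1 h = h"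
proof -
  have "\<sigma> 1 = id"
    by (rule hom_eqI[OF \<sigma>_hom[OF one_\<mu>]])
      (auto simp: one_\<mu> \<sigma>_const \<sigma>_x \<sigma>_y unital_hom_def hom_1[OF \<iota>_hom])
  then show ?thesis by simp
qed

lemma \<sigma>_inverse:
  assumes "\<zeta> \<in> \<mu>"
  shows "\<sigma> \<zeta> (\<sigma> (inverse \<zeta>) h) = h" "\<sigma> (inverse \<zeta>) (\<sigma> \<zeta> h) = h"
  using assms \<mu>_nz[OF assms] by (simp_all add: \<sigma>_comp \<mu>_inverse \<sigma>_1)

lemma pullback_fun_eq:
  assumes "\<zeta> \<in> \<mu>"
  shows "pullback_fun \<iota> x y \<zeta> = \<sigma> \<zeta>"
  unfolding pullback_fun_def field_embedding_iff_unital_hom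
proof (rule the_equality)
  fix \<phi> :: "'f \<Rightarrow> 'f"
  assume "unital_hom \<phi> \<and> (\<forall>c. \<phi> (\<iota> c) = \<iota> c) \<and> \<phi> x = x \<and> \<phi> y = \<iota> \<zeta> * y"
  then show "\<phi> = \<sigma> \<zeta>"
    using assms by (intro hom_eqI) (auto simp: \<sigma>_hom \<sigma>_const \<sigma>_x \<sigma>_y)
qed (use assms in \<open>auto simp: \<sigma>_hom \<sigma>_const \<sigma>_x \<sigma>_y\<close>)

lemma inv_\<sigma>:
  assumes "\<zeta> \<in> \<mu>"
  shows "Hilbert_Choice.inv (\<sigma> \<zeta>) = \<sigma> (inverse \<zeta>)"
  using \<sigma>_inverse[OF assms] by (intro inv_equality) auto

lemma px_pderiv: "D (px p) = px (pderiv p)"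
  by (induction p)
    (auto simp: px_pCons D_add D_mult D_const D_x D_0 pderiv_pCons hom_0[OF px_hom] hom_add[OF px_hom]
      hom_0[OF \<iota>_hom])

lemma \<sigma>_px: "\<zeta> \<in> \<mu> \<Longrightarrow> \<sigma> \<zeta> (px p) = px p"
  by (simp add: px_altdef hom_sum[OF \<sigma>_hom] hom_mult[OF \<sigma>_hom] hom_power[OF \<sigma>_hom] \<sigma>_const \<sigma>_x)

lemma dlog_y: "D y / y = D (px f) / px f / of_nat N"
proof -
  have "D (px f) / px f = of_nat N * (D y / y)"
    using dlog_power[OF y_nz, of N] by (simp only: y_pow)
  then show ?thesis using of_nat_F_nz[of N] by simp
qed

text \<open>Agreement passes through the field operations, so the generators suffice. At y it holds
  because D y / y lies in K(x), which the automorphism fixes, and constants have derivative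
  0.\<close>

lemma \<sigma>_D:
  assumes \<zeta>: "\<zeta> \<in> \<mu>"
  shows "\<sigma> \<zeta> (D h) = D (\<sigma> \<zeta> h)"
proof (rule generated[where P = "\<lambda>h. \<sigma> \<zeta> (D h) = D (\<sigma> \<zeta> h)"])
  note hom = \<sigma>_hom[OF \<zeta>]
  note simps = hom_1[OF hom] hom_0[OF hom] hom_diff[OF hom] hom_mult[OF hom] hom_add[OF hom] hom_inverse[OF hom]
    hom_uminus[OF hom] hom_divide[OF hom] hom_power[OF hom]
  have Dy: "D y = y * (D (px f) / px f / of_nat N)"
    using dlog_y y_nz by (metis nonzero_mult_div_cancel_left times_divide_eq_right)
  show "\<sigma> \<zeta> (D y) = D (\<sigma> \<zeta> y)"
    by (simp add: Dy px_pderiv simps \<sigma>_y[OF \<zeta>] \<sigma>_px[OF \<zeta>] hom_of_nat[OF hom] D_mult D_const)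
  show "\<sigma> \<zeta> (D x) = D (\<sigma> \<zeta> x)" "\<sigma> \<zeta> (D 1) = D (\<sigma> \<zeta> 1)" "\<sigma> \<zeta> (D (\<iota> c)) = D (\<sigma> \<zeta> (\<iota> c))" for c
    by (simp_all add: D_x D_1 D_const \<sigma>_x \<sigma>_const \<zeta> simps)
  show "\<sigma> \<zeta> (D (a - b)) = D (\<sigma> \<zeta> (a - b))" "\<sigma> \<zeta> (D (a * b)) = D (\<sigma> \<zeta> (a * b))"
    if "\<sigma> \<zeta> (D a) = D (\<sigma> \<zeta> a)" "\<sigma> \<zeta> (D b) = D (\<sigma> \<zeta> b)" for a b
    using that by (simp_all add: D_diff D_mult simps)
  show "\<sigma> \<zeta> (D (inverse a)) = D (\<sigma> \<zeta> (inverse a))" if "\<sigma> \<zeta> (D a) = D (\<sigma> \<zeta> a)" for a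
    using that by (simp add: D_inverse simps)
qed

section \<open>Invariants and eigencomponents\<close>

lemma L_I: "q \<noteq> 0 \<Longrightarrow> h = px p / px q \<Longrightarrow> h \<in> L"
  unfolding L_def by blast

lemma L_px: "px p \<in> L"
  by (rule L_I[of 1 _ p]) (simp_all add: hom_1[OF px_hom])

lemma L_divide:
  assumes "a \<in> L" "b \<in> L"
  shows "a / b \<in> L"
proof -
  obtain p q p' q' where *: "a = px p / px q" "q \<noteq> 0" "b = px p' / px q'" "q' \<noteq> 0"
    using assms by (auto simp: L_def)
  show ?thesis
  proof (cases "p' = 0")
    case True
    then show ?thesis using * L_px[of 0] by (simp add: hom_0[OF px_hom])
  next
    case False
    then show ?thesis
      using * by (intro L_I[of "q * p'" _ "p * q'"]) (simp_all add: hom_mult[OF px_hom])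
  qed
qed

lemma L_mult: "a \<in> L \<Longrightarrow> b \<in> L \<Longrightarrow> a * b \<in> L"
  using L_divide[of a "1 / b"] L_divide[of 1 b] L_px[of 1] by (simp add: hom_1[OF px_hom])

lemma L_diff:
  assumes "a \<in> L" "b \<in> L"
  shows "a - b \<in> L"
proof -
  obtain p q p' q' where "a = px p / px q" "q \<noteq> 0" "b = px p' / px q'" "q' \<noteq> 0"
    using assms by (auto simp: L_def)
  then show ?thesis
    by (intro L_I[of "q * q'" _ "p * q' - p' * q"])
      (simp_all add: hom_mult[OF px_hom] hom_diff[OF px_hom] px_eq_0_iff diff_frac_eq)
qed

lemma L_subring: "subring_set L"
  using L_px[of 1] by (auto simp: subring_set_def L_mult L_diff hom_1[OF px_hom])

lemma L_const: "\<iota> c \<in> L"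
  using L_px[of "[:c:]"] by (simp add: px_const)

lemma L_x: "x \<in> L"
  using L_px[of "[:0, 1:]"] by (simp add: px_var)

lemma L_inverse: "a \<in> L \<Longrightarrow> inverse a \<in> L"
  using L_divide[of 1 a] L_px[of 1] by (simp add: hom_1[OF px_hom] divide_inverse)

lemma L_powi: "a \<in> L \<Longrightarrow> a powi k \<in> L"
  by (simp add: power_int_def subring_power[OF L_subring] L_inverse)

lemma \<sigma>_L: "\<zeta> \<in> \<mu> \<Longrightarrow> a \<in> L \<Longrightarrow> \<sigma> \<zeta> a = a"
  by (auto simp: L_def hom_divide[OF \<sigma>_hom] \<sigma>_px)

text \<open>Orthogonality of characters: the sum is unchanged by multiplication with
  \<open>\<xi> ^ i\<close>. An element with \<open>\<xi> ^ i \<noteq> 1\<close> is found by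
  counting, since T^k - 1 with k = i mod N < N cannot have N roots.\<close>

lemma sum_\<mu>: "(\<Sum>\<zeta>\<in>\<mu>. \<zeta> ^ i) = (if N dvd i then of_nat N else 0)"
proof (cases "N dvd i")
  case True
  then have "\<zeta> ^ i = 1" if "\<zeta> \<in> \<mu>" for \<zeta>
    using that by (auto simp: dvd_def power_mult roots_of_unity_def)
  then show ?thesis using True by (simp add: card_\<mu>)
next
  case False
  obtain \<xi> where \<xi>: "\<xi> \<in> \<mu>" "\<xi> ^ i \<noteq> 1"
  proof (rule ccontr)
    define k where "k = i mod N"
    have k: "1 \<le> k" "k < N" using False N1 by (auto simp: k_def Suc_le_eq mod_greater_zero_iff_not_dvd)
    assume "\<not> thesis"
    then have "\<zeta> ^ i = 1" if "\<zeta> \<in> \<mu>" for \<zeta> using \<open>\<And>\<xi>. \<xi> \<in> \<mu> \<Longrightarrow> \<xi> ^ i \<noteq> 1 \<Longrightarrow> thesis\<close> that by blast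
    moreover have "\<zeta> ^ i = \<zeta> ^ k" if "\<zeta> \<in> \<mu>" for \<zeta>
    proof -
      have "\<zeta> ^ i = \<zeta> ^ (N * (i div N) + k)" by (simp add: k_def)
      also have "\<dots> = \<zeta> ^ k" using that by (simp add: power_add power_mult roots_of_unity_def)
      finally show ?thesis .
    qed
    ultimately have "\<mu> \<subseteq> roots_of_unity k" by (auto simp: roots_of_unity_def)
    moreover have "finite (roots_of_unity k :: 'k set)" by (rule card_roots_of_unity_le(1)[OF k(1)])
    ultimately have "N \<le> card (roots_of_unity k :: 'k set)"
      using card_mono card_\<mu> by metis
    then show False using card_roots_of_unity_le(2)[OF k(1), where 'a = 'k] k by linarith
  qed
  have "(\<Sum>\<zeta>\<in>\<mu>. \<zeta> ^ i) = (\<Sum>\<zeta>\<in>\<mu>. (\<xi> * \<zeta>) ^ i)"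
    using \<mu>_nz[OF \<xi>(1)] \<mu>_mult[OF \<xi>(1)] \<mu>_mult[OF \<mu>_inverse[OF \<xi>(1)]]
    by (intro sum.reindex_bij_witness[of _ "\<lambda>\<zeta>. \<xi> * \<zeta>" "\<lambda>\<zeta>. inverse \<xi> * \<zeta>"]) (auto simp: mult.assoc[symmetric])
  also have "\<dots> = \<xi> ^ i * (\<Sum>\<zeta>\<in>\<mu>. \<zeta> ^ i)"
    by (simp add: power_mult_distrib sum_distrib_left)
  finally have "(1 - \<xi> ^ i) * (\<Sum>\<zeta>\<in>\<mu>. \<zeta> ^ i) = 0" by (simp add: algebra_simps)
  then show ?thesis using \<xi> False by simp
qed

lemma sum_\<iota>_\<mu>: "(\<Sum>\<zeta>\<in>\<mu>. \<iota> \<zeta> ^ i) = (if N dvd i then of_nat N else 0)"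
proof -
  have "(\<Sum>\<zeta>\<in>\<mu>. \<iota> \<zeta> ^ i) = \<iota> (\<Sum>\<zeta>\<in>\<mu>. \<zeta> ^ i)"
    by (simp add: hom_sum[OF \<iota>_hom] hom_power[OF \<iota>_hom])
  then show ?thesis by (simp add: sum_\<mu> hom_0[OF \<iota>_hom] hom_of_nat[OF \<iota>_hom])
qed

lemma pxy_altdef: "pxy P = (\<Sum>i\<le>degree P. px (coeff P i) * y ^ i)"
  unfolding pxy_def by (rule eval_hom_altdef[OF px_hom px_eq_0_iff])

lemma \<sigma>_pxy: "\<zeta> \<in> \<mu> \<Longrightarrow> \<sigma> \<zeta> (pxy P) = (\<Sum>i\<le>degree P. px (coeff P i) * (\<iota> \<zeta> * y) ^ i)"
  by (simp add: pxy_altdef hom_sum[OF \<sigma>_hom] hom_mult[OF \<sigma>_hom] hom_power[OF \<sigma>_hom] \<sigma>_px \<sigma>_y)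

text \<open>Averaging over the group removes all powers y^i with N not dividing i, and the remaining
  ones are powers of f.\<close>

lemma fixed_pxy_L:
  assumes "\<And>\<zeta>. \<zeta> \<in> \<mu> \<Longrightarrow> \<sigma> \<zeta> (pxy P) = pxy P"
  shows "pxy P \<in> L"
proof -
  have "of_nat N * pxy P = (\<Sum>\<zeta>\<in>\<mu>. \<sigma> \<zeta> (pxy P))"
    using assms by (simp add: card_\<mu>)
  also have "\<dots> = (\<Sum>\<zeta>\<in>\<mu>. \<Sum>i\<le>degree P. px (coeff P i) * y ^ i * \<iota> \<zeta> ^ i)"
    by (intro sum.cong refl) (simp add: \<sigma>_pxy power_mult_distrib ac_simps)
  also have "\<dots> = (\<Sum>i\<le>degree P. px (coeff P i) * y ^ i * (\<Sum>\<zeta>\<in>\<mu>. \<iota> \<zeta> ^ i))"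
    by (subst sum.swap) (simp add: sum_distrib_left)
  finally have eq: "of_nat N * pxy P = \<dots>" .
  have "\<dots> \<in> L"
  proof (intro subring_sum[OF L_subring])
    fix i
    show "px (coeff P i) * y ^ i * (\<Sum>\<zeta>\<in>\<mu>. \<iota> \<zeta> ^ i) \<in> L"
    proof (cases "N dvd i")
      case True
      then obtain k where "i = N * k" by (auto simp: dvd_def)
      then have "y ^ i = px (f ^ k)" by (simp add: power_mult y_pow hom_power[OF px_hom])
      then show ?thesis
        using True L_const[of "of_nat N"] by (simp add: sum_\<iota>_\<mu> L_mult L_px hom_of_nat[OF \<iota>_hom])
    next
      case False
      then show ?thesis using L_const[of 0] by (simp add: sum_\<iota>_\<mu> hom_0[OF \<iota>_hom])
    qed
  qed
  then have "of_nat N * pxy P / \<iota> (of_nat N) \<in> L" unfolding eq by (intro L_divide L_const)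
  then show ?thesis using of_nat_F_nz[of N] by (simp add: hom_of_nat[OF \<iota>_hom])
qed

lemmas range_pxy_subring = subring_range_hom[OF pxy_hom]

lemma \<sigma>_range_pxy: "\<zeta> \<in> \<mu> \<Longrightarrow> \<sigma> \<zeta> (pxy P) \<in> range pxy"
  unfolding \<sigma>_pxy
proof (intro subring_sum[OF range_pxy_subring] subring_mult[OF range_pxy_subring]
    subring_power[OF range_pxy_subring])
  show "px p \<in> range pxy" "\<iota> c \<in> range pxy" "y \<in> range pxy" for p c
    by (metis pxy_const px_const pxy_var rangeI)+
qed

text \<open>Clearing denominators by the norm of the denominator reduces to polynomials in \<open>y\<close>.\<close>

lemma fixed_L:
  assumes fixed: "\<And>\<zeta>. \<zeta> \<in> \<mu> \<Longrightarrow> \<sigma> \<zeta> h = h"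
  shows "h \<in> L"
proof -
  obtain P Q where PQ: "pxy Q \<noteq> 0" "h = pxy P / pxy Q" using pxy_fraction by blast
  define n where "n = (\<Prod>\<zeta>\<in>\<mu>. \<sigma> \<zeta> (pxy Q))"
  have "\<sigma> \<xi> n = n" if \<xi>: "\<xi> \<in> \<mu>" for \<xi>
  proof -
    have "\<sigma> \<xi> n = (\<Prod>\<zeta>\<in>\<mu>. \<sigma> (\<xi> * \<zeta>) (pxy Q))"
      unfolding n_def by (simp add: hom_prod[OF \<sigma>_hom[OF \<xi>]] \<sigma>_comp \<xi>)
    also have "\<dots> = n"
      unfolding n_def using \<mu>_nz[OF \<xi>] \<mu>_mult[OF \<xi>] \<mu>_mult[OF \<mu>_inverse[OF \<xi>]]
      by (intro prod.reindex_bij_witness[of _ "\<lambda>\<zeta>. inverse \<xi> * \<zeta>" "\<lambda>\<zeta>. \<xi> * \<zeta>"]) (auto simp: mult.assoc[symmetric])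
    finally show ?thesis .
  qed
  moreover have "n \<in> range pxy"
    unfolding n_def by (intro subring_prod[OF range_pxy_subring] \<sigma>_range_pxy)
  ultimately have n: "n \<in> L" using fixed_pxy_L by auto
  have n_nz: "n \<noteq> 0"
    using PQ(1) finite_\<mu> by (auto simp: n_def hom_eq_0_iff[OF \<sigma>_hom])
  have "n = pxy Q * (\<Prod>\<zeta>\<in>\<mu> - {1}. \<sigma> \<zeta> (pxy Q))"
    unfolding n_def using finite_\<mu> one_\<mu> by (simp add: prod.remove \<sigma>_1)
  then have "h * n = pxy P * (\<Prod>\<zeta>\<in>\<mu> - {1}. \<sigma> \<zeta> (pxy Q))"
    using PQ by simp
  also have "\<dots> \<in> range pxy"
    by (intro subring_mult[OF range_pxy_subring] subring_prod[OF range_pxy_subring] \<sigma>_range_pxy rangeI) auto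
  finally have "h * n \<in> range pxy" .
  moreover have "\<sigma> \<xi> (h * n) = h * n" if "\<xi> \<in> \<mu>" for \<xi>
    using that n by (simp add: hom_mult[OF \<sigma>_hom] fixed \<sigma>_L)
  ultimately have "h * n \<in> L" using fixed_pxy_L by auto
  then have "h * n / n \<in> L" using n by (rule L_divide)
  then show ?thesis using n_nz by simp
qed

text \<open>Projection onto the functions g(x) / y^s. The weight is \<zeta>^s because the
  automorphism multiplies 1 / y^s by \<zeta>^(-s).\<close>

definition proj :: "nat \<Rightarrow> 'f \<Rightarrow> 'f" where
  "proj s h = (\<Sum>\<zeta>\<in>\<mu>. \<iota> \<zeta> ^ s * \<sigma> \<zeta> h) / of_nat N"

lemma proj_L: "proj s h * y ^ s \<in> L"
proof (rule fixed_L)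
  fix \<xi> assume \<xi>: "\<xi> \<in> \<mu>"
  have "\<sigma> \<xi> (\<Sum>\<zeta>\<in>\<mu>. \<iota> \<zeta> ^ s * \<sigma> \<zeta> h) * \<iota> \<xi> ^ s = (\<Sum>\<zeta>\<in>\<mu>. \<iota> (\<xi> * \<zeta>) ^ s * \<sigma> (\<xi> * \<zeta>) h)"
    by (simp add: hom_sum[OF \<sigma>_hom[OF \<xi>]] hom_mult[OF \<sigma>_hom[OF \<xi>]] hom_power[OF \<sigma>_hom[OF \<xi>]] \<sigma>_const \<sigma>_comp \<xi>
        hom_mult[OF \<iota>_hom] sum_distrib_left sum_distrib_right power_mult_distrib ac_simps)
  also have "\<dots> = (\<Sum>\<zeta>\<in>\<mu>. \<iota> \<zeta> ^ s * \<sigma> \<zeta> h)"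
    using \<mu>_nz[OF \<xi>] \<mu>_mult[OF \<xi>] \<mu>_mult[OF \<mu>_inverse[OF \<xi>]]
    by (intro sum.reindex_bij_witness[of _ "\<lambda>\<zeta>. inverse \<xi> * \<zeta>" "\<lambda>\<zeta>. \<xi> * \<zeta>"]) (auto simp: mult.assoc[symmetric])
  finally show "\<sigma> \<xi> (proj s h * y ^ s) = proj s h * y ^ s"
    unfolding proj_def using \<xi>
    by (simp add: hom_mult[OF \<sigma>_hom] hom_divide[OF \<sigma>_hom] hom_power[OF \<sigma>_hom] \<sigma>_y hom_of_nat[OF \<sigma>_hom]
        power_mult_distrib mult.assoc[symmetric])
qed

text \<open>The weights sum to a geometric series, which vanishes for every \<zeta> other than
  1.\<close>

lemma sum_proj: "(\<Sum>s<N. proj s h) = h"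
proof -
  have g: "(\<Sum>s<N. \<iota> \<zeta> ^ s) = (if \<zeta> = 1 then of_nat N else 0)" if \<zeta>: "\<zeta> \<in> \<mu>" for \<zeta>
  proof (cases "\<zeta> = 1")
    case False
    then have "\<iota> \<zeta> \<noteq> 1" using hom_eq_iff[OF \<iota>_hom, of \<zeta> 1] by (simp add: hom_1[OF \<iota>_hom])
    then show ?thesis using False \<iota>_\<mu>_pow[OF \<zeta>] by (simp add: geometric_sum)
  qed (simp add: hom_1[OF \<iota>_hom])
  have "(\<Sum>s<N. proj s h) = (\<Sum>\<zeta>\<in>\<mu>. (\<Sum>s<N. \<iota> \<zeta> ^ s) * \<sigma> \<zeta> h) / of_nat N"
    unfolding proj_def sum_divide_distrib[symmetric] sum_distrib_right by (subst sum.swap) simp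
  also have "(\<Sum>\<zeta>\<in>\<mu>. (\<Sum>s<N. \<iota> \<zeta> ^ s) * \<sigma> \<zeta> h) = (\<Sum>\<zeta>\<in>\<mu>. if \<zeta> = 1 then of_nat N * h else 0)"
    by (intro sum.cong refl) (simp add: g \<sigma>_1)
  also have "\<dots> / of_nat N = h"
    using finite_\<mu> one_\<mu> of_nat_F_nz[of N] by simp
  finally show ?thesis .
qed

lemma \<sigma>_eigen:
  assumes \<zeta>: "\<zeta> \<in> \<mu>" and h: "h * y ^ s \<in> L"
  shows "\<sigma> \<zeta> h = h / \<iota> \<zeta> ^ s"
proof -
  have "\<sigma> \<zeta> h * (\<iota> \<zeta> * y) ^ s = h * y ^ s"
    using \<sigma>_L[OF \<zeta> h] by (simp add: hom_mult[OF \<sigma>_hom[OF \<zeta>]] hom_power[OF \<sigma>_hom[OF \<zeta>]] \<sigma>_y[OF \<zeta>])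
  then have "\<sigma> \<zeta> h * \<iota> \<zeta> ^ s * y ^ s = h * y ^ s" by (simp add: power_mult_distrib mult.assoc)
  then show ?thesis
    using y_nz \<mu>_nz[OF \<zeta>] by (simp add: hom_eq_0_iff[OF \<iota>_hom] nonzero_eq_divide_eq)
qed

lemma proj_eigen:
  assumes s: "s < N" "k < N" and h: "h * y ^ s \<in> L"
  shows "proj k h = (if k = s then h else 0)"
proof -
  \<comment> \<open>N is added before subtracting s to stay within natural numbers; \<zeta>^N = 1
    makes this harmless.\<close>
  have "proj k h = (\<Sum>\<zeta>\<in>\<mu>. h * \<iota> \<zeta> ^ (k + N - s)) / of_nat N"
  proof -
    have "\<iota> \<zeta> ^ k * \<sigma> \<zeta> h = h * \<iota> \<zeta> ^ (k + N - s)" if \<zeta>: "\<zeta> \<in> \<mu>" for \<zeta>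
    proof -
      have "\<iota> \<zeta> \<noteq> 0" using \<mu>_nz[OF \<zeta>] by (simp add: hom_eq_0_iff[OF \<iota>_hom])
      moreover have "\<iota> \<zeta> ^ (k + N - s) * \<iota> \<zeta> ^ s = \<iota> \<zeta> ^ k"
        using s \<iota>_\<mu>_pow[OF \<zeta>] by (simp flip: power_add) (simp add: power_add)
      ultimately show ?thesis by (simp add: \<sigma>_eigen[OF \<zeta> h] nonzero_divide_eq_eq mult.assoc)
    qed
    then show ?thesis by (simp add: proj_def)
  qed
  also have "\<dots> = h * (if N dvd k + N - s then of_nat N else 0) / of_nat N"
    by (simp only: sum_distrib_left[symmetric] sum_\<iota>_\<mu>)
  \<comment> \<open>The exponent lies strictly between 0 and 2 N, so N divides it only when it
    equals N.\<close>
  also have "N dvd k + N - s \<longleftrightarrow> k = s"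
  proof
    assume "N dvd k + N - s"
    then obtain c where c: "k + N - s = N * c" by (auto simp: dvd_def)
    have "c = 1"
    proof (rule ccontr)
      assume "c \<noteq> 1"
      then consider "c = 0" | "c \<ge> 2" by linarith
      then show False
      proof cases
        case 2
        then have "N * 2 \<le> N * c" by simp
        then show False using c s by linarith
      qed (use c s in auto)
    qed
    then show "k = s" using c s by simp
  qed simp
  finally show ?thesis using of_nat_F_nz[of N] by simp
qed

end

section \<open>Differentials at a place\<close>

text \<open>The coefficients h for which h dx is regular at R. \<open>D\<close> stands for da/dx, so
  the abstract space of forms can be left aside until the end.\<close>

definition (in superelliptic) forms_module :: "'f set \<Rightarrow> 'f set" where
  "forms_module R = {(\<Sum>a\<in>S. u a * D a) | S u. finite S \<and> S \<subseteq> R \<and> u ` S \<subseteq> R}"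

locale superelliptic_place = superelliptic N r A lam f \<iota> x y + valuation_ring R
  for N r :: nat and A :: "nat \<Rightarrow> nat" and lam :: "nat \<Rightarrow> 'k::field" and f :: "'k poly"
    and \<iota> :: "'k \<Rightarrow> 'f::field" and x y :: 'f and R :: "'f set" +
  assumes const_R: "\<iota> c \<in> R"
begin

lemma const_unit: "c \<noteq> 0 \<Longrightarrow> \<iota> c \<in> units"
  using const_R[of c] const_R[of "inverse c"]
  by (auto simp: units_def hom_eq_0_iff[OF \<iota>_hom] hom_inverse[OF \<iota>_hom])

lemma of_nat_R: "of_nat n \<in> R"
  using const_R[of "of_nat n"] by (simp add: hom_of_nat[OF \<iota>_hom])

lemma of_int_R: "of_int n \<in> R"
  using const_R[of "of_int n"] by (simp add: hom_of_int[OF \<iota>_hom])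

lemma of_nat_unit: "n dvd N \<Longrightarrow> of_nat n \<in> units"
  using const_unit[of "of_nat n"] of_nat_K_nz[of n] by (simp add: hom_of_nat[OF \<iota>_hom])

lemma power_N_R_iff: "z ^ N \<in> R \<longleftrightarrow> z \<in> R"
  using root_in_R[of z N] R_power[of z N] N1 by auto

lemma px_R: "x \<in> R \<Longrightarrow> px p \<in> R"
  by (simp add: px_altdef R_sum R_mult R_power const_R)

text \<open>
  The integral closure of a valuation ring of \<open>K(x)\<close> localizes to \<open>R\<close>: \<open>a\<close> is a root of the norm
  polynomial \<open>\<Prod> (T - \<sigma> a)\<close>, which is cut at its dominant coefficient \<open>j\<close>.  After division by that
  coefficient, \<open>u = b\<^sub>j + b\<^sub>j\<^sub>+\<^sub>1 a + \<dots>\<close> and \<open>w = - (b\<^sub>j\<^sub>-\<^sub>1 + b\<^sub>j\<^sub>-\<^sub>2 / a + \<dots>)\<close> satisfy \<open>a u = w\<close>,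
  so each of them is integral wherever \<open>a\<close> or \<open>1 / a\<close> is.
\<close>

lemma integral_fraction:
  assumes a: "a \<in> R"
  shows "\<exists>u w. u \<in> units \<and> w = a * u \<and> (\<forall>\<zeta>\<in>\<mu>. \<sigma> \<zeta> u \<in> R \<and> \<sigma> \<zeta> w \<in> R)"
proof (cases "a = 0")
  case True
  then show ?thesis
    by (intro exI[of _ 1] exI[of _ 0])
      (auto simp: one_unit R_0 R_1 hom_1[OF \<sigma>_hom] hom_0[OF \<sigma>_hom])
next
  case False
  define F where "F = (\<Prod>\<zeta>\<in>\<mu>. [:- \<sigma> \<zeta> a, 1:])"
  have deg: "degree F = N"
    by (simp add: F_def degree_prod_eq_sum_degree card_\<mu>)
  have lc: "coeff F N = 1"
    using lead_coeff_prod[of "\<lambda>\<zeta>. [:- \<sigma> \<zeta> a, 1:]" \<mu>] deg by (simp add: F_def)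
  \<comment> \<open>The automorphisms permute the linear factors of F, so its coefficients are
    invariant and lie in K(x).\<close>
  have FL: "coeff F i \<in> L" for i
  proof (rule fixed_L)
    fix \<xi> assume \<xi>: "\<xi> \<in> \<mu>"
    note hom = \<sigma>_hom[OF \<xi>]
    have "map_poly (\<sigma> \<xi>) F = (\<Prod>\<zeta>\<in>\<mu>. [:- \<sigma> (\<xi> * \<zeta>) a, 1:])"
      unfolding F_def hom_prod[OF unital_hom_map_poly[OF hom]]
      by (intro prod.cong refl)
        (simp add: map_poly_pCons hom_0[OF hom] hom_1[OF hom] hom_uminus[OF hom] \<sigma>_comp \<xi>)
    also have "\<dots> = F"
      unfolding F_def using \<mu>_nz[OF \<xi>] \<mu>_mult[OF \<xi>] \<mu>_mult[OF \<mu>_inverse[OF \<xi>]]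
      by (intro prod.reindex_bij_witness[of _ "\<lambda>\<zeta>. inverse \<xi> * \<zeta>" "\<lambda>\<zeta>. \<xi> * \<zeta>"]) (auto simp: mult.assoc[symmetric])
    finally show "\<sigma> \<xi> (coeff F i) = coeff F i"
      using coeff_map_poly[of "\<sigma> \<xi>" F i] by (simp add: hom_0[OF hom])
  qed
  obtain j where j: "j \<le> N" "coeff F j \<noteq> 0" "\<And>i. i \<le> N \<Longrightarrow> coeff F i / coeff F j \<in> R"
    "\<And>i. i \<le> N \<Longrightarrow> j < i \<Longrightarrow> coeff F i / coeff F j \<in> nonunits"
    using dominant_index[of N "coeff F"] lc by force
  define b where "b i = coeff F i / coeff F j" for i
  have b: "b j = 1" "\<And>i. b i \<in> L" "\<And>i. i \<le> N \<Longrightarrow> b i \<in> R" "\<And>i. i \<le> N \<Longrightarrow> j < i \<Longrightarrow> b i \<in> nonunits"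
    using j FL by (auto simp: b_def L_divide)
  define U where "U z = (\<Sum>i=j..N. b i * z ^ (i - j))" for z
  define W where "W z = - (\<Sum>i<j. b i * inverse z ^ (j - 1 - i))" for z
  have \<sigma>UW: "\<sigma> \<zeta> (U z) = U (\<sigma> \<zeta> z)" "\<sigma> \<zeta> (W z) = W (\<sigma> \<zeta> z)" if "\<zeta> \<in> \<mu>" for \<zeta> z
    using that by (simp_all add: U_def W_def hom_sum[OF \<sigma>_hom] hom_mult[OF \<sigma>_hom] hom_power[OF \<sigma>_hom]
        hom_inverse[OF \<sigma>_hom] hom_uminus[OF \<sigma>_hom] \<sigma>_L b)
  have UW: "W z = z * U z" if z: "z \<noteq> 0" and root: "poly F z = 0" for z
  proof -
    have "(\<Sum>i\<le>N. b i * z ^ i) = poly F z / coeff F j"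
      by (simp add: poly_altdef deg b_def sum_divide_distrib)
    then have 0: "(\<Sum>i\<le>N. b i * z ^ i) = 0" using root by simp
    have "z ^ j * (z * U z) = z * (\<Sum>i=j..N. b i * z ^ i)"
    proof -
      have "z ^ j * U z = (\<Sum>i=j..N. b i * z ^ i)"
        unfolding U_def sum_distrib_left
        by (intro sum.cong refl) (simp add: mult.left_commute flip: power_add)
      then show ?thesis by (simp add: mult.left_commute)
    qed
    moreover have "z ^ j * W z = - (z * (\<Sum>i<j. b i * z ^ i))"
    proof -
      have "z ^ j * inverse z ^ (j - 1 - i) = z * z ^ i" if "i < j" for i
      proof -
        have "z ^ j = z ^ (j - 1 - i) * (z * z ^ i)"
          using that by (simp flip: power_Suc power_add)
        then show ?thesis using z by (simp add: power_inverse)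
      qed
      then have "z ^ j * (b i * inverse z ^ (j - 1 - i)) = z * (b i * z ^ i)" if "i < j" for i
        using that by (metis mult.left_commute)
      then show ?thesis
        unfolding W_def sum_distrib_left mult_minus_right by (intro arg_cong[of _ _ uminus] sum.cong) auto
    qed
    moreover have "{..N} = {..<j} \<union> {j..N}" using j(1) by auto
    then have "(\<Sum>i\<le>N. b i * z ^ i) = (\<Sum>i<j. b i * z ^ i) + (\<Sum>i=j..N. b i * z ^ i)"
      by (subst sum.union_disjoint[symmetric]) auto
    then have "(\<Sum>i=j..N. b i * z ^ i) = - (\<Sum>i<j. b i * z ^ i)"
      using 0 by (simp add: eq_neg_iff_add_eq_0 add.commute)
    ultimately have "z ^ j * (z * U z) = z ^ j * W z" by simp
    then show ?thesis using z by simp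
  qed
  have "\<sigma> \<zeta> (U a) \<in> R \<and> \<sigma> \<zeta> (W a) \<in> R" if \<zeta>: "\<zeta> \<in> \<mu>" for \<zeta>
  proof -
    define z where "z = \<sigma> \<zeta> a"
    have z: "z \<noteq> 0" using False by (simp add: z_def hom_eq_0_iff[OF \<sigma>_hom[OF \<zeta>]])
    have "poly F z = 0" using \<zeta> finite_\<mu> by (auto simp: F_def poly_prod z_def intro!: prod_zero)
    then have UWz: "W z = z * U z" by (rule UW[OF z])
    have "U z \<in> R \<and> W z \<in> R"
    proof (cases "z \<in> R")
      case True
      then have "U z \<in> R" unfolding U_def by (intro R_sum R_mult R_power b) auto
      then show ?thesis using True by (simp add: UWz R_mult)
    next
      case False
      then have inv: "inverse z \<in> R" using total by blast
      then have W: "W z \<in> R" unfolding W_def using j(1) by (intro R_uminus R_sum R_mult R_power b) auto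
      then have "inverse z * W z \<in> R" by (rule R_mult[OF inv])
      then show ?thesis using W z by (simp add: UWz mult.assoc[symmetric])
    qed
    then show ?thesis by (simp add: \<sigma>UW \<zeta> z_def)
  qed
  moreover have "W a = a * U a"
    using False finite_\<mu> one_\<mu> by (intro UW) (auto simp: F_def poly_prod \<sigma>_1 intro!: prod_zero bexI[of _ 1])
  moreover have "U a \<in> units"
  proof -
    \<comment> \<open>Here j must be the largest dominant index: all later b_i are nonunits, so U a
      is 1 plus an element of the maximal ideal. At the other conjugates only b_i in R is
      used.\<close>
    have "U a = 1 + (\<Sum>i=Suc j..N. b i * a ^ (i - j))"
      unfolding U_def using j(1) b(1) by (simp add: sum.atLeast_Suc_atMost)
    moreover have "(\<Sum>i=Suc j..N. b i * a ^ (i - j)) \<in> nonunits"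
    proof (rule nonunit_sum)
      fix i assume "i \<in> {Suc j..N}"
      then have "a ^ (i - j) * b i \<in> nonunits" by (intro nonunit_mult b R_power a) auto
      then show "b i * a ^ (i - j) \<in> nonunits" by (simp add: mult.commute)
    qed
    ultimately show ?thesis by (simp add: unit_add_nonunit one_unit)
  qed
  ultimately show ?thesis by blast
qed

text \<open>If all conjugates of z lie in R, then so do its eigencomponents, as 1/N is in R, and the
  bound for eigenfunctions gives D z in E. An arbitrary a need not have this property, but a = w / u
  with such u and w and u a unit, and u D a = D w - a D u.\<close>

lemma derivation_bound:
  assumes E: "0 \<in> E" "\<And>a b. a \<in> E \<Longrightarrow> b \<in> E \<Longrightarrow> a + b \<in> E" "\<And>a b. a \<in> R \<Longrightarrow> b \<in> E \<Longrightarrow> a * b \<in> E"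
    and eigen: "\<And>h s. h \<in> R \<Longrightarrow> s < N \<Longrightarrow> h * y ^ s \<in> L \<Longrightarrow> D h \<in> E"
    and a: "a \<in> R"
  shows "D a \<in> E"
proof -
  have sumE: "sum g I \<in> E" if "\<And>i. i \<in> I \<Longrightarrow> g i \<in> E" for g and I :: "nat set"
    using that by (induction I rule: infinite_finite_induct) (auto intro: E)
  have DE: "D z \<in> E" if z: "\<And>\<zeta>. \<zeta> \<in> \<mu> \<Longrightarrow> \<sigma> \<zeta> z \<in> R" for z
  proof -
    have "proj s z \<in> R" for s
      unfolding proj_def divide_inverse
      using z of_nat_unit[of N] by (intro R_mult R_sum R_power const_R units_inverse_R) auto
    then have "D (proj s z) \<in> E" if "s < N" for s
      using that proj_L[of s z] by (intro eigen)
    then have "(\<Sum>s<N. D (proj s z)) \<in> E" by (intro sumE) auto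
    then show ?thesis by (simp add: sum_proj flip: D_sum)
  qed
  obtain u w where u: "u \<in> units" "w = a * u" "\<And>\<zeta>. \<zeta> \<in> \<mu> \<Longrightarrow> \<sigma> \<zeta> u \<in> R" "\<And>\<zeta>. \<zeta> \<in> \<mu> \<Longrightarrow> \<sigma> \<zeta> w \<in> R"
    using integral_fraction[OF a] by blast
  have "inverse u * (D w + (- a) * D u) \<in> E"
    using u a by (intro E DE R_uminus units_inverse_R)
  moreover have "D w + (- a) * D u = u * D a" by (simp add: u(2) D_mult algebra_simps)
  ultimately show ?thesis using units_nz[OF u(1)] by (simp add: mult.assoc[symmetric])
qed

lemma forms_module_upper:
  assumes E: "0 \<in> E" "\<And>a b. a \<in> E \<Longrightarrow> b \<in> E \<Longrightarrow> a + b \<in> E" "\<And>a b. a \<in> R \<Longrightarrow> b \<in> E \<Longrightarrow> a * b \<in> E"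
    and eigen: "\<And>h s. h \<in> R \<Longrightarrow> s < N \<Longrightarrow> h * y ^ s \<in> L \<Longrightarrow> D h \<in> E"
  shows "forms_module R \<subseteq> E"
proof -
  have "(\<Sum>a\<in>S. u a * D a) \<in> E" if "finite S" "S \<subseteq> R" "u ` S \<subseteq> R" for S u
    using that by (induction S rule: finite_induct) (auto intro!: E derivation_bound[OF E eigen])
  then show ?thesis by (auto simp: forms_module_def)
qed

lemma forms_module_I: "a \<in> R \<Longrightarrow> b \<in> R \<Longrightarrow> a * D b \<in> forms_module R"
  unfolding forms_module_def by (intro CollectI exI[of _ "{b}"] exI[of _ "\<lambda>_. a"]) auto

lemma L_coprime:
  assumes "g \<in> L"
  shows "\<exists>p q a b. q \<noteq> 0 \<and> g = px p / px q \<and> a * p + b * q = 1"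
proof -
  obtain p q where g: "g = px p / px q" "q \<noteq> 0" using assms by (auto simp: L_def)
  obtain e p' q' a b where *: "p = e * p'" "q = e * q'" "a * p' + b * q' = 1"
    using poly_bezout[OF g(2)] by blast
  then have "q' \<noteq> 0" "px e \<noteq> 0" using g(2) px_eq_0_iff by auto
  moreover then have "g = px p' / px q'" using g * by (simp add: hom_mult[OF px_hom])
  ultimately show ?thesis using *(3) by blast
qed

text \<open>Bezout gives 1 = (a p/q + b) q with the bracket in R, so q cannot lie in the maximal
  ideal.\<close>

lemma coprime_unit:
  assumes x: "x \<in> R" and q: "q \<noteq> 0" and g: "px p / px q \<in> R" and "a * p + b * q = 1"
  shows "px q \<in> units"
proof (rule ccontr)
  assume "px q \<notin> units"
  then have nq: "px q \<in> nonunits" using R_cases px_R[OF x] by blast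
  have "px a * (px p / px q) + px b \<in> R" using x g by (intro R_add R_mult px_R)
  then have "(px a * (px p / px q) + px b) * px q \<in> nonunits" by (rule nonunit_mult[OF nq])
  moreover have "(px a * (px p / px q) + px b) * px q = px (a * p + b * q)"
    using q px_eq_0_iff by (simp add: hom_add[OF px_hom] hom_mult[OF px_hom] distrib_right)
  ultimately have "1 \<in> nonunits" using assms(4) by (simp add: hom_1[OF px_hom])
  then show False using one_unit units_not_nonunits by blast
qed

lemma quotient_derivative_R:
  assumes "x \<in> R" "px q \<in> units"
  shows "D (px p / px q) \<in> R"
proof -
  have "D (px p * inverse (px q)) = px p * (- px (pderiv q) * (inverse (px q)) ^ 2) + px (pderiv p) * inverse (px q)"
    by (simp add: D_mult D_inverse px_pderiv divide_inverse power_inverse)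
  also have "\<dots> \<in> R" using assms by (intro R_add R_mult R_uminus px_R R_power units_inverse_R)
  finally show ?thesis by (simp add: divide_inverse)
qed

text \<open>Since y is a unit, an eigenfunction g(x) / y^s in R has g in R. The reduced denominator
  of g is then a unit, and so differentiation does not leave R. As D x = 1, the regular forms are R
  dx; no uniformizer and no separability of the residue field is involved.\<close>

lemma unramified:
  assumes x: "x \<in> R" and un: "\<And>j. j \<le> r \<Longrightarrow> x - \<iota> (lam j) \<in> units"
    and g: "h * y ^ s \<in> L"
  shows "h \<in> forms_module R \<longleftrightarrow> h \<in> R" and "y \<in> units"
proof -
  have f: "px f \<in> units" unfolding px_f by (intro unit_prod unit_power un) auto
  then show y: "y \<in> units" using root_unit[of y N] N1 by (simp add: y_pow)
  have dy: "D y / y \<in> R"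
  proof -
    have "D y / y = px (pderiv f) * inverse (px f) * inverse (of_nat N)"
      unfolding dlog_y px_pderiv by (simp add: divide_inverse)
    also have "\<dots> \<in> R" using f of_nat_unit[of N] x by (intro R_mult px_R units_inverse_R) auto
    finally show ?thesis .
  qed
  have "forms_module R \<subseteq> R"
  proof (rule forms_module_upper)
    fix h s assume h: "h \<in> R" "h * y ^ s \<in> L"
    let ?g = "h * y ^ s"
    have gR: "?g \<in> R" by (rule R_mult[OF h(1) R_power[OF units_R[OF y]]])
    obtain p q a b where pq: "q \<noteq> 0" "?g = px p / px q" "a * p + b * q = 1"
      using L_coprime[OF h(2)] by blast
    then have "px q \<in> units" using coprime_unit[OF x pq(1) _ pq(3)] gR by simp
    then have Dg: "D ?g \<in> R" unfolding pq(2) by (rule quotient_derivative_R[OF x])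
    have "D (y ^ s) = y ^ s * (of_nat s * (D y / y))"
      using dlog_power[OF y_nz, of s] y_nz by (simp add: nonzero_divide_eq_eq mult.commute)
    then have "D ?g = h * (y ^ s * (of_nat s * (D y / y))) + D h * y ^ s" by (simp only: D_mult)
    then have "D h * y ^ s = D ?g - h * (y ^ s * (of_nat s * (D y / y)))" by (simp add: algebra_simps)
    also have "\<dots> \<in> R" by (intro R_diff Dg R_mult h R_power of_nat_R dy units_R[OF y])
    finally show "D h \<in> R" using R_mult_unit_iff[OF unit_power[OF y]] by blast
  qed (auto intro: R_0 R_add R_mult)
  then show "h \<in> forms_module R \<longleftrightarrow> h \<in> R"
    using forms_module_I[OF _ x, of h] by (auto simp: D_x)
qed

text \<open>
  A place at which \<open>\<xi>\<close> uniformizes \<open>K(x)\<close> and \<open>y\<^sup>N\<close> has order \<open>B\<close>.  With \<open>lg z\<close> the logarithmic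
  derivative with respect to \<open>ln \<xi>\<close>, \<open>t = y\<^sup>u \<xi>\<^sup>v\<close> with \<open>u B + v N = gcd B N\<close> has \<open>lg t\<close> a unit, while
  \<open>lg h \<in> \<xi> R\<close> for every eigenfunction \<open>h\<close> that is a unit.
\<close>

lemma ramified:
  fixes \<xi> c0 :: 'f and B \<rho> :: int
  defines "good \<equiv> (\<lambda>c. c \<in> units \<and> D c / D \<xi> \<in> R)"
  assumes \<xi>: "\<xi> \<in> nonunits" "\<xi> \<noteq> 0"
    and rep: "\<And>g. g \<in> L \<Longrightarrow> g \<noteq> 0 \<Longrightarrow> \<exists>k c. g = \<xi> powi k * c \<and> good c"
    and f: "px f = \<xi> powi B * c0" "good c0"
    and D\<xi>: "D \<xi> = \<eta> * \<xi> powi \<rho>" "\<eta> \<in> units"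
    and s: "s < N" and h: "h * y ^ s = \<xi> powi k * c" "c \<in> units"
  shows "h \<in> forms_module R \<longleftrightarrow> int N * k - int s * B + int N - int N * \<rho> - gcd B (int N) \<ge> 0"
proof -
  define a where "a = gcd B (int N)"
  have a: "a > 0" "a dvd int N" "a dvd B" using N1 by (auto simp: a_def gcd_pos_int)
  then have aN: "a \<le> int N" using N1 by (intro zdvd_imp_le) auto
  obtain u v where uv: "u * B + v * int N = a" using bezout_int[of B "int N"] by (auto simp: a_def)
  define t where "t = y powi u * \<xi> powi v"
  have t_nz: "t \<noteq> 0" using y_nz \<xi> by (simp add: t_def)
  have D\<xi>_nz: "D \<xi> \<noteq> 0" using D\<xi> \<xi> units_nz by simp
  have c0: "c0 \<in> units" "c0 \<noteq> 0" using f units_nz by (auto simp: good_def)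
  \<comment> \<open>The logarithmic derivative is scaled so that \<open>lg \<xi> = 1\<close>; this
    makes \<open>lg\<close> record orders as integers, up to multiples of
    \<open>\<xi>\<close>.\<close>
  define lg where "lg z = D z / z * (\<xi> / D \<xi>)" for z
  have lg_mult: "lg (z * w) = lg z + lg w" if "z \<noteq> 0" "w \<noteq> 0" for z w
    using dlog_mult[OF that] by (simp only: lg_def distrib_right)
  have lg_powi: "lg (z powi n) = of_int n * lg z" if "z \<noteq> 0" for z n
    using dlog_powi[OF that, of n] by (simp only: lg_def mult.assoc)
  have lg_power: "lg (z ^ n) = of_nat n * lg z" if "z \<noteq> 0" for z n
    using lg_powi[OF that, of "int n"] by simp
  have lg_\<xi>: "lg \<xi> = 1" using \<xi> D\<xi>_nz by (simp add: lg_def)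
  have lg_good: "\<exists>z\<in>R. lg c = \<xi> * z" if "good c" for c
  proof
    show "lg c = \<xi> * (D c / D \<xi> * inverse c)" by (simp add: lg_def divide_inverse)
    show "D c / D \<xi> * inverse c \<in> R" using that by (intro R_mult) (auto simp: good_def units_inverse_R)
  qed
  obtain z0 where z0: "z0 \<in> R" "lg c0 = \<xi> * z0" using lg_good f by blast
  have lg_y: "of_nat N * lg y = of_int B + \<xi> * z0"
  proof -
    have "of_nat N * lg y = lg (px f)" using lg_power[OF y_nz, of N] by (simp add: y_pow)
    then show ?thesis using c0 \<xi> by (simp add: f lg_mult lg_powi lg_\<xi> z0)
  qed
  have N_unit: "of_nat N \<in> units" by (rule of_nat_unit) simp
  have N_nz: "of_nat N \<noteq> (0 :: 'f)" using N_unit units_nz by blast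
  have tN: "t ^ N = \<xi> powi a * c0 powi u"
  proof -
    have "t ^ N = (y ^ N) powi u * \<xi> powi (v * int N)"
      by (simp add: t_def power_int_mult_distrib mult.commute flip: power_int_of_nat power_int_mult)
    also have "(y ^ N) powi u = \<xi> powi (B * u) * c0 powi u"
      by (simp add: y_pow f power_int_mult_distrib power_int_mult)
    finally show ?thesis using \<xi> uv by (simp add: power_int_add flip: uv) (simp add: ac_simps)
  qed
  have t_R: "t \<in> R"
    using power_nonunit_iff[OF \<xi> unit_powi[OF c0(1)], of a u] a power_N_R_iff[of t] by (simp add: tN)
  have lg_t: "lg t \<in> units"
  proof -
    have "of_nat N * lg t = of_int u * (of_nat N * lg y) + of_int v * of_nat N"
      using y_nz \<xi> by (simp add: t_def lg_mult lg_powi lg_\<xi> algebra_simps)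
    also have "\<dots> = of_int (u * B + v * int N) + (of_int u * z0) * \<xi>"
      by (simp add: lg_y algebra_simps)
    \<comment> \<open>The integer a divides N, hence is nonzero in K and a unit of R, while the
      remaining term lies in the maximal ideal.\<close>
    also have "\<dots> = of_nat (nat a) + (of_int u * z0) * \<xi>" using a by (simp add: uv)
    also have "\<dots> \<in> units"
    proof (intro unit_add_nonunit nonunit_mult[OF \<xi>(1)] R_mult of_int_R z0 of_nat_unit)
      show "nat a dvd N" using a by (metis int_dvd_int_iff int_nat_eq less_imp_le)
    qed
    finally have "inverse (of_nat N) * (of_nat N * lg t) \<in> units"
      by (rule unit_mult[OF unit_inverse[OF N_unit]])
    then show ?thesis using N_nz by (simp add: mult.assoc[symmetric])
  qed
  have hN: "h ^ N = \<xi> powi (int N * k - int s * B) * (c ^ N * c0 powi (- int s))"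
    if h: "h * y ^ s = \<xi> powi k * c" for h k s c
  proof -
    have "h ^ N * (y ^ N) ^ s = (\<xi> powi k * c) ^ N"
      using h by (metis mult.commute power_mult power_mult_distrib)
    then have "h ^ N * (\<xi> powi B * c0) ^ s = (\<xi> powi k * c) ^ N" by (simp add: y_pow f)
    then have "h ^ N = (\<xi> powi k * c) ^ N / (\<xi> powi B * c0) ^ s"
      using \<xi> c0 by (simp add: nonzero_eq_divide_eq)
    also have "\<dots> = \<xi> powi (k * int N) / \<xi> powi (B * int s) * (c ^ N / c0 ^ s)"
      by (simp add: power_mult_distrib power_int_mult)
    also have "\<xi> powi (k * int N) / \<xi> powi (B * int s) = \<xi> powi (int N * k - int s * B)"
      using \<xi> by (simp add: power_int_diff mult.commute)
    finally show ?thesis by (simp add: power_int_minus divide_inverse)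
  qed
  \<comment> \<open>E is R t D\<xi> / \<xi>, which equals R D t because \<open>lg t\<close> is a
    unit. It will turn out to be the whole module of regular forms at R.\<close>
  define E where "E = {z. z * (\<xi> / D \<xi>) / t \<in> R}"
  have "forms_module R \<subseteq> E"
  proof (rule forms_module_upper)
    show "0 \<in> E" by (simp add: E_def R_0)
    show "z + w \<in> E" if "z \<in> E" "w \<in> E" for z w
      using R_add that by (simp add: E_def distrib_right add_divide_distrib)
    show "z * w \<in> E" if "z \<in> R" "w \<in> E" for z w
      using R_mult that by (simp add: E_def mult.assoc flip: times_divide_eq_right)
  next
    fix h s assume hs: "h \<in> R" "h * y ^ s \<in> L"
    show "D h \<in> E"
    proof (cases "h = 0")
      case True
      then show ?thesis by (simp add: E_def D_0 R_0)
    next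
      case False
      then obtain k c where kc: "h * y ^ s = \<xi> powi k * c" "good c"
        using rep[OF hs(2)] y_nz by auto
      then have c: "c \<in> units" "c \<noteq> 0" using units_nz by (auto simp: good_def)
      obtain z where z: "z \<in> R" "lg c = \<xi> * z" using lg_good kc(2) by blast
      define e where "e = int N * k - int s * B"
      have un: "c ^ N * c0 powi (- int s) \<in> units"
        using c c0 by (intro unit_mult unit_power unit_powi)
      have "h ^ N \<in> R" using hs R_power by blast
      then have e0: "e \<ge> 0" using power_nonunit_iff[OF \<xi> un] by (simp add: hN[OF kc(1)] e_def)
      have "lg (h * y ^ s) = lg (\<xi> powi k * c)" by (simp only: kc(1))
      then have "lg h + of_nat s * lg y = of_int k + \<xi> * z"
        using False y_nz \<xi> c by (simp add: lg_mult lg_power lg_powi lg_\<xi> z)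
      then have "lg h = of_int k + \<xi> * z - of_nat s * lg y" by (simp add: eq_diff_eq)
      then have "of_nat N * lg h = of_nat N * (of_int k + \<xi> * z) - of_nat s * (of_nat N * lg y)"
        by (simp add: right_diff_distrib mult.left_commute)
      also have "\<dots> = of_int e + \<xi> * (of_nat N * z - of_nat s * z0)"
        by (simp add: lg_y e_def algebra_simps)
      finally have lgh: "of_nat N * lg h = \<dots>" .
      have zz: "of_nat N * z - of_nat s * z0 \<in> R" using z z0 by (intro R_diff R_mult of_nat_R)
      \<comment> \<open>Here e is the order of h^N and a multiple of a. If e = 0, the integer part
        of N \<open>lg h\<close> vanishes and its factor \<open>\<xi>\<close> compensates 1/t,
        because a \<le> N. If e > 0, then e \<ge> a and h / t itself lies in R.\<close>
      have "h / t * (of_nat N * lg h) \<in> R"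
      proof (cases "e = 0")
        case True
        have "(\<xi> / t) ^ N = \<xi> ^ N / (\<xi> powi a * c0 powi u)"
          by (simp add: power_divide tN)
        also have "\<dots> = \<xi> powi (int N - a) * c0 powi (- u)"
          using \<xi> by (simp add: power_int_diff power_int_minus divide_inverse)
        also have "\<dots> \<in> R" using power_nonunit_iff[OF \<xi> unit_powi[OF c0(1)]] aN by simp
        finally have "\<xi> / t \<in> R" by (simp add: power_N_R_iff)
        then have "h * (\<xi> / t) * (of_nat N * z - of_nat s * z0) \<in> R" using hs zz by (intro R_mult)
        then show ?thesis using True by (simp add: lgh mult.assoc)
      next
        case False
        have "a dvd e" using a by (auto simp: e_def intro: dvd_diff dvd_mult)
        then have "a \<le> e" using False e0 by (intro zdvd_imp_le) auto
        have "(h / t) ^ N = \<xi> powi e * (c ^ N * c0 powi (- int s)) / (\<xi> powi a * c0 powi u)"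
          by (simp add: power_divide tN hN[OF kc(1)] e_def)
        also have "\<dots> = \<xi> powi (e - a) * (c ^ N * c0 powi (- int s) * c0 powi (- u))"
          using \<xi> by (simp add: power_int_diff power_int_minus divide_inverse)
        also have "\<dots> \<in> R"
          using power_nonunit_iff[OF \<xi> unit_mult[OF un unit_powi[OF c0(1)]]] \<open>a \<le> e\<close> by simp
        finally have "h / t \<in> R" by (simp add: power_N_R_iff)
        then show ?thesis unfolding lgh
          using zz nonunits_R[OF \<xi>(1)] by (intro R_mult[OF \<open>h / t \<in> R\<close>] R_add R_mult of_int_R)
      qed
      then have "h / t * lg h \<in> R"
        using R_mult_unit_iff[OF N_unit, of "h / t * lg h"] by (simp add: ac_simps)
      moreover have "h / t * lg h = D h * (\<xi> / D \<xi>) / t" using False by (simp add: lg_def)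
      ultimately show ?thesis by (simp add: E_def)
    qed
  qed
  moreover have "E \<subseteq> forms_module R"
  proof
    fix z assume "z \<in> E"
    then have "z * (\<xi> / D \<xi>) / t \<in> R" by (simp only: E_def mem_Collect_eq)
    then have "z * (\<xi> / D \<xi>) / t * inverse (lg t) \<in> R"
      by (rule R_mult[OF _ units_inverse_R[OF lg_t]])
    then have "z * (\<xi> / D \<xi>) / t * inverse (lg t) * D t \<in> forms_module R"
      using t_R by (rule forms_module_I)
    moreover have "D t = lg t * (t * (D \<xi> / \<xi>))"
      using t_nz \<xi> D\<xi>_nz by (simp add: lg_def)
    then have "z * (\<xi> / D \<xi>) / t * inverse (lg t) * D t = z"
      using t_nz \<xi> D\<xi>_nz units_nz[OF lg_t] by simp
    ultimately show "z \<in> forms_module R" by simp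
  qed
  ultimately have "h \<in> forms_module R \<longleftrightarrow> h * (\<xi> / D \<xi>) / t \<in> R" by (auto simp: E_def)
  also have "\<dots> \<longleftrightarrow> (h * (\<xi> / D \<xi>) / t) ^ N \<in> R" by (simp add: power_N_R_iff)
  \<comment> \<open>Contributions to the exponent: N k - s B from h, N from \<open>\<xi>\<close>, -
    N \<open>\<rho>\<close> from D \<open>\<xi>\<close>, and - a from t.\<close>
  also have "(h * (\<xi> / D \<xi>) / t) ^ N =
      \<xi> powi (int N * k - int s * B + int N - int N * \<rho> - a) *
      (c ^ N * c0 powi (- int s) * inverse (\<eta> ^ N) * c0 powi (- u))"
  proof -
    have "D \<xi> ^ N = \<eta> ^ N * \<xi> powi (int N * \<rho>)"
      by (simp add: D\<xi> power_int_mult_distrib mult.commute flip: power_int_of_nat power_int_mult)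
    then have "(h * (\<xi> / D \<xi>) / t) ^ N =
        \<xi> powi (int N * k - int s * B) * (c ^ N * c0 powi (- int s)) *
        (\<xi> powi int N / (\<eta> ^ N * \<xi> powi (int N * \<rho>))) / (\<xi> powi a * c0 powi u)"
      by (simp add: power_divide power_mult_distrib tN hN[OF h(1)])
    moreover have "\<xi> powi (int N * k - int s * B + int N - int N * \<rho> - a) =
        \<xi> powi (int N * k - int s * B) * \<xi> powi int N / \<xi> powi (int N * \<rho>) / \<xi> powi a"
      using \<xi> by (simp only: power_int_diff power_int_add simp_thms)
    then have "\<xi> powi (int N * k - int s * B) * (c ^ N * c0 powi (- int s)) *
        (\<xi> powi int N / (\<eta> ^ N * \<xi> powi (int N * \<rho>))) / (\<xi> powi a * c0 powi u) =
        \<xi> powi (int N * k - int s * B + int N - int N * \<rho> - a) *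
        (c ^ N * c0 powi (- int s) * inverse (\<eta> ^ N) * c0 powi (- u))"
      by (simp add: power_int_minus divide_inverse)
    ultimately show ?thesis by simp
  qed
  also have "\<dots> \<in> R \<longleftrightarrow> int N * k - int s * B + int N - int N * \<rho> - a \<ge> 0"
    using h(2) c0 D\<xi>(2)
    by (intro power_nonunit_iff[OF \<xi>] unit_mult unit_power unit_powi unit_inverse) auto
  finally show ?thesis by (simp add: a_def)
qed

end

section \<open>Regular eigenfunctions\<close>

text \<open>The right side is the inequality of \<open>ramified\<close> for B = A_j and \<rho> = 0,
  so \<open>e_num\<close> is the least admissible order of g at \<lambda>_j.\<close>

lemma e_num_le_iff:
  assumes "N \<ge> 1"
  shows "e_num N A s j \<le> m \<longleftrightarrow> int N * m - int s * int (A j) + int N - gcd (int (A j)) (int N) \<ge> 0"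
proof -
  have "e_num N A s j \<le> m \<longleftrightarrow>
      (of_nat (s * A j) + of_nat (gcd N (A j))) / of_nat N - (1 :: rat) \<le> of_int m"
    by (simp only: e_num_def ceiling_le_iff)
  also have "\<dots> \<longleftrightarrow> of_nat (s * A j) + of_nat (gcd N (A j)) \<le> (of_int m + 1) * (of_nat N :: rat)"
    using assms by (simp add: diff_le_eq pos_divide_le_eq)
  also have "\<dots> \<longleftrightarrow> of_int (int (s * A j) + int (gcd N (A j))) \<le> (of_int ((m + 1) * int N) :: rat)"
    by simp
  also have "\<dots> \<longleftrightarrow> int (s * A j) + int (gcd N (A j)) \<le> (m + 1) * int N"
    by (simp only: of_int_le_iff)
  finally show ?thesis by (simp add: algebra_simps gcd.commute)
qed

text \<open>The bound before truncation at 0, as the condition at infinity produces it.\<close>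

definition d_signed :: "nat \<Rightarrow> nat \<Rightarrow> (nat \<Rightarrow> nat) \<Rightarrow> nat \<Rightarrow> int" where
  "d_signed N r A s =
     \<lfloor>(of_nat (s * (\<Sum>k\<le>r. A k)) - of_int (gcd (int N) (int N - (\<Sum>k\<le>r. int (A k)))))
       / (of_nat N :: rat)\<rfloor> - (\<Sum>j\<le>r. e_num N A s j)"

lemma d_num_eq: "d_num N r A s = max 0 (d_signed N r A s)"
  by (simp add: d_num_def d_signed_def)

text \<open>For m = deg p + 1 the right side is the inequality of \<open>ramified\<close> at
  infinity, with B = - deg f, \<rho> = 2 and order - deg p - (sum of the
  \<open>e_num\<close>).\<close>

lemma le_d_signed_iff:
  assumes "N \<ge> 1"
  shows "m \<le> d_signed N r A s \<longleftrightarrow>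
    int s * (\<Sum>k\<le>r. int (A k)) - gcd (- (\<Sum>k\<le>r. int (A k))) (int N) - int N * (m + (\<Sum>j\<le>r. e_num N A s j)) \<ge> 0"
proof -
  let ?S = "\<Sum>k\<le>r. A k" and ?g = "gcd (int N) (int N - (\<Sum>k\<le>r. int (A k)))"
    and ?e = "\<Sum>j\<le>r. e_num N A s j"
  have g: "?g = gcd (- (\<Sum>k\<le>r. int (A k))) (int N)"
    using gcd_add1[of "int N" "- (\<Sum>k\<le>r. int (A k))"]
    by (metis add.commute gcd.commute gcd_add2 uminus_add_conv_diff)
  have "m \<le> d_signed N r A s \<longleftrightarrow>
      m + ?e \<le> \<lfloor>(of_nat (s * ?S) - of_int ?g) / (of_nat N :: rat)\<rfloor>"
    by (simp only: d_signed_def le_diff_eq)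
  also have "\<dots> \<longleftrightarrow> of_int (m + ?e) \<le> (of_nat (s * ?S) - of_int ?g) / (of_nat N :: rat)"
    by (simp only: le_floor_iff)
  also have "\<dots> \<longleftrightarrow> of_int (m + ?e) * (of_nat N :: rat) \<le> of_nat (s * ?S) - of_int ?g"
    using assms by (simp add: pos_le_divide_eq)
  also have "\<dots> \<longleftrightarrow> (of_int ((m + ?e) * int N) :: rat) \<le> of_int (int (s * ?S) - ?g)"
    by simp
  also have "\<dots> \<longleftrightarrow> (m + ?e) * int N \<le> int (s * ?S) - ?g"
    by (simp only: of_int_le_iff)
  finally show ?thesis by (simp add: g algebra_simps)
qed

lemma prod_power_int:
  "a \<noteq> 0 \<Longrightarrow> (\<Prod>j\<in>J. a powi g j) = a powi (\<Sum>j\<in>J. g j)" for a :: "'a::field"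
  by (induction J rule: infinite_finite_induct) (auto simp: power_int_add)

context superelliptic
begin

text \<open>The factor with minimal admissible order at every \<lambda>_j; dividing by it turns
  regularity at all finite places into the absence of poles.\<close>

definition branch_prod :: "nat \<Rightarrow> 'f" where
  "branch_prod s = (\<Prod>j\<le>r. (x - \<iota> (lam j)) powi e_num N A s j)"

lemma branch_prod_nz: "branch_prod s \<noteq> 0"
  using x_minus_nz by (auto simp: branch_prod_def)

lemma branch_prod_L: "branch_prod s \<in> L"
  unfolding branch_prod_def by (intro subring_prod[OF L_subring] L_powi L_diff L_x L_const)

end

context superelliptic_place
begin

lemma zero_in_forms_module: "0 \<in> forms_module R"
  using forms_module_I[OF R_0 R_0] by simp

text \<open>After all factors x - c are removed, the cofactor is congruent to a nonzero constant
  modulo the maximal ideal, hence a unit.\<close>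

lemma px_order_at:
  assumes x: "x \<in> R" and c: "x - \<iota> c \<in> nonunits" and p: "p \<noteq> 0"
  shows "\<exists>k q. px p = (x - \<iota> c) ^ k * px q \<and> px q \<in> units"
proof -
  obtain q where q: "p = [:- c, 1:] ^ order c p * q" "\<not> [:- c, 1:] dvd q"
    using order_decomp[OF p] by blast
  have "poly (q - [:poly q c:]) c = 0" by simp
  then obtain q' where "q - [:poly q c:] = [:- c, 1:] * q'" by (metis poly_eq_0_iff_dvd dvdE)
  then have "q = [:poly q c:] + [:- c, 1:] * q'" by (simp add: diff_eq_eq add.commute)
  then have "px q = px ([:poly q c:] + [:- c, 1:] * q')" by simp
  also have "\<dots> = \<iota> (poly q c) + px q' * (x - \<iota> c)"
    unfolding hom_add[OF px_hom] hom_mult[OF px_hom] px_const px_linear by (simp add: mult.commute)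
  also have "\<dots> \<in> units"
    using q(2) c x by (intro unit_add_nonunit const_unit nonunit_mult px_R) (auto simp: poly_eq_0_iff_dvd)
  finally have "px q \<in> units" .
  moreover have "px p = (x - \<iota> c) ^ order c p * px q"
    using arg_cong[OF q(1), of px] by (simp only: hom_mult[OF px_hom] hom_power[OF px_hom] px_linear)
  ultimately show ?thesis by blast
qed

text \<open>At a branch point the exponent of \<open>branch_prod\<close> is exactly the least one
  allowed by \<open>ramified\<close>, so what remains is that G has order at least 0. Elsewhere y
  and \<open>branch_prod\<close> are units and \<open>unramified\<close> applies.\<close>

lemma finite_place:
  assumes x: "x \<in> R" and s: "s < N" and G: "G \<in> L" and h: "h * y ^ s = G * branch_prod s"
  shows "h \<in> forms_module R \<longleftrightarrow> G \<in> R"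
proof (cases "\<forall>j\<le>r. x - \<iota> (lam j) \<in> units")
  case True
  have hL: "h * y ^ s \<in> L" using h G branch_prod_L by (simp add: L_mult)
  have "h \<in> forms_module R \<longleftrightarrow> h \<in> R"
    using True x by (intro unramified(1)[OF _ _ hL]) auto
  also have "\<dots> \<longleftrightarrow> h * y ^ s \<in> R"
    using unramified(2)[OF x _ hL] True by (intro R_mult_unit_iff[symmetric] unit_power) auto
  also have "\<dots> \<longleftrightarrow> G \<in> R"
    unfolding h branch_prod_def using True by (intro R_mult_unit_iff unit_prod unit_powi) auto
  finally show ?thesis .
next
  case False
  then obtain j where j: "j \<le> r" "x - \<iota> (lam j) \<notin> units" by blast
  define \<xi> where "\<xi> = x - \<iota> (lam j)"
  have \<xi>: "\<xi> \<in> nonunits" "\<xi> \<noteq> 0"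
    using j R_cases[of \<xi>] R_diff[OF x const_R] x_minus_nz by (auto simp: \<xi>_def)
  have D\<xi>: "D \<xi> = 1" by (simp add: \<xi>_def D_diff D_x D_const)
  have other: "x - \<iota> (lam i) \<in> units" if "i \<le> r" "i \<noteq> j" for i
  proof -
    \<comment> \<open>x - \<lambda>_i is a nonzero constant plus the nonunit \<open>\<xi>\<close>,
      so a place lies above at most one branch point.\<close>
    have "lam j - lam i \<noteq> 0" using inj_lam that j by (auto simp: inj_on_def)
    then have "\<iota> (lam j - lam i) + \<xi> \<in> units" by (intro unit_add_nonunit const_unit \<xi>)
    then show ?thesis by (simp add: \<xi>_def hom_diff[OF \<iota>_hom])
  qed
  have rep: "\<exists>k c. g = \<xi> powi k * c \<and> c \<in> units \<and> D c / D \<xi> \<in> R" if "g \<in> L" "g \<noteq> 0" for g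
  proof -
    obtain p q where pq: "g = px p / px q" "q \<noteq> 0" using \<open>g \<in> L\<close> by (auto simp: L_def)
    then have "p \<noteq> 0" using \<open>g \<noteq> 0\<close> by (auto simp: hom_0[OF px_hom])
    obtain k p' where p': "px p = \<xi> ^ k * px p'" "px p' \<in> units"
      using px_order_at[OF x _ \<open>p \<noteq> 0\<close>] \<xi> unfolding \<xi>_def by blast
    obtain l q' where q': "px q = \<xi> ^ l * px q'" "px q' \<in> units"
      using px_order_at[OF x _ \<open>q \<noteq> 0\<close>] \<xi> unfolding \<xi>_def by blast
    have "g = \<xi> powi (int k - int l) * (px p' / px q')"
      using \<xi> by (simp add: pq p' q' power_int_diff)
    moreover have "D (px p' / px q') / D \<xi> \<in> R"
      using quotient_derivative_R[OF x q'(2)] by (simp add: D\<xi>)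
    moreover have "px p' / px q' \<in> units" using p' q' by (intro unit_divide)
    ultimately show ?thesis by blast
  qed
  show ?thesis
  proof (cases "G = 0")
    case True
    then have "h = 0" using h y_nz by simp
    then show ?thesis using True by (simp add: zero_in_forms_module R_0)
  next
    case G0: False
    obtain k c where kc: "G = \<xi> powi k * c" "c \<in> units" using rep[OF G G0] by blast
    define f0 where "f0 = px (\<Prod>i\<in>{..r} - {j}. [:- lam i, 1:] ^ A i)"
    have f0: "f0 \<in> units"
      unfolding f0_def hom_prod[OF px_hom] hom_power[OF px_hom] px_linear
      using other by (intro unit_prod unit_power) auto
    have f: "px f = \<xi> powi int (A j) * f0"
      unfolding px_f f0_def hom_prod[OF px_hom] hom_power[OF px_hom] px_linear \<xi>_def
      using j(1) by (subst prod.remove[of _ j]) auto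
    have Df0: "D f0 / D \<xi> \<in> R" by (simp add: D\<xi> f0_def px_pderiv px_R x)
    define b where "b = (\<Prod>i\<in>{..r} - {j}. (x - \<iota> (lam i)) powi e_num N A s i)"
    have b: "b \<in> units" unfolding b_def using other by (intro unit_prod unit_powi) auto
    have "branch_prod s = \<xi> powi e_num N A s j * b"
      unfolding branch_prod_def b_def \<xi>_def using j(1) by (subst prod.remove[of _ j]) auto
    then have hy: "h * y ^ s = \<xi> powi (k + e_num N A s j) * (c * b)"
      using \<xi> by (simp add: h kc power_int_add ac_simps)
    have "h \<in> forms_module R \<longleftrightarrow>
        int N * (k + e_num N A s j) - int s * int (A j) + int N - int N * 0 - gcd (int (A j)) (int N) \<ge> 0"
    proof (rule ramified[OF \<xi> _ f _ _ one_unit s hy unit_mult[OF kc(2) b]])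
      show "D \<xi> = 1 * \<xi> powi 0" by (simp add: D\<xi>)
    qed (use rep f0 Df0 in auto)
    also have "\<dots> \<longleftrightarrow> e_num N A s j \<le> k + e_num N A s j"
      by (simp only: e_num_le_iff[OF N1] mult_zero_right diff_0_right)
    also have "\<dots> \<longleftrightarrow> k \<ge> 0" by simp
    also have "\<dots> \<longleftrightarrow> G \<in> R" unfolding kc(1) by (rule power_nonunit_iff[OF \<xi> kc(2), symmetric])
    finally show ?thesis .
  qed
qed

lemma px_at_infinity: "px p = x ^ degree p * eval_hom \<iota> (inverse x) (reflect_poly p)"
  using eval_hom_reflect_poly[OF \<iota>_hom, of "inverse x" p] x_nz by (simp add: px_def power_inverse)

text \<open>An application of \<open>ramified\<close> with \<open>\<xi>\<close> = 1/x, where D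
  \<open>\<xi>\<close> = - \<open>\<xi>\<close>^2 gives \<rho> = 2 and f has order B = - deg
  f.\<close>

lemma infinite_place:
  assumes x: "x \<notin> R" and s: "s < N" and p: "p \<noteq> 0" and h: "h * y ^ s = px p * branch_prod s"
  shows "h \<in> forms_module R \<longleftrightarrow> int (degree p) < d_signed N r A s"
proof -
  define \<xi> where "\<xi> = inverse x"
  define ev where "ev = eval_hom \<iota> \<xi>"
  have ev_hom: "unital_hom ev" unfolding ev_def by (rule unital_hom_eval_hom[OF \<iota>_hom])
  have \<xi>: "\<xi> \<in> nonunits" "\<xi> \<noteq> 0" using x x_nz by (auto simp: \<xi>_def nonunits_def)
  have x_eq: "x = inverse \<xi>" by (simp add: \<xi>_def)
  have D\<xi>: "D \<xi> = (-1) * \<xi> powi 2"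
    using D_inverse[of x] by (simp add: \<xi>_def D_x divide_inverse power_inverse power_int_def)
  have ev_pCons: "ev (pCons c p) = \<iota> c + \<xi> * ev p" for c p
    by (simp add: ev_def eval_hom_pCons[OF \<iota>_hom])
  have ev_R: "ev p \<in> R" for p
    by (induction p) (auto simp: hom_0[OF ev_hom] R_0 ev_pCons intro!: R_add[OF const_R R_mult[OF nonunits_R[OF \<xi>(1)]]])
  have ev_unit: "ev p \<in> units" if "coeff p 0 \<noteq> 0" for p
  proof (cases p)
    case (pCons c q)
    then have "\<iota> c + ev q * \<xi> \<in> units"
      using that by (intro unit_add_nonunit const_unit nonunit_mult \<xi> ev_R) auto
    then show ?thesis by (simp add: pCons ev_pCons mult.commute)
  qed
  have ev_D: "D (ev p) = D \<xi> * ev (pderiv p)" for p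
    by (induction p)
      (auto simp: hom_0[OF ev_hom] D_0 ev_pCons D_add D_mult D_const pderiv_pCons hom_add[OF ev_hom]
        hom_0[OF \<iota>_hom] algebra_simps)
  have D\<xi>_nz: "D \<xi> \<noteq> 0" using D\<xi> \<xi> by simp
  \<comment> \<open>Reversing p moves its leading coefficient to the constant term, so for p
    \<noteq> 0 the second factor is a unit and the order is - deg p.\<close>
  have px_ev: "px p = \<xi> powi (- int (degree p)) * ev (reflect_poly p)" for p
    using px_at_infinity[of p] \<xi> by (simp add: ev_def \<xi>_def power_int_minus power_inverse)
  have rep: "\<exists>k c. g = \<xi> powi k * c \<and> c \<in> units \<and> D c / D \<xi> \<in> R" if "g \<in> L" "g \<noteq> 0" for g
  proof -
    obtain p q where pq: "g = px p / px q" "q \<noteq> 0" using \<open>g \<in> L\<close> by (auto simp: L_def)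
    then have "p \<noteq> 0" using \<open>g \<noteq> 0\<close> by (auto simp: hom_0[OF px_hom])
    let ?p = "ev (reflect_poly p)" and ?q = "ev (reflect_poly q)"
    have u: "?p \<in> units" "?q \<in> units" using \<open>p \<noteq> 0\<close> \<open>q \<noteq> 0\<close> by (auto intro!: ev_unit)
    have "g = \<xi> powi (- int (degree p)) / \<xi> powi (- int (degree q)) * (?p / ?q)"
      unfolding pq(1) px_ev by (simp only: times_divide_times_eq)
    then have "g = \<xi> powi (int (degree q) - int (degree p)) * (?p / ?q)"
      using \<xi> by (simp add: power_int_diff power_int_minus divide_inverse mult.commute)
    moreover have "D (?p / ?q) / D \<xi> \<in> R"
    proof -
      let ?d = "?p * (- ev (pderiv (reflect_poly q)) * inverse ?q ^ 2) + ev (pderiv (reflect_poly p)) * inverse ?q"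
      have "D (?p * inverse ?q) = D \<xi> * ?d"
        unfolding D_mult D_inverse ev_D by (simp add: divide_inverse power_inverse algebra_simps)
      then have "D (?p * inverse ?q) / D \<xi> = ?d" using D\<xi>_nz by simp
      also have "\<dots> \<in> R" using u by (intro R_add R_mult R_uminus ev_R R_power units_inverse_R)
      finally show ?thesis by (simp add: divide_inverse)
    qed
    ultimately show ?thesis using unit_divide[OF u] by blast
  qed
  define S where "S = (\<Sum>k\<le>r. int (A k))"
  have "int (degree f) = S"
    unfolding f_def S_def by (subst degree_prod_eq_sum_degree) (auto simp: degree_power_eq)
  then have f: "px f = \<xi> powi (- S) * ev (reflect_poly f)" using px_ev[of f] by simp
  have f0: "ev (reflect_poly f) \<in> units" "D (ev (reflect_poly f)) / D \<xi> \<in> R"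
    using f_nz D\<xi>_nz by (auto intro!: ev_unit ev_R simp: ev_D)
  define e where "e = (\<Sum>j\<le>r. e_num N A s j)"
  define b where "b = (\<Prod>j\<le>r. ev [:1, - lam j:] powi e_num N A s j)"
  have b: "b \<in> units" unfolding b_def by (intro unit_prod unit_powi ev_unit) auto
  have "branch_prod s = (\<Prod>j\<le>r. \<xi> powi (- e_num N A s j) * ev [:1, - lam j:] powi e_num N A s j)"
    unfolding branch_prod_def
  proof (rule prod.cong)
    fix j
    have "x - \<iota> (lam j) = inverse \<xi> * ev [:1, - lam j:]"
      using \<xi> by (simp add: ev_pCons hom_0[OF ev_hom] hom_1[OF \<iota>_hom] hom_uminus[OF \<iota>_hom] x_eq algebra_simps)
    then show "(x - \<iota> (lam j)) powi e_num N A s j =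
        \<xi> powi (- e_num N A s j) * ev [:1, - lam j:] powi e_num N A s j"
      by (simp add: power_int_mult_distrib power_int_minus power_int_inverse)
  qed simp
  also have "\<dots> = \<xi> powi (- e) * b"
    unfolding prod.distrib b_def e_def
    using \<xi> by (simp add: prod_power_int sum_negf)
  finally have hy: "h * y ^ s = \<xi> powi (- int (degree p) - e) * (ev (reflect_poly p) * b)"
    using \<xi> by (simp add: h px_ev[of p] power_int_diff power_int_minus divide_inverse ac_simps)
  \<comment> \<open>N - 2 N leaves - N, which is absorbed as the summand 1 in deg p + 1 and makes
    the degree bound strict.\<close>
  have "h \<in> forms_module R \<longleftrightarrow>
      int N * (- int (degree p) - e) - int s * (- S) + int N - int N * 2 - gcd (- S) (int N) \<ge> 0"
    by (rule ramified[OF \<xi> _ f _ D\<xi> unit_uminus[OF one_unit] s hy unit_mult[OF ev_unit b]])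
      (use rep f0 p in auto)
  also have "\<dots> \<longleftrightarrow> int (degree p) + 1 \<le> d_signed N r A s"
    unfolding le_d_signed_iff[OF N1] S_def[symmetric] e_def[symmetric] by (simp add: algebra_simps)
  finally show ?thesis by (simp add: add1_zle_eq)
qed

end

context superelliptic
begin

section \<open>Existence of places\<close>

lemma place_I:
  assumes "R \<in> places \<iota>"
  shows "superelliptic_place N r A lam f \<iota> x y R"
proof -
  have "subring_set R" "\<And>h. h \<in> R \<or> inverse h \<in> R" "range \<iota> \<subseteq> R"
    using assms by (auto simp: places_def)
  then show ?thesis by unfold_locales auto
qed

text \<open>Chevalley's theorem for the ring K[z]. Omitting 1/t also ensures that the valuation ring
  is not all of F.\<close>

lemma place_above:
  assumes "t \<in> range (eval_hom \<iota> z)" "inverse t \<notin> range (eval_hom \<iota> z)"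
  shows "\<exists>R\<in>places \<iota>. z \<in> R \<and> inverse t \<notin> R"
proof -
  obtain R where R: "subring_set R" "range (eval_hom \<iota> z) \<subseteq> R" "inverse t \<notin> R"
    "\<forall>h. h \<in> R \<or> inverse h \<in> R"
    using exists_valuation_ring[OF subring_range_hom[OF unital_hom_eval_hom[OF \<iota>_hom]] assms] by blast
  have "\<iota> c \<in> R" for c
    using R(2) eval_hom_const[OF \<iota>_hom, of z c] by (metis rangeI subsetD)
  moreover have "eval_hom \<iota> z [:0, 1:] = z"
    by (simp add: eval_hom_pCons[OF \<iota>_hom] eval_hom_0[OF \<iota>_hom] hom_0[OF \<iota>_hom] hom_1[OF \<iota>_hom])
  then have "z \<in> R" using R(2) by (metis rangeI subsetD)
  ultimately show ?thesis using R unfolding places_def by blast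
qed

text \<open>A nonconstant polynomial is not invertible in K[x]. Such a place rules out q as a
  reduced denominator of a regular G.\<close>

lemma finite_place_exists:
  assumes "degree q \<noteq> 0"
  shows "\<exists>R\<in>places \<iota>. x \<in> R \<and> inverse (px q) \<notin> R"
proof (rule place_above)
  show "px q \<in> range (eval_hom \<iota> x)" by (simp add: px_def)
  show "inverse (px q) \<notin> range (eval_hom \<iota> x)"
  proof
    assume "inverse (px q) \<in> range (eval_hom \<iota> x)"
    then obtain p where "inverse (px q) = px p" by (auto simp: px_def)
    moreover have "px q \<noteq> 0" using assms px_eq_0_iff by auto
    ultimately have "px (q * p) = px 1"
      by (simp add: hom_mult[OF px_hom] hom_1[OF px_hom]) (metis right_inverse)
    then have "q * p = 1" by (simp only: px_eq_iff)
    then show False using assms by (metis dvd_triv_left is_unit_iff_degree one_neq_zero mult_zero_left)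
  qed
qed

lemma infinite_place_exists: "\<exists>R\<in>places \<iota>. x \<notin> R"
proof -
  let ?E = "eval_hom \<iota> (inverse x)"
  have "x \<notin> range ?E"
  proof
    assume "x \<in> range ?E"
    then obtain q where q: "x = ?E q" by blast
    \<comment> \<open>Multiplying x = q(1/x) by x^(deg q) would equate a polynomial of degree at
      most deg q with x^(deg q + 1).\<close>
    have "px (reflect_poly q) = x ^ degree q * ?E q"
      unfolding px_def by (rule eval_hom_reflect_poly[OF \<iota>_hom x_nz])
    also have "\<dots> = px ([:0, 1:] ^ Suc (degree q))"
      unfolding hom_power[OF px_hom] px_var q[symmetric] by (simp add: mult.commute)
    finally have "reflect_poly q = [:0, 1:] ^ Suc (degree q)" by (simp only: px_eq_iff)
    then have "degree (reflect_poly q) = Suc (degree q)" by (simp only: degree_linear_power)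
    then show False using degree_reflect_poly_le[of q] by linarith
  qed
  moreover have "?E [:0, 1:] = inverse x"
    by (simp add: eval_hom_pCons[OF \<iota>_hom] eval_hom_0[OF \<iota>_hom] hom_0[OF \<iota>_hom] hom_1[OF \<iota>_hom])
  ultimately show ?thesis
    using place_above[of "inverse x" "inverse x"] by (metis inverse_inverse_eq rangeI)
qed

section \<open>Global regularity and its compatibility with the group action\<close>

definition regular_coefficients :: "'f set" where
  "regular_coefficients = {h. \<forall>R\<in>places \<iota>. h \<in> forms_module R}"

text \<open>G = h y^s / \<open>branch_prod\<close> has no pole where x is finite, and a nonconstant
  reduced denominator would produce one, so G is a polynomial; infinity bounds its degree.
  Conversely every place either contains x or does not, and the two local criteria cover both
  cases.\<close>

theorem regular_eigenfunction_iff: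
  assumes s: "s < N"
  shows "h \<in> regular_coefficients \<and> h * y ^ s \<in> L \<longleftrightarrow>
    (\<exists>p. (p = 0 \<or> int (degree p) < d_signed N r A s) \<and> h * y ^ s = px p * branch_prod s)"
proof
  assume *: "h \<in> regular_coefficients \<and> h * y ^ s \<in> L"
  define G where "G = h * y ^ s / branch_prod s"
  have G: "G \<in> L" "h * y ^ s = G * branch_prod s"
    using * branch_prod_L branch_prod_nz by (simp_all add: G_def L_divide)
  have GR: "G \<in> R" if R: "R \<in> places \<iota>" "x \<in> R" for R
  proof -
    interpret superelliptic_place N r A lam f \<iota> x y R by (rule place_I[OF R(1)])
    show ?thesis using * R finite_place[OF R(2) s G] by (simp add: regular_coefficients_def)
  qed
  \<comment> \<open>One place above infinity suffices, since the criterion there depends only on the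
    degree of p.\<close>
  obtain R0 where R0: "R0 \<in> places \<iota>" "x \<notin> R0" using infinite_place_exists by blast
  interpret inf: superelliptic_place N r A lam f \<iota> x y R0 by (rule place_I[OF R0(1)])
  obtain p q a b where pq: "q \<noteq> 0" "G = px p / px q" "a * p + b * q = 1"
    using inf.L_coprime[OF G(1)] by blast
  have "degree q = 0"
  proof (rule ccontr)
    assume "degree q \<noteq> 0"
    then obtain R where R: "R \<in> places \<iota>" "x \<in> R" "inverse (px q) \<notin> R"
      using finite_place_exists by blast
    interpret fin: superelliptic_place N r A lam f \<iota> x y R by (rule place_I[OF R(1)])
    have "px q \<in> fin.units"
      using fin.coprime_unit[OF R(2) pq(1) _ pq(3)] GR[OF R(1,2)] pq(2) by simp
    then show False using R(3) fin.units_inverse_R by blast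
  qed
  then obtain c where c: "q = [:c:]" by (metis degree_eq_zeroE)
  have "G = px (smult (inverse c) p)"
    using hom_mult[OF px_hom, of "[:inverse c:]" p]
    by (simp add: pq(2) c px_const hom_inverse[OF \<iota>_hom] divide_inverse)
  then obtain p where p: "G = px p" by blast
  have "p = 0 \<or> int (degree p) < d_signed N r A s"
    using inf.infinite_place[OF R0(2) s, of p h] * R0 G(2) p by (auto simp: regular_coefficients_def)
  then show "\<exists>p. (p = 0 \<or> int (degree p) < d_signed N r A s) \<and> h * y ^ s = px p * branch_prod s"
    using G(2) p by blast
next
  assume "\<exists>p. (p = 0 \<or> int (degree p) < d_signed N r A s) \<and> h * y ^ s = px p * branch_prod s"
  then obtain p where p: "p = 0 \<or> int (degree p) < d_signed N r A s" "h * y ^ s = px p * branch_prod s"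
    by blast
  have "h \<in> forms_module R" if R: "R \<in> places \<iota>" for R
  proof -
    interpret superelliptic_place N r A lam f \<iota> x y R by (rule place_I[OF R])
    show ?thesis
    proof (cases "p = 0")
      case True
      then have "h = 0" using p(2) y_nz by (simp add: hom_0[OF px_hom])
      then show ?thesis by (simp add: zero_in_forms_module)
    next
      case False
      then show ?thesis
        using finite_place[OF _ s L_px p(2)] infinite_place[OF _ s False p(2)] px_R p(1) by blast
    qed
  qed
  then show "h \<in> regular_coefficients \<and> h * y ^ s \<in> L"
    using p(2) by (simp add: regular_coefficients_def L_mult L_px branch_prod_L)
qed

lemma forms_module_add:
  assumes R: "subring_set R" and ab: "a \<in> forms_module R" "b \<in> forms_module R"
  shows "a + b \<in> forms_module R"
proof -
  obtain S u where a: "a = (\<Sum>z\<in>S. u z * D z)" "finite S" "S \<subseteq> R" "u ` S \<subseteq> R"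
    using ab(1) by (auto simp: forms_module_def)
  obtain T v where b: "b = (\<Sum>z\<in>T. v z * D z)" "finite T" "T \<subseteq> R" "v ` T \<subseteq> R"
    using ab(2) by (auto simp: forms_module_def)
  define w where "w z = (if z \<in> S then u z else 0) + (if z \<in> T then v z else 0)" for z
  have "(\<Sum>z\<in>S \<union> T. w z * D z) = (\<Sum>z\<in>S \<union> T. (if z \<in> S then u z * D z else 0)) + (\<Sum>z\<in>S \<union> T. (if z \<in> T then v z * D z else 0))"
    unfolding sum.distrib[symmetric] by (intro sum.cong refl) (simp add: w_def distrib_right)
  also have "(\<Sum>z\<in>S \<union> T. (if z \<in> S then u z * D z else 0)) = a"
    unfolding a(1) using a(2) b(2) by (intro sum.mono_neutral_cong_right) auto
  also have "(\<Sum>z\<in>S \<union> T. (if z \<in> T then v z * D z else 0)) = b"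
    unfolding b(1) using a(2) b(2) by (intro sum.mono_neutral_cong_right) auto
  finally have "a + b = (\<Sum>z\<in>S \<union> T. w z * D z)" by simp
  moreover have "w ` (S \<union> T) \<subseteq> R"
    using subsetD[OF a(4) imageI] subsetD[OF b(4) imageI] subring_0[OF R]
    by (auto simp: w_def intro!: subring_add[OF R])
  ultimately show ?thesis using a b unfolding forms_module_def by blast
qed

lemma forms_module_scale:
  assumes R: "subring_set R" and c: "c \<in> R" and a: "a \<in> forms_module R"
  shows "c * a \<in> forms_module R"
proof -
  obtain S u where a: "a = (\<Sum>z\<in>S. u z * D z)" "finite S" "S \<subseteq> R" "u ` S \<subseteq> R"
    using a by (auto simp: forms_module_def)
  have "c * a = (\<Sum>z\<in>S. (c * u z) * D z)" by (simp add: a(1) sum_distrib_left mult.assoc)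
  then show ?thesis
    unfolding forms_module_def using a c
    by (auto intro!: exI[of _ S] exI[of _ "\<lambda>z. c * u z"] subring_mult[OF R])
qed

lemma regular_coefficients_add:
  "a \<in> regular_coefficients \<Longrightarrow> b \<in> regular_coefficients \<Longrightarrow> a + b \<in> regular_coefficients"
  by (auto simp: regular_coefficients_def places_def intro: forms_module_add)

lemma regular_coefficients_scale:
  "a \<in> regular_coefficients \<Longrightarrow> \<iota> c * a \<in> regular_coefficients"
  by (auto simp: regular_coefficients_def places_def intro!: forms_module_scale)

lemma regular_coefficients_sum:
  "(\<And>i. i \<in> I \<Longrightarrow> g i \<in> regular_coefficients) \<Longrightarrow> sum g I \<in> regular_coefficients"
proof (induction I rule: infinite_finite_induct)
  have "\<iota> 0 * 0 \<in> regular_coefficients"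
    using superelliptic_place.zero_in_forms_module[OF place_I]
    by (auto simp: regular_coefficients_def)
  then have *: "0 \<in> regular_coefficients" by simp
  { case (infinite A) then show ?case using * by simp }
  { case empty then show ?case using * by simp }
qed (auto intro: regular_coefficients_add)

text \<open>The preimage of a place under the automorphism is again a place. A representation of h
  there is carried to one of its image at R because the automorphism commutes with
  \<open>D\<close>.\<close>

lemma \<sigma>_regular:
  assumes \<zeta>: "\<zeta> \<in> \<mu>" and h: "h \<in> regular_coefficients"
  shows "\<sigma> \<zeta> h \<in> regular_coefficients"
  unfolding regular_coefficients_def
proof (intro CollectI ballI)
  fix R assume R: "R \<in> places \<iota>"
  note hom = \<sigma>_hom[OF \<zeta>]
  let ?R = "{z. \<sigma> \<zeta> z \<in> R}"
  have "?R \<in> places \<iota>"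
  proof -
    obtain z where z: "z \<notin> R" using R by (auto simp: places_def)
    have "\<sigma> (inverse \<zeta>) z \<notin> ?R" using z \<sigma>_inverse(1)[OF \<zeta>] by simp
    then have "?R \<noteq> UNIV" by blast
    then show ?thesis
      using R \<zeta> by (auto simp: places_def subring_set_def hom_1[OF hom] hom_diff[OF hom] hom_mult[OF hom]
          hom_inverse[OF hom] \<sigma>_const)
  qed
  then have "h \<in> forms_module ?R" using h by (simp add: regular_coefficients_def)
  then obtain S u where S: "h = (\<Sum>z\<in>S. u z * D z)" "finite S" "S \<subseteq> ?R" "u ` S \<subseteq> ?R"
    by (auto simp: forms_module_def)
  have inj: "inj_on (\<sigma> \<zeta>) S" by (auto simp: inj_on_def hom_eq_iff[OF hom])
  have "\<sigma> \<zeta> h = (\<Sum>z\<in>S. \<sigma> \<zeta> (u z) * D (\<sigma> \<zeta> z))"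
    by (simp add: S(1) hom_sum[OF hom] hom_mult[OF hom] \<sigma>_D[OF \<zeta>])
  also have "\<dots> = (\<Sum>z\<in>\<sigma> \<zeta> ` S. \<sigma> \<zeta> (u (\<sigma> (inverse \<zeta>) z)) * D z)"
    by (simp add: sum.reindex[OF inj] \<sigma>_inverse(2)[OF \<zeta>])
  finally show "\<sigma> \<zeta> h \<in> forms_module R"
    unfolding forms_module_def using S(2-4)
    by (intro CollectI exI[of _ "\<sigma> \<zeta> ` S"] exI[of _ "\<lambda>z. \<sigma> \<zeta> (u (\<sigma> (inverse \<zeta>) z))"])
      (auto simp: \<sigma>_inverse(2)[OF \<zeta>])
qed

lemma proj_regular:
  assumes "h \<in> regular_coefficients"
  shows "proj s h \<in> regular_coefficients"
proof -
  have "proj s h = (\<Sum>\<zeta>\<in>\<mu>. \<iota> (\<zeta> ^ s / of_nat N) * \<sigma> \<zeta> h)"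
    by (simp add: proj_def sum_divide_distrib hom_divide[OF \<iota>_hom] hom_power[OF \<iota>_hom] hom_of_nat[OF \<iota>_hom])
  then show ?thesis
    using assms by (auto intro!: regular_coefficients_sum regular_coefficients_scale \<sigma>_regular)
qed

end

section \<open>Kaehler differentials\<close>

lemma lookup_scale: "Poly_Mapping.lookup (Poly_Mapping.map (\<lambda>c. h * c) p) a = h * Poly_Mapping.lookup p a"
  for h :: "'f::field"
  by (simp add: Poly_Mapping.map.rep_eq when_def)

lemma module_poly_mapping: "Modules.module (\<lambda>h. Poly_Mapping.map (\<lambda>c. h * c) :: ('a \<Rightarrow>\<^sub>0 'f::field) \<Rightarrow> _)"
  by unfold_locales
    (rule poly_mapping_eqI, simp only: lookup_scale lookup_add, simp add: algebra_simps)+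

context
  fixes scale :: "'f::field \<Rightarrow> 'w::ab_group_add \<Rightarrow> 'w" and d :: "'f \<Rightarrow> 'w"
  assumes vs: "vector_space scale"
begin

interpretation vector_space scale by (rule vs)

lemma free_to_forms_superset:
  assumes "finite S" "Poly_Mapping.keys p \<subseteq> S"
  shows "free_to_forms scale d p = (\<Sum>a\<in>S. scale (Poly_Mapping.lookup p a) (d a))"
  unfolding free_to_forms_def using assms
  by (intro sum.mono_neutral_left) (auto simp: in_keys_iff)

lemma free_to_forms_add: "free_to_forms scale d (p + q) = free_to_forms scale d p + free_to_forms scale d q"
proof -
  let ?S = "Poly_Mapping.keys p \<union> Poly_Mapping.keys q"
  have "Poly_Mapping.keys (p + q) \<subseteq> ?S" by (rule Poly_Mapping.keys_add)
  then show ?thesis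
    by (simp add: free_to_forms_superset[of ?S] lookup_add scale_left_distrib sum.distrib)
qed

lemma free_to_forms_scale:
  "free_to_forms scale d (Poly_Mapping.map (\<lambda>c. h * c) p) = scale h (free_to_forms scale d p)"
proof -
  let ?S = "Poly_Mapping.keys p"
  have "Poly_Mapping.keys (Poly_Mapping.map (\<lambda>c. h * c) p) \<subseteq> ?S"
    by (auto simp: in_keys_iff lookup_scale)
  then show ?thesis
    by (simp add: free_to_forms_superset[of ?S] lookup_scale scale_sum_right)
qed

lemma free_to_forms_diff: "free_to_forms scale d (p - q) = free_to_forms scale d p - free_to_forms scale d q"
  using free_to_forms_add[of "p - q" q] by simp

lemma free_to_forms_single: "free_to_forms scale d (Poly_Mapping.single a c) = scale c (d a)"
  by (subst free_to_forms_superset[of "{a}"]) auto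

lemma free_to_forms_span:
  assumes "\<And>p. p \<in> B \<Longrightarrow> free_to_forms scale d p = 0"
    and "p \<in> module.span (\<lambda>h. Poly_Mapping.map (\<lambda>c. h * c)) B"
  shows "free_to_forms scale d p = 0"
proof -
  interpret pm: Modules.module "\<lambda>h. Poly_Mapping.map (\<lambda>c. h * c) :: ('f \<Rightarrow>\<^sub>0 'f) \<Rightarrow> _"
    by (rule module_poly_mapping)
  have "pm.subspace {p. free_to_forms scale d p = 0}"
    unfolding pm.subspace_def
    by (auto simp: free_to_forms_add free_to_forms_scale) (simp add: free_to_forms_def)
  then have "pm.span B \<subseteq> {p. free_to_forms scale d p = 0}"
    using assms(1) by (intro pm.span_minimal) auto
  then show ?thesis using assms(2) by blast
qed

end

locale superelliptic_forms = superelliptic N r A lam f \<iota> x y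
  for N r :: nat and A :: "nat \<Rightarrow> nat" and lam :: "nat \<Rightarrow> 'k::field" and f :: "'k poly"
    and \<iota> :: "'k \<Rightarrow> 'f::field" and x y :: 'f +
  fixes scale :: "'f \<Rightarrow> 'w::ab_group_add \<Rightarrow> 'w" and d :: "'f \<Rightarrow> 'w"
  assumes kaehler: "kaehler_differentials \<iota> scale d"
begin

lemma vs: "vector_space scale"
  using kaehler by (simp add: kaehler_differentials_def)

interpretation vector_space scale by (rule vs)

lemma relation_zero:
  assumes "p \<in> kaehler_relations \<iota>"
  shows "free_to_forms scale d p = 0"
proof -
  interpret pm: Modules.module "\<lambda>h. Poly_Mapping.map (\<lambda>c. h * c) :: ('f \<Rightarrow>\<^sub>0 'f) \<Rightarrow> _"
    by (rule module_poly_mapping)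
  have "p \<in> pm.span (kaehler_relations \<iota>)" using assms by (rule pm.span_base)
  then show ?thesis using kaehler unfolding kaehler_differentials_def by blast
qed

lemma d_add: "d (a + b) = d a + d b"
proof -
  have "Poly_Mapping.single (a + b) 1 - Poly_Mapping.single a 1 - Poly_Mapping.single b 1 \<in> kaehler_relations \<iota>"
    by (auto simp: kaehler_relations_def)
  from relation_zero[OF this] show ?thesis
    by (simp add: free_to_forms_diff[OF vs] free_to_forms_single[OF vs] diff_eq_eq add.commute)
qed

lemma d_mult: "d (a * b) = scale a (d b) + scale b (d a)"
proof -
  have "Poly_Mapping.single (a * b) 1 - Poly_Mapping.single b a - Poly_Mapping.single a b \<in> kaehler_relations \<iota>"
    by (auto simp: kaehler_relations_def)
  from relation_zero[OF this] show ?thesis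
    by (simp add: free_to_forms_diff[OF vs] free_to_forms_single[OF vs] diff_eq_eq add.commute)
qed

lemma d_const: "d (\<iota> c) = 0"
proof -
  have "Poly_Mapping.single (\<iota> c) 1 \<in> kaehler_relations \<iota>"
    by (auto simp: kaehler_relations_def)
  from relation_zero[OF this] show ?thesis by (simp add: free_to_forms_single[OF vs])
qed

lemma d_1: "d 1 = 0"
  using d_const[of 1] by (simp add: hom_1[OF \<iota>_hom])

lemma d_diff: "d (a - b) = d a - d b"
  using d_add[of "a - b" b] by simp

lemma d_power: "d (a ^ n) = scale (of_nat n * a ^ (n - 1)) (d a)"
proof (induction n)
  case (Suc n)
  then show ?case
    by (cases n) (simp_all add: d_mult d_1 algebra_simps flip: scale_left_distrib)
qed (simp add: d_1)

lemma d_px: "d (px p) = scale (px (pderiv p)) (d x)"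
proof (induction p)
  case (pCons c p)
  then show ?case
    by (simp add: px_pCons d_add d_const d_mult pderiv_pCons hom_add[OF px_hom] hom_0[OF \<iota>_hom] scale_left_distrib)
qed (use d_const[of 0] in \<open>simp add: hom_0[OF px_hom] hom_0[OF \<iota>_hom]\<close>)

text \<open>Identifies F with the space of rational forms; bijectivity is \<open>form_eq_iff\<close>
  together with \<open>form_surj\<close>.\<close>

definition form :: "'f \<Rightarrow> 'w" where "form h = scale h (d x)"

text \<open>Both sides obey the same rules of differentiation, so the generators suffice. At y,
  differentiating y^N = f fixes d y after cancelling the nonzero factor N y^(N-1).\<close>

lemma d_eq: "d a = form (D a)"
proof (rule generated[where P = "\<lambda>a. d a = form (D a)"])
  show "d 1 = form (D 1)" "d x = form (D x)" "d (\<iota> c) = form (D (\<iota> c))" for c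
    by (simp_all add: form_def d_1 D_1 D_x d_const D_const)
  show "d (a - b) = form (D (a - b))" "d (a * b) = form (D (a * b))"
    if "d a = form (D a)" "d b = form (D b)" for a b
    using that by (simp_all add: form_def d_diff D_diff d_mult D_mult scale_left_diff_distrib scale_left_distrib mult.commute)
  show "d (inverse a) = form (D (inverse a))" if a: "d a = form (D a)" for a
  proof (cases "a = 0")
    case True
    then show ?thesis using a by simp
  next
    case False
    then have "scale a (d (inverse a)) = - scale (inverse a) (d a)"
      using d_mult[of a "inverse a"] by (simp add: d_1 eq_neg_iff_add_eq_0)
    then have "scale (inverse a) (scale a (d (inverse a))) = scale (inverse a) (- scale (inverse a) (d a))"
      by simp
    then show ?thesis
      using False a by (simp add: form_def D_inverse divide_inverse power2_eq_square ac_simps)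
  qed
  show "d y = form (D y)"
  proof -
    let ?c = "of_nat N * y ^ (N - 1)"
    have c: "?c \<noteq> 0" using of_nat_F_nz[of N] y_nz by simp
    have "scale ?c (d y) = scale (px (pderiv f)) (d x)"
      using d_power[of y N] d_px[of f] by (simp add: y_pow)
    also have "px (pderiv f) = ?c * D y"
    proof -
      have "D (y ^ N) / y ^ N = of_nat N * (D y / y)" by (rule dlog_power[OF y_nz])
      then have "D (y ^ N) = of_nat N * (D y / y) * y ^ N" using y_nz by (simp add: nonzero_divide_eq_eq)
      also have "\<dots> = of_nat N * (D y / y) * (y * y ^ (N - 1))"
        using N1 by (cases N) simp_all
      also have "\<dots> = ?c * D y" using y_nz by simp
      finally show ?thesis unfolding y_pow px_pderiv .
    qed
    finally have "scale ?c (d y) = scale ?c (form (D y))" by (simp add: form_def)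
    then show ?thesis using c by (simp only: scale_left_imp_eq)
  qed
qed

lemma form_add: "form (a + b) = form a + form b"
  by (simp add: form_def scale_left_distrib)

lemma form_0: "form 0 = 0"
  by (simp add: form_def)

lemma form_sum: "form (sum g S) = (\<Sum>i\<in>S. form (g i))"
  by (simp add: form_def scale_sum_left)

lemma scale_d: "scale h (d a) = form (h * D a)"
  by (simp add: d_eq[of a] form_def)

lemma K_scale_form: "K_scale \<iota> scale c (form h) = form (\<iota> c * h)"
  by (simp add: K_scale_def form_def)

text \<open>The F-linear map [a] to \<open>D a\<close> kills all Kaehler relations, hence their
  span, but sends [x] to 1. So [x] is not in the span, which is where the exact description of the
  kernel is used.\<close>

lemma dx_nz: "d x \<noteq> 0"
proof
  assume "d x = 0"
  then have "free_to_forms scale d (Poly_Mapping.single x 1) = 0"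
    by (simp add: free_to_forms_single[OF vs])
  then have span: "Poly_Mapping.single x 1 \<in> module.span (\<lambda>h. Poly_Mapping.map (\<lambda>c. h * c)) (kaehler_relations \<iota>)"
    using kaehler unfolding kaehler_differentials_def by blast
  have F: "vector_space ((*) :: 'f \<Rightarrow> 'f \<Rightarrow> 'f)"
    by unfold_locales (auto simp: algebra_simps)
  have "free_to_forms (*) D (Poly_Mapping.single x 1) = 0"
  proof (rule free_to_forms_span[OF F _ span])
    fix p assume "p \<in> kaehler_relations \<iota>"
    then show "free_to_forms (*) D p = 0"
      by (auto simp: kaehler_relations_def free_to_forms_diff[OF F] free_to_forms_single[OF F]
          D_add D_mult D_const)
  qed
  then show False by (simp add: free_to_forms_single[OF F] D_x)
qed

lemma form_eq_iff: "form a = form b \<longleftrightarrow> a = b"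
  using dx_nz by (simp add: form_def)

lemma form_surj: "\<exists>h. \<omega> = form h"
proof -
  obtain p where "\<omega> = free_to_forms scale d p"
    using kaehler unfolding kaehler_differentials_def by blast
  then have "\<omega> = form (\<Sum>a\<in>Poly_Mapping.keys p. Poly_Mapping.lookup p a * D a)"
    by (simp add: free_to_forms_def scale_d form_sum)
  then show ?thesis ..
qed

lemma form_in_image_iff: "form h \<in> form ` H \<longleftrightarrow> h \<in> H"
  using form_eq_iff by auto

lemma regular_forms_eq: "regular_forms \<iota> scale d = form ` regular_coefficients"
proof -
  have "regular_forms_at scale d R = form ` forms_module R" for R
    unfolding regular_forms_at_def forms_module_def
    by (auto simp: scale_d form_sum[symmetric] image_iff)
  then have "form h \<in> regular_forms \<iota> scale d \<longleftrightarrow> h \<in> regular_coefficients" for h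
    by (simp add: regular_forms_def regular_coefficients_def form_in_image_iff)
  then show ?thesis using form_surj by (metis (no_types, lifting) equalityI image_iff subsetI)
qed

text \<open>Resolves the definite descriptions in the action. A pullback exists because forms have
  unique coefficients and the automorphism commutes with \<open>D\<close>; it is unique because
  every form is h dx.\<close>

lemma root_action_form:
  assumes \<zeta>: "\<zeta> \<in> \<mu>"
  shows "root_action \<iota> x y scale d \<zeta> (form h) = form (\<sigma> (inverse \<zeta>) h)"
proof -
  let ?\<sigma> = "\<sigma> (inverse \<zeta>)"
  note inv = \<mu>_inverse[OF \<zeta>]
  note hom = \<sigma>_hom[OF inv]
  define T where "T \<omega> = form (?\<sigma> (THE h. \<omega> = form h))" for \<omega>
  have T: "T (form h) = form (?\<sigma> h)" for h
    unfolding T_def by (simp add: form_eq_iff)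
  have "pullback_form scale d ?\<sigma> = T"
    unfolding pullback_form_def
  proof (rule the_equality)
    have "T (\<omega> + \<eta>) = T \<omega> + T \<eta>" for \<omega> \<eta>
      using form_surj[of \<omega>] form_surj[of \<eta>] by (auto simp: T hom_add[OF hom] simp flip: form_add)
    moreover have "T (scale h (d a)) = scale (?\<sigma> h) (d (?\<sigma> a))" for h a
      by (simp add: scale_d T hom_mult[OF hom] \<sigma>_D[OF inv])
    ultimately show "(\<forall>\<omega> \<eta>. T (\<omega> + \<eta>) = T \<omega> + T \<eta>) \<and> (\<forall>h a. T (scale h (d a)) = scale (?\<sigma> h) (d (?\<sigma> a)))"
      by blast
  next
    fix T' assume T': "(\<forall>\<omega> \<eta>. T' (\<omega> + \<eta>) = T' \<omega> + T' \<eta>) \<and>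
      (\<forall>h a. T' (scale h (d a)) = scale (?\<sigma> h) (d (?\<sigma> a)))"
    show "T' = T"
    proof
      fix \<omega>
      obtain h where "\<omega> = form h" using form_surj by blast
      then show "T' \<omega> = T \<omega>" using T' by (simp add: T) (simp add: form_def \<sigma>_x[OF inv])
    qed
  qed
  then show ?thesis
    by (simp add: root_action_def pullback_fun_eq[OF \<zeta>] inv_\<sigma>[OF \<zeta>] T)
qed

definition eigen_coefficients :: "nat \<Rightarrow> 'f set" where
  "eigen_coefficients s = {h \<in> regular_coefficients. h * y ^ s \<in> L}"

text \<open>Since y^s has the opposite weight, the eigenvalue condition on h dx says that h y^s is
  invariant, that is, lies in K(x).\<close>

lemma character_space_eq: "character_space \<iota> N x y scale d s = form ` eigen_coefficients s"
proof -
  have "(\<forall>\<zeta>\<in>\<mu>. root_action \<iota> x y scale d \<zeta> (form h) = K_scale \<iota> scale (\<zeta> ^ s) (form h)) \<longleftrightarrow>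
      h * y ^ s \<in> L" for h
  proof
    assume *: "\<forall>\<zeta>\<in>\<mu>. root_action \<iota> x y scale d \<zeta> (form h) = K_scale \<iota> scale (\<zeta> ^ s) (form h)"
    show "h * y ^ s \<in> L"
    proof (rule fixed_L)
      fix \<zeta> assume \<zeta>: "\<zeta> \<in> \<mu>"
      \<comment> \<open>The hypothesis is used for the inverse of \<zeta>, because \<zeta> acts on
        forms through the automorphism of its inverse.\<close>
      then have "\<sigma> \<zeta> h = \<iota> (inverse \<zeta> ^ s) * h"
        using * \<mu>_inverse[OF \<zeta>] by (force simp: root_action_form K_scale_form form_eq_iff)
      then show "\<sigma> \<zeta> (h * y ^ s) = h * y ^ s"
        using \<mu>_nz[OF \<zeta>] by (simp add: hom_mult[OF \<sigma>_hom[OF \<zeta>]] hom_power[OF \<sigma>_hom[OF \<zeta>]] \<sigma>_y[OF \<zeta>]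
            hom_power[OF \<iota>_hom] hom_inverse[OF \<iota>_hom] power_mult_distrib hom_eq_0_iff[OF \<iota>_hom] power_inverse)
    qed
  next
    assume h: "h * y ^ s \<in> L"
    show "\<forall>\<zeta>\<in>\<mu>. root_action \<iota> x y scale d \<zeta> (form h) = K_scale \<iota> scale (\<zeta> ^ s) (form h)"
      using \<sigma>_eigen[OF \<mu>_inverse h]
      by (simp add: root_action_form K_scale_form form_eq_iff hom_power[OF \<iota>_hom] hom_inverse[OF \<iota>_hom]
          power_inverse divide_inverse mult.commute)
  qed
  then show ?thesis
    using form_surj
    unfolding character_space_def regular_forms_eq eigen_coefficients_def
    by (auto simp: form_in_image_iff)
qed

section \<open>The character spaces as vector spaces over K\<close>

lemma K_vs: "vector_space (K_scale \<iota> scale)"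
  by unfold_locales
    (simp_all add: K_scale_def scale_right_distrib scale_left_distrib hom_add[OF \<iota>_hom] hom_mult[OF \<iota>_hom] hom_1[OF \<iota>_hom])

lemma subspace_character_space:
  "module.subspace (K_scale \<iota> scale) (character_space \<iota> N x y scale d s)"
proof -
  interpret kv: vector_space "K_scale \<iota> scale" by (rule K_vs)
  have "0 \<in> eigen_coefficients s"
    using regular_coefficients_sum[of "{}"] L_px[of 0] by (simp add: eigen_coefficients_def hom_0[OF px_hom])
  moreover have "a + b \<in> eigen_coefficients s" if "a \<in> eigen_coefficients s" "b \<in> eigen_coefficients s" for a b
    using that regular_coefficients_add subring_add[OF L_subring]
    by (auto simp: eigen_coefficients_def distrib_right)
  moreover have "\<iota> c * a \<in> eigen_coefficients s" if "a \<in> eigen_coefficients s" for a c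
    using that regular_coefficients_scale L_mult[OF L_const]
    by (auto simp: eigen_coefficients_def mult.assoc)
  ultimately show ?thesis
    unfolding kv.subspace_def character_space_eq
    by (auto simp: K_scale_form form_in_image_iff simp flip: form_add) (metis form_0 imageI)
qed

lemma proj_add: "proj s (a + b) = proj s a + proj s b"
  by (simp add: proj_def hom_add[OF \<sigma>_hom] distrib_left sum.distrib add_divide_distrib)

lemma proj_sum: "proj s (\<Sum>i<(n::nat). g i) = (\<Sum>i<n. proj s (g i))"
proof (induction n)
  case 0
  then show ?case by (simp add: proj_def hom_0[OF \<sigma>_hom])
qed (simp add: proj_add)

text \<open>\<open>proj\<close> recovers each component from the sum, which gives injectivity;
  \<open>sum_proj\<close> writes any regular form as such a sum, and \<open>proj_regular\<close>
  keeps its components regular.\<close>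

lemma eigenspace_decomposition:
  "bij_betw (\<lambda>v. \<Sum>s<N. v s) (\<Pi>\<^sub>E s\<in>{..<N}. character_space \<iota> N x y scale d s) (regular_forms \<iota> scale d)"
proof (rule bij_betw_imageI)
  let ?P = "\<Pi>\<^sub>E s\<in>{..<N}. character_space \<iota> N x y scale d s"
  have ex: "\<exists>h. (\<forall>s<N. h s \<in> eigen_coefficients s \<and> v s = form (h s)) \<and>
      (\<Sum>s<N. v s) = form (\<Sum>s<N. h s) \<and> (\<forall>k<N. proj k (\<Sum>s<N. h s) = h k)" if v: "v \<in> ?P" for v
  proof -
    have "\<forall>s. \<exists>h. s < N \<longrightarrow> h \<in> eigen_coefficients s \<and> v s = form h"
      using v by (force simp: PiE_iff character_space_eq)
    then obtain h where h: "\<And>s. s < N \<Longrightarrow> h s \<in> eigen_coefficients s \<and> v s = form (h s)" by metis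
    have "proj k (\<Sum>s<N. h s) = h k" if "k < N" for k
    proof -
      have "proj k (\<Sum>s<N. h s) = (\<Sum>s<N. if k = s then h s else 0)"
        unfolding proj_sum using h that
        by (intro sum.cong refl) (auto simp: eigen_coefficients_def proj_eigen)
      then show ?thesis using that by simp
    qed
    then show ?thesis using h by (auto simp: form_sum)
  qed
  show "inj_on (\<lambda>v. \<Sum>s<N. v s) ?P"
  proof (rule inj_onI)
    fix v w assume v: "v \<in> ?P" and w: "w \<in> ?P" and eq: "(\<Sum>s<N. v s) = (\<Sum>s<N. w s)"
    obtain g where g: "\<And>s. s < N \<Longrightarrow> v s = form (g s)" "(\<Sum>s<N. v s) = form (\<Sum>s<N. g s)"
      "\<And>k. k < N \<Longrightarrow> proj k (\<Sum>s<N. g s) = g k" using ex[OF v] by blast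
    obtain h where h: "\<And>s. s < N \<Longrightarrow> w s = form (h s)" "(\<Sum>s<N. w s) = form (\<Sum>s<N. h s)"
      "\<And>k. k < N \<Longrightarrow> proj k (\<Sum>s<N. h s) = h k" using ex[OF w] by blast
    have "(\<Sum>s<N. g s) = (\<Sum>s<N. h s)" using eq g(2) h(2) form_eq_iff by simp
    then have "v s = w s" if "s < N" for s using that g(1,3) h(1,3) by metis
    then show "v = w" using v w by (intro PiE_ext) auto
  qed
  show "(\<lambda>v. \<Sum>s<N. v s) ` ?P = regular_forms \<iota> scale d"
  proof
    show "(\<lambda>v. \<Sum>s<N. v s) ` ?P \<subseteq> regular_forms \<iota> scale d"
    proof (rule image_subsetI)
      fix v assume v: "v \<in> ?P"
      obtain h where h: "\<And>s. s < N \<Longrightarrow> h s \<in> eigen_coefficients s" "(\<Sum>s<N. v s) = form (\<Sum>s<N. h s)"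
        using ex[OF v] by blast
      then have "(\<Sum>s<N. h s) \<in> regular_coefficients"
        by (intro regular_coefficients_sum) (auto simp: eigen_coefficients_def)
      then show "(\<Sum>s<N. v s) \<in> regular_forms \<iota> scale d" by (simp add: h regular_forms_eq)
    qed
  next
    show "regular_forms \<iota> scale d \<subseteq> (\<lambda>v. \<Sum>s<N. v s) ` ?P"
    proof
      fix \<omega> assume "\<omega> \<in> regular_forms \<iota> scale d"
      then obtain h where h: "\<omega> = form h" "h \<in> regular_coefficients" by (auto simp: regular_forms_eq)
      \<comment> \<open>Restriction makes the family extensional, as membership in the dependent
        product requires.\<close>
      let ?v = "restrict (\<lambda>s. form (proj s h)) {..<N}"
      have "?v \<in> ?P"
        using h(2) by (auto simp: character_space_eq eigen_coefficients_def proj_regular proj_L)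
      moreover have "(\<Sum>s<N. ?v s) = \<omega>"
        by (simp add: h(1) sum_proj flip: form_sum)
      ultimately show "\<omega> \<in> (\<lambda>v. \<Sum>s<N. v s) ` ?P" by (metis (no_types, lifting) image_eqI)
    qed
  qed
qed

lemma basis_form_eq: "basis_form \<iota> N r A lam x y scale d s m = form (x ^ m * branch_prod s / y ^ s)"
  by (simp add: basis_form_def form_def branch_prod_def)

text \<open>\<open>\<Phi>\<close> carries the polynomials of degree less than n, together with 0,
  isomorphically onto the character space and the monomials to the basis forms, so independence and
  spanning reduce to comparing coefficients.\<close>

lemma character_space_basis:
  assumes s: "s < N"
  shows "int (vector_space.dim (K_scale \<iota> scale) (character_space \<iota> N x y scale d s)) = d_num N r A s \<and>
      inj_on (basis_form \<iota> N r A lam x y scale d s) {m. int m \<le> d_num N r A s - 1} \<and>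
      \<not> module.dependent (K_scale \<iota> scale)
        (basis_form \<iota> N r A lam x y scale d s ` {m. int m \<le> d_num N r A s - 1}) \<and>
      module.span (K_scale \<iota> scale)
        (basis_form \<iota> N r A lam x y scale d s ` {m. int m \<le> d_num N r A s - 1})
        = character_space \<iota> N x y scale d s"
proof -
  interpret kv: vector_space "K_scale \<iota> scale" by (rule K_vs)
  define n where "n = nat (d_num N r A s)"
  have d_num: "d_num N r A s = int n" by (simp add: n_def d_num_eq)
  have I: "{m. int m \<le> d_num N r A s - 1} = {..<n}" by (auto simp: d_num)
  have n_iff: "int k < d_signed N r A s \<longleftrightarrow> k < n" for k by (auto simp: n_def d_num_eq)
  let ?b = "basis_form \<iota> N r A lam x y scale d s" and ?V = "character_space \<iota> N x y scale d s"
  define \<Phi> where "\<Phi> p = form (px p * branch_prod s / y ^ s)" for p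
  have \<Phi>_inj: "\<Phi> p = \<Phi> q \<longleftrightarrow> p = q" for p q
    using branch_prod_nz y_nz by (simp add: \<Phi>_def form_eq_iff px_eq_iff)
  have \<Phi>_0: "\<Phi> 0 = 0" by (simp add: \<Phi>_def form_0 hom_0[OF px_hom])
  have \<Phi>_sum: "\<Phi> (\<Sum>m<n. monom (c m) m) = (\<Sum>m<n. K_scale \<iota> scale (c m) (?b m))" for c
  proof -
    have "px (monom a m) = \<iota> a * x ^ m" for a m
      by (induction m) (simp_all add: monom_0 px_const monom_Suc px_pCons hom_0[OF \<iota>_hom] hom_0[OF px_hom])
    then show ?thesis
      by (simp add: \<Phi>_def basis_form_eq K_scale_form hom_sum[OF px_hom] sum_distrib_right sum_divide_distrib
          mult.assoc flip: form_sum)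
  qed
  have b_eq: "?b m = \<Phi> (monom 1 m)" if "m < n" for m
  proof -
    have "?b m = (\<Sum>k<n. K_scale \<iota> scale (if k = m then 1 else 0) (?b k))"
    proof -
      have "(\<Sum>k<n. K_scale \<iota> scale (if k = m then 1 else 0) (?b k)) = (\<Sum>k<n. if k = m then ?b k else 0)"
        by (intro sum.cong) auto
      then show ?thesis using that by simp
    qed
    also have "\<dots> = \<Phi> (\<Sum>k<n. monom (if k = m then 1 else 0) k)" by (rule \<Phi>_sum[symmetric])
    also have "(\<Sum>k<n. monom (if k = m then 1 else 0) k) = (\<Sum>k<n. if k = m then monom 1 k else (0 :: 'k poly))"
      by (intro sum.cong) auto
    also have "\<dots> = monom 1 m" using that by simp
    finally show ?thesis .
  qed
  \<comment> \<open>The zero polynomial has degree 0 by convention; it is listed separately so that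
    n = 0 still leaves the zero form.\<close>
  have V: "\<omega> \<in> ?V \<longleftrightarrow> (\<exists>p. (p = 0 \<or> degree p < n) \<and> \<omega> = \<Phi> p)" for \<omega>
  proof -
    obtain h where h: "\<omega> = form h" using form_surj by blast
    have "\<omega> \<in> ?V \<longleftrightarrow> (\<exists>p. (p = 0 \<or> int (degree p) < d_signed N r A s) \<and> h * y ^ s = px p * branch_prod s)"
      unfolding character_space_eq h form_in_image_iff eigen_coefficients_def mem_Collect_eq
      by (rule regular_eigenfunction_iff[OF s])
    moreover have "h * y ^ s = px p * branch_prod s \<longleftrightarrow> \<omega> = \<Phi> p" for p
      using y_nz by (simp add: h \<Phi>_def form_eq_iff nonzero_eq_divide_eq)
    ultimately show ?thesis by (simp add: n_iff)
  qed
  have inj: "inj_on ?b {..<n}"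
  proof (rule inj_onI)
    fix m m' assume "m \<in> {..<n}" "m' \<in> {..<n}" "?b m = ?b m'"
    then have "monom 1 m = (monom 1 m' :: 'k poly)" by (simp add: b_eq \<Phi>_inj)
    then show "m = m'" by (metis degree_monom_eq one_neq_zero)
  qed
  have indep: "\<not> kv.dependent (?b ` {..<n})"
  proof
    assume "kv.dependent (?b ` {..<n})"
    then obtain u where u: "\<exists>v\<in>?b ` {..<n}. u v \<noteq> 0" "(\<Sum>v\<in>?b ` {..<n}. K_scale \<iota> scale (u v) v) = 0"
      using kv.dependent_finite[of "?b ` {..<n}"] by auto
    have "\<Phi> (\<Sum>m<n. monom (u (?b m)) m) = 0"
      using u(2) unfolding sum.reindex[OF inj] \<Phi>_sum by (simp add: o_def)
    then have P: "(\<Sum>m<n. monom (u (?b m)) m) = 0" using \<Phi>_inj \<Phi>_0 by metis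
    have "u (?b m) = 0" if "m < n" for m
      using arg_cong[OF P, of "\<lambda>p. coeff p m"] that by (simp add: coeff_sum)
    then show False using u(1) by auto
  qed
  have span: "kv.span (?b ` {..<n}) = ?V"
  proof
    have "?b ` {..<n} \<subseteq> ?V"
      unfolding V image_subset_iff using b_eq by (auto simp: V degree_monom_eq intro!: exI[of _ "monom 1 _"])
    then show "kv.span (?b ` {..<n}) \<subseteq> ?V"
      by (rule kv.span_minimal[OF _ subspace_character_space])
    show "?V \<subseteq> kv.span (?b ` {..<n})"
    proof
      fix \<omega> assume "\<omega> \<in> ?V"
      then obtain p where p: "p = 0 \<or> degree p < n" "\<omega> = \<Phi> p" using V by blast
      have "p = (\<Sum>m<n. monom (coeff p m) m)"
        using p(1) by (intro poly_eqI) (auto simp: coeff_sum coeff_eq_0)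
      then have "\<omega> = (\<Sum>m<n. K_scale \<iota> scale (coeff p m) (?b m))" using p(2) \<Phi>_sum by metis
      also have "\<dots> \<in> kv.span (?b ` {..<n})"
        by (intro kv.span_sum kv.span_scale kv.span_base) auto
      finally show "\<omega> \<in> kv.span (?b ` {..<n})" .
    qed
  qed
  have "kv.dim ?V = n"
    using kv.dim_span_eq_card_independent[OF indep] inj by (simp add: card_image span)
  then show ?thesis using inj indep span by (simp only: I) (simp add: d_num)
qed

end

theorem theorem3p6:
  fixes N r :: nat
    and A :: "nat \<Rightarrow> nat"
    and lam :: "nat \<Rightarrow> 'k::field"
    and f :: "'k poly"
    and \<iota> :: "'k \<Rightarrow> 'f::field"
    and x y :: 'f
    and scale :: "'f \<Rightarrow> 'w::ab_group_add \<Rightarrow> 'w"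
    and d :: "'f \<Rightarrow> 'w"
  assumes "N \<ge> 1"
    and "\<not> CHAR('k) dvd N"
    and "\<forall>j\<le>r. A j \<ge> 1"
    and "inj_on lam {..r}"
    and "Gcd (insert N (A ` {..r})) = 1"
    and "f = (\<Prod>j\<le>r. [:- lam j, 1:] ^ A j)"
    and "(roots_of_unity N :: 'k alg_closure set) \<subseteq> range to_ac"
    and "superelliptic_function_field \<iota> N f x y"
    and "kaehler_differentials \<iota> scale d"
  shows "(\<forall>s<N. module.subspace (K_scale \<iota> scale) (character_space \<iota> N x y scale d s)) \<and>
    bij_betw (\<lambda>v. \<Sum>s<N. v s)
      (\<Pi>\<^sub>E s\<in>{..<N}. character_space \<iota> N x y scale d s) (regular_forms \<iota> scale d) \<and>
    (\<forall>s<N.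
      int (vector_space.dim (K_scale \<iota> scale) (character_space \<iota> N x y scale d s)) = d_num N r A s \<and>
      inj_on (basis_form \<iota> N r A lam x y scale d s) {m. int m \<le> d_num N r A s - 1} \<and>
      \<not> module.dependent (K_scale \<iota> scale)
        (basis_form \<iota> N r A lam x y scale d s ` {m. int m \<le> d_num N r A s - 1}) \<and>
      module.span (K_scale \<iota> scale)
        (basis_form \<iota> N r A lam x y scale d s ` {m. int m \<le> d_num N r A s - 1})
        = character_space \<iota> N x y scale d s)"
proof -
  interpret superelliptic_forms N r A lam f \<iota> x y scale d
    using assms by unfold_locales
  show ?thesis
    using subspace_character_space eigenspace_decomposition character_space_basis by blast
qed

end
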